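(* Let $\Omega\subset\mathbb{R}^n$ be a bounded connected strictly convex open domain with smooth boundary $\partial\Omega$ and diameter $D$. Let $B=(b^1,\dots,b^n)$ be a real $C^3$ vector-valued function on $\bar\Omega$ and $c$ a real $C^2$ function on $\bar\Omega$ with $c\ge 0$. Let $\beta=\sum_{i=1}^n b^i\,dx_i$, and suppose there is a constant $K$ such that $|d\beta(x)|\le K\,\mathrm{dist}(x,\partial\Omega)$ for all $x\in\Omega$. Consider the operator $$Lu=\Delta u-B\cdot\nabla u-cu$$ and the eigenvalue problem $Lu=-\lambda u$ on $\Omega$ with Dirichlet boundary condition $u=0$ on $\partial\Omega$, where $\lambda$ and $u$ may be complex. Let $\lambda_0$ be the principal eigenvalue with eigenfunction $u_0$. Then there is a constant $\sigma>0$, depending on $\|b^j\|_{C^2(\bar\Omega)}$, $\|\Delta b^j\|_{C^1(\bar\Omega)}$, $\|c\|_{C^2(\bar\Omega)}$, $K$ and on $u_0$, such that for every other eigenvalue $\lambda$, $$\mathrm{Re}(\lambda)-\lambda_0>\tfrac14(\mu_1-\mu_0)>0,$$ where $\mu_0<\mu_1$ are the first two eigenvalues of the Sturm-Liouville problem on $[-\frac D2,\frac D2]$: $$w''(s)+\sigma|s|\,w(s)=-\mu\, w(s),\qquad w(-\tfrac D2)=w(\tfrac D2)=0.$$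
   Context: The operator $L$ need not be symmetric. Its principal Dirichlet eigenvalue $\lambda_0$ is the real and simple eigenvalue whose eigenfunction $u_0$ can be taken positive in $\Omega$; $u_0$ vanishes on $\partial\Omega$ and satisfies $|\nabla u_0|\neq 0$ on $\partial\Omega$. All other eigenvalues are possibly complex. Dependence of $\sigma$ on $u_0$ (for the given domain $\Omega$): let $S$ be the set of critical points of $u_0$ in $\Omega$, $\delta_0=\frac12\inf_{x\in S}u_0(x)$, $\Omega_{\delta_0}=\{x\in\Omega: u_0(x)\ge\delta_0\}$, and $\theta_0=\inf_{x\in\Omega\setminus\Omega_{\delta_0}}|\nabla u_0(x)|>0$. The dependence on $u_0$ is a dependence on $\delta_0$, $\theta_0$ and $|\nabla u_0|_{C^1(\bar\Omega)}$. *)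

theory Defs
  imports "HOL-Analysis.Analysis"
begin

section \<open>Iterated partial derivatives and spaces of differentiable functions\<close>

definition partial_deriv :: "'n::finite \<Rightarrow> (real^'n \<Rightarrow> 'b::real_normed_vector) \<Rightarrow> real^'n \<Rightarrow> 'b" where
  "partial_deriv i f x = frechet_derivative f (at x) (axis i 1)"

primrec partial_derivs :: "'n::finite list \<Rightarrow> (real^'n \<Rightarrow> 'b::real_normed_vector) \<Rightarrow> real^'n \<Rightarrow> 'b" where
  "partial_derivs [] f = f"
| "partial_derivs (i # is) f = partial_deriv i (partial_derivs is f)"

definition grad :: "(real^'n::finite \<Rightarrow> real) \<Rightarrow> real^'n \<Rightarrow> real^'n" where
  "grad f x = (\<chi> i. partial_deriv i f x)"

definition laplacian :: "(real^'n::finite \<Rightarrow> 'b::real_normed_vector) \<Rightarrow> real^'n \<Rightarrow> 'b" where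
  "laplacian f x = (\<Sum>i\<in>UNIV. partial_deriv i (partial_deriv i f) x)"

text \<open>\<open>Ck_on k U f\<close>: the function is of class C^k on the open set U.\<close>

definition Ck_on :: "nat \<Rightarrow> (real^'n::finite) set \<Rightarrow> (real^'n \<Rightarrow> 'b::real_normed_vector) \<Rightarrow> bool" where
  "Ck_on k U f \<longleftrightarrow>
     (\<forall>is. length is < k \<longrightarrow> (\<forall>x\<in>U. partial_derivs is f differentiable (at x))) \<and>
     (\<forall>is. length is \<le> k \<longrightarrow> continuous_on U (partial_derivs is f))"

text \<open>\<open>Ck_closure k \<Omega> f\<close>: f is of class C^k on the closure of the open set \<open>\<Omega>\<close>, i.e. it is C^k in
  \<open>\<Omega>\<close>, continuous on the closure, and all its partial derivatives of order at most k extend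
  continuously from \<open>\<Omega>\<close> to the closure. The extension \<open>g\<close> is needed because the values of
  \<open>partial_derivs\<close> at boundary points depend on the irrelevant values of f outside the closure.\<close>

definition Ck_closure :: "nat \<Rightarrow> (real^'n::finite) set \<Rightarrow> (real^'n \<Rightarrow> 'b::real_normed_vector) \<Rightarrow> bool" where
  "Ck_closure k \<Omega> f \<longleftrightarrow>
     Ck_on k \<Omega> f \<and> continuous_on (closure \<Omega>) f \<and>
     (\<forall>is. length is \<le> k \<longrightarrow>
        (\<exists>g. continuous_on (closure \<Omega>) g \<and> (\<forall>x\<in>\<Omega>. g x = partial_derivs is f x)))"

text \<open>The C^k norm on the closure of \<open>\<Omega>\<close>. The suprema are taken over \<open>\<Omega>\<close>, which for functions in
  \<open>Ck_closure\<close> gives the same value as the maximum of the continuous extensions over the closure.\<close>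

definition Ck_norm :: "nat \<Rightarrow> (real^'n::finite) set \<Rightarrow> (real^'n \<Rightarrow> 'b::real_normed_vector) \<Rightarrow> real" where
  "Ck_norm k \<Omega> f =
     (\<Sum>m\<le>k. SUP (is, x) \<in> {is. length is = m} \<times> \<Omega>. norm (partial_derivs is f x))"

section \<open>Domains\<close>

definition strictly_convex :: "'a::euclidean_space set \<Rightarrow> bool" where
  "strictly_convex \<Omega> \<longleftrightarrow>
     (\<forall>x\<in>closure \<Omega>. \<forall>y\<in>closure \<Omega>. x \<noteq> y \<longrightarrow> open_segment x y \<subseteq> interior \<Omega>)"

text \<open>The boundary is smooth if near each of its points the domain is the sublevel set of a smooth
  function without critical points (so that \<open>\<Omega>\<close> lies locally on one side of its boundary).\<close>

definition smooth_boundary :: "(real^'n::finite) set \<Rightarrow> bool" where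
  "smooth_boundary \<Omega> \<longleftrightarrow>
     (\<forall>p\<in>frontier \<Omega>. \<exists>U \<rho>. open U \<and> p \<in> U \<and> (\<forall>k. Ck_on k U \<rho>) \<and>
        (\<forall>x\<in>U. grad \<rho> x \<noteq> 0) \<and> \<Omega> \<inter> U = {x\<in>U. \<rho> x < 0})"

section \<open>The operator and its Dirichlet eigenvalues\<close>

text \<open>The Euclidean norm of the 2-form \<open>d\<beta> = \<Sum>\<^sub>i\<^sub><\<^sub>j (\<partial>\<^sub>i b\<^sup>j - \<partial>\<^sub>j b\<^sup>i) dx\<^sub>i \<and> dx\<^sub>j\<close> for \<open>\<beta> = \<Sum>\<^sub>i b\<^sup>i dx\<^sub>i\<close>,
  with the \<open>dx\<^sub>i \<and> dx\<^sub>j\<close>, \<open>i < j\<close>, orthonormal. As the index type is not ordered, we sum over all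
  pairs and halve.\<close>

definition norm_d_beta :: "(real^'n::finite \<Rightarrow> real^'n) \<Rightarrow> real^'n \<Rightarrow> real" where
  "norm_d_beta B x =
     sqrt ((\<Sum>i\<in>UNIV. \<Sum>j\<in>UNIV.
        (partial_deriv i (\<lambda>y. B y $ j) x - partial_deriv j (\<lambda>y. B y $ i) x)\<^sup>2) / 2)"

definition L_op :: "(real^'n::finite \<Rightarrow> real^'n) \<Rightarrow> (real^'n \<Rightarrow> real) \<Rightarrow>
    (real^'n \<Rightarrow> complex) \<Rightarrow> real^'n \<Rightarrow> complex" where
  "L_op B c u x =
     laplacian u x - (\<Sum>i\<in>UNIV. of_real (B x $ i) * partial_deriv i u x) - of_real (c x) * u x"

text \<open>Classical solutions; by elliptic regularity these are the same as the weak ones.\<close>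

definition dirichlet_eigenfunction :: "(real^'n::finite) set \<Rightarrow> (real^'n \<Rightarrow> real^'n) \<Rightarrow>
    (real^'n \<Rightarrow> real) \<Rightarrow> complex \<Rightarrow> (real^'n \<Rightarrow> complex) \<Rightarrow> bool" where
  "dirichlet_eigenfunction \<Omega> B c lam u \<longleftrightarrow>
     Ck_on 2 \<Omega> u \<and> continuous_on (closure \<Omega>) u \<and>
     (\<exists>x\<in>\<Omega>. u x \<noteq> 0) \<and>
     (\<forall>x\<in>\<Omega>. L_op B c u x = - lam * u x) \<and>
     (\<forall>x\<in>frontier \<Omega>. u x = 0)"

definition dirichlet_eigenvalue :: "(real^'n::finite) set \<Rightarrow> (real^'n \<Rightarrow> real^'n) \<Rightarrow>
    (real^'n \<Rightarrow> real) \<Rightarrow> complex \<Rightarrow> bool" where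
  "dirichlet_eigenvalue \<Omega> B c lam \<longleftrightarrow> (\<exists>u. dirichlet_eigenfunction \<Omega> B c lam u)"

text \<open>The principal eigenvalue is the real eigenvalue having an eigenfunction \<open>u\<^sub>0\<close> that is positive
  in \<open>\<Omega>\<close>. By Krein--Rutman such an eigenvalue exists, is unique and is simple. Regularity up to the
  boundary of \<open>u\<^sub>0\<close>, automatic for smooth domains, is recorded because the C^1 norm of its gradient
  over the closure is used.\<close>

definition principal_eigenpair :: "(real^'n::finite) set \<Rightarrow> (real^'n \<Rightarrow> real^'n) \<Rightarrow>
    (real^'n \<Rightarrow> real) \<Rightarrow> real \<Rightarrow> (real^'n \<Rightarrow> real) \<Rightarrow> bool" where
  "principal_eigenpair \<Omega> B c lam\<^sub>0 u\<^sub>0 \<longleftrightarrow>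
     dirichlet_eigenfunction \<Omega> B c (of_real lam\<^sub>0) (\<lambda>x. of_real (u\<^sub>0 x)) \<and>
     Ck_closure 2 \<Omega> u\<^sub>0 \<and> (\<forall>x\<in>\<Omega>. 0 < u\<^sub>0 x)"

section \<open>The quantities through which the constant depends on the principal eigenfunction\<close>

definition critical_points :: "(real^'n::finite) set \<Rightarrow> (real^'n \<Rightarrow> real) \<Rightarrow> (real^'n) set" where
  "critical_points \<Omega> u\<^sub>0 = {x\<in>\<Omega>. grad u\<^sub>0 x = 0}"

definition delta0 :: "(real^'n::finite) set \<Rightarrow> (real^'n \<Rightarrow> real) \<Rightarrow> real" where
  "delta0 \<Omega> u\<^sub>0 = (1/2) * (INF x\<in>critical_points \<Omega> u\<^sub>0. u\<^sub>0 x)"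

definition superlevel :: "(real^'n::finite) set \<Rightarrow> (real^'n \<Rightarrow> real) \<Rightarrow> real \<Rightarrow> (real^'n) set" where
  "superlevel \<Omega> u\<^sub>0 \<delta> = {x\<in>\<Omega>. u\<^sub>0 x \<ge> \<delta>}"

definition theta0 :: "(real^'n::finite) set \<Rightarrow> (real^'n \<Rightarrow> real) \<Rightarrow> real" where
  "theta0 \<Omega> u\<^sub>0 = (INF x\<in>\<Omega> - superlevel \<Omega> u\<^sub>0 (delta0 \<Omega> u\<^sub>0). norm (grad u\<^sub>0 x))"

section \<open>The Sturm--Liouville comparison problem\<close>

text \<open>\<open>v\<close> is the derivative of \<open>w\<close>. The problem is self-adjoint, so its eigenvalues are real and have
  real eigenfunctions.\<close>

definition sl_eigenvalue :: "real \<Rightarrow> real \<Rightarrow> real \<Rightarrow> bool" where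
  "sl_eigenvalue D \<sigma> \<mu> \<longleftrightarrow>
     (\<exists>w v :: real \<Rightarrow> real.
        (\<forall>s\<in>{-D/2..D/2}.
           (w has_real_derivative v s) (at s within {-D/2..D/2}) \<and>
           (\<exists>w''. (v has_real_derivative w'') (at s within {-D/2..D/2}) \<and>
                  w'' + \<sigma> * \<bar>s\<bar> * w s = - \<mu> * w s)) \<and>
        w (-D/2) = 0 \<and> w (D/2) = 0 \<and> (\<exists>s\<in>{-D/2..D/2}. w s \<noteq> 0))"

text \<open>The pair \<open>\<mu>\<^sub>0 < \<mu>\<^sub>1\<close> is uniquely determined by this property.\<close>

definition sl_first_two_eigenvalues :: "real \<Rightarrow> real \<Rightarrow> real \<Rightarrow> real \<Rightarrow> bool" where
  "sl_first_two_eigenvalues D \<sigma> \<mu>\<^sub>0 \<mu>\<^sub>1 \<longleftrightarrow>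
     \<mu>\<^sub>0 < \<mu>\<^sub>1 \<and> {\<mu>. sl_eigenvalue D \<sigma> \<mu> \<and> \<mu> \<le> \<mu>\<^sub>1} = {\<mu>\<^sub>0, \<mu>\<^sub>1}"

end

theory Submission
  imports Defs
begin

text \<open>
  The potential \<open>-\<sigma>\<bar>s\<bar>\<close> of the comparison problem is a double well with its two minima at the ends of the
  interval. As \<open>\<sigma>\<close> grows, the first even and the first odd eigenfunction concentrate in these wells
  and differ only through what is left of them at the centre, so \<open>\<mu>\<^sub>1 - \<mu>\<^sub>0\<close> tends to 0
  (\<open>sl_gap_small\<close>). As \<open>\<sigma>\<close> may be as large as one likes, it is enough to bound \<open>Re \<lambda> - \<lambda>\<^sub>0\<close> from below by a
  positive number that depends only on \<open>\<Omega>\<close> and on the listed quantities (\<open>spectral_gap\<close>), and then to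
  take \<open>\<sigma>\<close> so large that a quarter of the Sturm--Liouville gap is smaller.

  For the bound let \<open>u\<close> be an eigenfunction for \<open>\<lambda>\<close> and \<open>w = u / u\<^sub>0\<close>. Then
  \<open>\<Delta>w + X\<cdot>\<nabla>w = -(\<lambda> - \<lambda>\<^sub>0) w\<close> with the drift \<open>X = 2\<nabla>log u\<^sub>0 - B\<close>. Suppose first that
  \<open>\<bar>w(y) - w(x)\<bar> / \<psi>(\<bar>x - y\<bar>)\<close> has an interior maximum \<open>M\<close>, where \<open>\<psi>\<close> is increasing and concave. Moving the
  two points along directions that are mirror images in the hyperplane orthogonal to \<open>y - x\<close> turns the
  second order conditions into a comparison of the two Laplacians (\<open>two_point_max_hessian\<close>), and
  the equation gives \<open>Re(\<lambda> - \<lambda>\<^sub>0) \<psi> \<ge> -(4\<psi>'' + F\<psi>')\<close>, provided that \<open>F\<close> bounds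
  \<open>(X(y) - X(x))\<cdot>(y - x)/\<bar>y - x\<bar>\<close> from above. For \<open>\<psi>(r) = 2 - exp(-\<kappa>r)\<close> and \<open>\<kappa> = \<bar>F\<bar> + 1\<close> the right-hand
  side is at least \<open>\<epsilon>\<psi>\<close> with an explicit \<open>\<epsilon> > 0\<close>.

  The maximum need not exist, because \<open>w\<close> is only known in the open domain. Subtracting \<open>\<eta>\<close> times a
  barrier \<open>1/u\<^sub>0 - A u\<^sub>0 + A'\<close> at both points repairs this: \<open>u\<close> vanishes on the boundary, so
  \<open>w\<close> is small compared with \<open>1/u\<^sub>0\<close> there, and the term \<open>- A u\<^sub>0\<close> makes the barrier
  an approximate supersolution, because \<open>\<bar>\<nabla>u\<^sub>0\<bar>\<close> is bounded below near the boundary. If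
  \<open>Re \<lambda> - \<lambda>\<^sub>0 < \<epsilon>\<close>, the maximum of the corrected quotient is at most a constant times \<open>\<eta>\<close>, because \<open>\<psi>(0) = 1\<close> is
  positive and so \<open>\<psi>\<close> is bounded below. Letting \<open>\<eta>\<close> tend to 0 shows that \<open>w\<close> is constant, and then
  \<open>\<lambda> = \<lambda>\<^sub>0\<close>.

  What remains is the bound \<open>F\<close>, that is, a one-sided bound for the differences of \<open>\<nabla>log u\<^sub>0\<close>
  (\<open>log_grad_modulus\<close>). Near the boundary \<open>u\<^sub>0\<close> is a positive multiple of the distance \<open>d\<close> up to an
  error of second order. Since \<open>\<Omega>\<close> lies on one side of the tangent hyperplane at the boundary point nearest to \<open>x\<close>,
  this gives \<open>-\<nabla>log u\<^sub>0(x)\<cdot>e \<le> (d(x) - d(y)) / (\<bar>x - y\<bar> d(x)) + C\<close> for \<open>e = (y - x)/\<bar>y - x\<bar>\<close>. Adding the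
  same inequality with \<open>x\<close> and \<open>y\<close> exchanged makes the sum of the singular terms nonpositive, because
  \<open>(a - b)/a + (b - a)/b \<le> 0\<close> for positive \<open>a\<close> and \<open>b\<close>. The constant \<open>C\<close> is explicit in \<open>\<delta>\<^sub>0\<close>, \<open>\<theta>\<^sub>0\<close> and the
  \<open>C\<^sup>1\<close> norm of \<open>\<nabla>u\<^sub>0\<close>. That \<open>\<delta>\<^sub>0\<close> and \<open>\<theta>\<^sub>0\<close> are positive is Hopf's lemma
  (\<open>hopf_lower_bound\<close>).
\<close>

section \<open>The Airy equation\<close>

text \<open>The power series coefficients of the solution of \<open>y'' = x y\<close> with \<open>y(0) = a\<close> and
  \<open>y'(0) = b\<close>.\<close>
fun airy_coeff :: "real \<Rightarrow> real \<Rightarrow> nat \<Rightarrow> real" where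
  "airy_coeff a b 0 = a"
| "airy_coeff a b (Suc 0) = b"
| "airy_coeff a b (Suc (Suc 0)) = 0"
| "airy_coeff a b (Suc (Suc (Suc n))) = airy_coeff a b n / ((real n + 2) * (real n + 3))"

definition airy :: "real \<Rightarrow> real \<Rightarrow> real \<Rightarrow> real" where
  "airy a b x = (\<Sum>n. airy_coeff a b n * x ^ n)"

definition airy' :: "real \<Rightarrow> real \<Rightarrow> real \<Rightarrow> real" where
  "airy' a b x = (\<Sum>n. diffs (airy_coeff a b) n * x ^ n)"

text \<open>Passing from index \<open>n\<close> to \<open>n + 3\<close> multiplies \<open>\<bar>a\<^sub>n\<bar> R\<^sup>n\<close> by \<open>R\<^sup>3 / ((n + 2)(n + 3))\<close>, which is at most
  1 from some index on. As \<open>R\<close> is arbitrary, the series converges everywhere.\<close>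
lemma airy_coeff_bound:
  assumes "R > 0"
  shows "\<exists>M. \<forall>n. norm (airy_coeff a b n) * R ^ n \<le> M"
proof -
  obtain N :: nat where N: "real N \<ge> R ^ 3"
    using real_arch_simple by blast
  define M where "M = Max ((\<lambda>n. \<bar>airy_coeff a b n\<bar> * R ^ n) ` {..N + 3})"
  have "\<bar>airy_coeff a b n\<bar> * R ^ n \<le> M" for n
  proof (induction n rule: less_induct)
    case (less n)
    show ?case
    proof (cases "n \<le> N + 3")
      case True
      then show ?thesis unfolding M_def by (intro Max_ge) auto
    next
      case False
      then have "n = Suc (Suc (Suc (n - 3)))" "n - 3 \<ge> N" by auto
      then obtain m where m: "n = Suc (Suc (Suc m))" "m \<ge> N" by blast
      have "R ^ 3 \<le> real m" using N m by simp
      also have "real m \<le> (real m + 2) * (real m + 3)" by (simp add: algebra_simps)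
      finally have "R ^ 3 \<le> (real m + 2) * (real m + 3)" .
      moreover have "(real m + 2) * (real m + 3) > 0" by simp
      ultimately have le: "R ^ 3 / ((real m + 2) * (real m + 3)) \<le> 1" by (metis divide_le_eq_1_pos)
      have "\<bar>airy_coeff a b n\<bar> * R ^ n
          = (\<bar>airy_coeff a b m\<bar> * R ^ m) * (R ^ 3 / ((real m + 2) * (real m + 3)))"
        by (simp add: m abs_mult power3_eq_cube)
      also have "\<dots> \<le> (\<bar>airy_coeff a b m\<bar> * R ^ m) * 1"
        using le assms by (intro mult_left_mono) auto
      also have "\<dots> \<le> M" using less.IH[of m] m by simp
      finally show ?thesis .
    qed
  qed
  then show ?thesis by auto
qed

lemma summable_airy: "summable (\<lambda>n. airy_coeff a b n * x ^ n)"
proof -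
  have "\<bar>x\<bar> + 1 > 0" by simp
  from airy_coeff_bound[OF this, of a b]
  obtain M where M: "\<And>n. norm (airy_coeff a b n) * (\<bar>x\<bar> + 1) ^ n \<le> M" by blast
  have "summable (\<lambda>n. norm (airy_coeff a b n) * \<bar>x\<bar> ^ n)"
    by (rule Abel_lemma[OF _ _ M]) auto
  then have "summable (\<lambda>n. norm (airy_coeff a b n * x ^ n))"
    by (simp add: abs_mult power_abs)
  then show ?thesis by (rule summable_norm_cancel)
qed

lemma airy_deriv: "(airy a b has_real_derivative airy' a b x) (at x)"
  unfolding airy_def[abs_def] airy'_def
  by (rule termdiffs_strong_converges_everywhere) (rule summable_airy)

lemma airy'_deriv: "(airy' a b has_real_derivative x * airy a b x) (at x)"
proof -
  let ?c = "airy_coeff a b"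
  have s1: "summable (\<lambda>n. diffs ?c n * y ^ n)" for y
    by (rule termdiff_converges_all) (rule summable_airy)
  have s2: "summable (\<lambda>n. diffs (diffs ?c) n * y ^ n)" for y
    by (rule termdiff_converges_all) (rule s1)
  have c: "diffs (diffs ?c) (Suc n) = ?c n" for n
  proof -
    have "diffs (diffs ?c) (Suc n) = ((real n + 2) * (real n + 3)) * (?c n / ((real n + 2) * (real n + 3)))"
      unfolding diffs_def airy_coeff.simps of_nat_Suc by (simp only: mult.assoc[symmetric]) (simp add: add.commute)
    also have "\<dots> = ?c n" by simp
    finally show ?thesis .
  qed
  have "(\<Sum>n. diffs (diffs ?c) n * x ^ n) = (\<Sum>n. diffs (diffs ?c) (Suc n) * x ^ Suc n)"
    using suminf_split_head[OF s2[of x]] by (simp add: diffs_def)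
  also have "\<dots> = (\<Sum>n. x * (?c n * x ^ n))"
    unfolding c by (simp add: mult.left_commute)
  also have "\<dots> = x * airy a b x"
    unfolding airy_def by (rule suminf_mult[OF summable_airy])
  finally have "(\<Sum>n. diffs (diffs ?c) n * x ^ n) = x * airy a b x" .
  moreover have "(airy' a b has_real_derivative (\<Sum>n. diffs (diffs ?c) n * x ^ n)) (at x)"
    unfolding airy'_def[abs_def] by (rule termdiffs_strong_converges_everywhere) (rule s1)
  ultimately show ?thesis by simp
qed

lemma airy_0: "airy a b 0 = a" "airy' a b 0 = b"
  by (simp_all add: airy_def airy'_def powser_zero diffs_def)

lemma airy_deriv_comp [derivative_intros]:
  assumes "(f has_real_derivative f') (at x within S)"
  shows "((\<lambda>x. airy a b (f x)) has_real_derivative airy' a b (f x) * f') (at x within S)"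
    "((\<lambda>x. airy' a b (f x)) has_real_derivative f x * airy a b (f x) * f') (at x within S)"
  using DERIV_chain2[OF airy_deriv assms] DERIV_chain2[OF airy'_deriv assms] by auto

lemma continuous_airy [continuous_intros]:
  fixes f :: "'a::topological_space \<Rightarrow> real"
  assumes "continuous_on S f"
  shows "continuous_on S (\<lambda>x. airy a b (f x))" "continuous_on S (\<lambda>x. airy' a b (f x))"
proof -
  have "continuous_on UNIV (airy a b)" "continuous_on UNIV (airy' a b)"
    by (auto simp: continuous_on_eq_continuous_at intro: DERIV_isCont airy_deriv airy'_deriv)
  then show "continuous_on S (\<lambda>x. airy a b (f x))" "continuous_on S (\<lambda>x. airy' a b (f x))"
    using assms by (auto intro: continuous_on_compose2)
qed

text \<open>The Wronskian is constant because the Airy equation has no first order term.\<close>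
lemma airy_wronskian: "airy 1 0 x * airy' 0 1 x - airy' 1 0 x * airy 0 1 x = 1"
proof -
  have "((\<lambda>x. airy 1 0 x * airy' 0 1 x - airy' 1 0 x * airy 0 1 x) has_real_derivative 0) (at x)" for x
    by (rule derivative_eq_intros refl | simp)+
  then have "airy 1 0 x * airy' 0 1 x - airy' 1 0 x * airy 0 1 x
     = airy 1 0 0 * airy' 0 1 0 - airy' 1 0 0 * airy 0 1 0"
    using DERIV_const_ratio_const DERIV_isconst_all by blast
  then show ?thesis by (simp add: airy_0)
qed

section \<open>The equation y'' = (t - z) y with initial values 0 and 1\<close>

text \<open>The solution in \<open>t\<close> of \<open>y'' = (t - z) y\<close> with \<open>y(0) = 0\<close> and \<open>y'(0) = 1\<close>, as a combination of
  translated Airy functions. Read from the right end of the interval inwards, and rescaled, this is the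
  Sturm--Liouville equation on one half of the interval. The explicit form gives joint
  continuity in \<open>z\<close> and \<open>t\<close>.\<close>
definition shoot :: "real \<Rightarrow> real \<Rightarrow> real" where
  "shoot z t = airy 1 0 (-z) * airy 0 1 (t - z) - airy 0 1 (-z) * airy 1 0 (t - z)"

definition shoot' :: "real \<Rightarrow> real \<Rightarrow> real" where
  "shoot' z t = airy 1 0 (-z) * airy' 0 1 (t - z) - airy 0 1 (-z) * airy' 1 0 (t - z)"

lemma shoot_deriv [derivative_intros]:
  assumes "(f has_real_derivative f') (at x within S)"
  shows "((\<lambda>x. shoot z (f x)) has_real_derivative shoot' z (f x) * f') (at x within S)"
    "((\<lambda>x. shoot' z (f x)) has_real_derivative (f x - z) * shoot z (f x) * f') (at x within S)"
  unfolding shoot_def shoot'_def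
  by (rule derivative_eq_intros assms refl | simp add: algebra_simps)+

lemma continuous_shoot [continuous_intros]:
  fixes f g :: "'a::topological_space \<Rightarrow> real"
  assumes "continuous_on S f" "continuous_on S g"
  shows "continuous_on S (\<lambda>x. shoot (f x) (g x))" "continuous_on S (\<lambda>x. shoot' (f x) (g x))"
  unfolding shoot_def shoot'_def by (intro continuous_intros assms)+

lemma tendsto_shoot [tendsto_intros]:
  assumes "(f \<longlongrightarrow> a) F" "(g \<longlongrightarrow> b) F"
  shows "((\<lambda>x. shoot (f x) (g x)) \<longlongrightarrow> shoot a b) F" "((\<lambda>x. shoot' (f x) (g x)) \<longlongrightarrow> shoot' a b) F"
proof -
  have "isCont (\<lambda>p. shoot (fst p) (snd p)) (a, b)" "isCont (\<lambda>p. shoot' (fst p) (snd p)) (a, b)"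
    by (rule continuous_on_interior[of UNIV], intro continuous_intros, simp)+
  moreover have "((\<lambda>x. (f x, g x)) \<longlongrightarrow> (a, b)) F"
    using assms by (rule tendsto_Pair)
  ultimately show "((\<lambda>x. shoot (f x) (g x)) \<longlongrightarrow> shoot a b) F" "((\<lambda>x. shoot' (f x) (g x)) \<longlongrightarrow> shoot' a b) F"
    using isCont_tendsto_compose[of "(a,b)" "\<lambda>p. shoot (fst p) (snd p)" "\<lambda>x. (f x, g x)" F]
      isCont_tendsto_compose[of "(a,b)" "\<lambda>p. shoot' (fst p) (snd p)" "\<lambda>x. (f x, g x)" F] by auto
qed

lemma continuous_shoot_t: "continuous_on S (shoot z)" "continuous_on S (shoot' z)"
  and continuous_shoot_z: "continuous_on S (\<lambda>z. shoot z t)" "continuous_on S (\<lambda>z. shoot' z t)"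
  by (intro continuous_shoot continuous_on_id continuous_on_const)+

lemma shoot_0: "shoot z 0 = 0" "shoot' z 0 = 1"
  using airy_wronskian[of "-z"] by (auto simp: shoot_def shoot'_def algebra_simps)

lemma shoot_no_double_zero:
  assumes "shoot z t = 0" shows "shoot' z t \<noteq> 0"
proof
  assume *: "shoot' z t = 0"
  let ?A = "airy 1 0 (t-z)" and ?B = "airy 0 1 (t-z)" and ?A' = "airy' 1 0 (t-z)" and ?B' = "airy' 0 1 (t-z)"
  have W: "?A * ?B' - ?A' * ?B = 1" by (rule airy_wronskian)
  have "airy 1 0 (-z) = shoot' z t * ?A - shoot z t * ?A'"
    "airy 0 1 (-z) = shoot' z t * ?B - shoot z t * ?B'"
    using W unfolding shoot_def shoot'_def by algebra+
  then have "airy 1 0 (-z) = 0" "airy 0 1 (-z) = 0" using assms * by auto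
  then show False using airy_wronskian[of "-z"] by simp
qed

lemma shoot_pos_near_0:
  "\<exists>d>0. \<forall>t. 0 < t \<and> t < d \<longrightarrow> shoot z t > 0"
  using DERIV_pos_inc_right[of "shoot z" "shoot' z 0" 0] shoot_deriv(1)[OF DERIV_ident, of z 0 UNIV]
  by (auto simp: shoot_0)

text \<open>Sturm comparison: the Wronskian of the solutions for \<open>z\<close> and \<open>z'\<close> starts at 0 and has the
  derivative \<open>z - z'\<close> times the product of the two solutions.\<close>
lemma shoot_wronskian_neg:
  assumes "z < z'" "T > 0" "\<And>t. 0 < t \<Longrightarrow> t < T \<Longrightarrow> shoot z t > 0" "\<And>t. 0 < t \<Longrightarrow> t < T \<Longrightarrow> shoot z' t > 0"
  shows "shoot' z' T * shoot z T - shoot z' T * shoot' z T < 0"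
proof -
  let ?W = "\<lambda>t. shoot' z' t * shoot z t - shoot z' t * shoot' z t"
  have "?W T < ?W 0"
  proof (rule DERIV_neg_imp_decreasing_open[OF \<open>T > 0\<close>])
    fix t assume t: "0 < t" "t < T"
    have "(?W has_real_derivative (z - z') * (shoot z t * shoot z' t)) (at t)"
      by (rule derivative_eq_intros refl | simp add: algebra_simps)+
    moreover have "(z - z') * (shoot z t * shoot z' t) < 0"
      using assms t by (intro mult_neg_pos mult_pos_pos) auto
    ultimately show "\<exists>y. (?W has_real_derivative y) (at t) \<and> y < 0" by blast
  qed (intro continuous_intros)
  then show ?thesis by (simp add: shoot_0)
qed

lemma shoot_first_zero:
  assumes "T > 0" "shoot z T \<le> 0"
  obtains t0 where "0 < t0" "t0 \<le> T" "shoot z t0 = 0" "\<And>t. 0 < t \<Longrightarrow> t < t0 \<Longrightarrow> shoot z t > 0"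
    "shoot' z t0 < 0"
proof -
  obtain d where d: "d > 0" "\<And>t. 0 < t \<Longrightarrow> t < d \<Longrightarrow> shoot z t > 0" using shoot_pos_near_0[of z] by auto
  define S where "S = {t \<in> {d..T}. shoot z t \<le> 0}"
  have "d \<le> T" using d assms by force
  then have ne: "S \<noteq> {}" unfolding S_def using assms by auto
  have "closed S" unfolding S_def
    by (intro continuous_on_closed_Collect_le continuous_shoot_t continuous_on_const closed_atLeastAtMost)
  moreover have "bdd_below S" unfolding S_def by auto
  ultimately have S: "Inf S \<in> S" using closed_contains_Inf ne by blast
  define t0 where "t0 = Inf S"
  have pos: "shoot z t > 0" if "0 < t" "t < t0" for t
  proof (rule ccontr)
    assume "\<not> ?thesis"
    then have "t \<in> S" using d(2)[of t] that S by (force simp: S_def t0_def)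
    then have "t0 \<le> t" unfolding t0_def using \<open>bdd_below S\<close> by (rule cInf_lower)
    then show False using that by simp
  qed
  have t0: "0 < t0" "t0 \<le> T" "shoot z t0 \<le> 0" using S d unfolding t0_def S_def by auto
  have z0: "shoot z t0 = 0"
  proof (rule ccontr)
    assume "\<not> ?thesis"
    then have "shoot z t0 < 0" using t0 by simp
    moreover have "shoot z (d/2) > 0" using d by auto
    moreover have "d/2 < t0" using S d unfolding t0_def S_def by auto
    ultimately obtain s where "d/2 \<le> s" "s \<le> t0" "shoot z s = 0"
      using IVT2'[of "shoot z" t0 0 "d/2"] continuous_shoot_t(1)[of _ z] by auto
    then show False using pos[of s] d \<open>shoot z t0 < 0\<close> by (cases "s = t0") auto
  qed
  have "\<not> shoot' z t0 > 0"
  proof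
    assume "shoot' z t0 > 0"
    then obtain e where e: "e > 0" "\<And>h. 0 < h \<Longrightarrow> h < e \<Longrightarrow> shoot z (t0 - h) < shoot z t0"
      using DERIV_pos_inc_left[of "shoot z" "shoot' z t0" t0] shoot_deriv(1)[OF DERIV_ident, of z t0 UNIV] by auto
    have "shoot z (t0 - min (e/2) (t0/2)) < 0" using e(2)[of "min (e/2) (t0/2)"] e(1) t0 z0 by auto
    moreover have "shoot z (t0 - min (e/2) (t0/2)) > 0" using e(1) t0 by (intro pos) auto
    ultimately show False by simp
  qed
  then have "shoot' z t0 < 0" using shoot_no_double_zero[OF z0] by simp
  then show thesis using that t0 z0 pos by blast
qed

lemma shoot_first_zero_ex:
  assumes "T > 0" "\<not> shoot z T > 0"
  shows "\<exists>t0. 0 < t0 \<and> t0 \<le> T \<and> shoot z t0 = 0 \<and> (\<forall>t. 0 < t \<longrightarrow> t < t0 \<longrightarrow> shoot z t > 0) \<and> shoot' z t0 < 0"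
proof -
  have "shoot z T \<le> 0" using assms by simp
  from shoot_first_zero[OF assms(1) this] show ?thesis by metis
qed

text \<open>Lowering \<open>z\<close> delays the first zero. At a first zero of the solution for \<open>z\<close> before \<open>T\<close> the
  Wronskian would have the wrong sign.\<close>
lemma shoot_mono_pos:
  assumes "z < z'" "\<And>t. 0 < t \<Longrightarrow> t < T \<Longrightarrow> shoot z' t > 0" "shoot z' T \<ge> 0" "0 < t" "t \<le> T"
  shows "shoot z t > 0"
proof (rule ccontr)
  assume "\<not> ?thesis"
  then obtain t0 where t0: "0 < t0" "t0 \<le> t" "shoot z t0 = 0" "\<And>t. 0 < t \<Longrightarrow> t < t0 \<Longrightarrow> shoot z t > 0"
    "shoot' z t0 < 0"
    using shoot_first_zero_ex[of t z] assms(4) by blast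
  have "shoot' z' t0 * shoot z t0 - shoot z' t0 * shoot' z t0 < 0"
    using t0 assms by (intro shoot_wronskian_neg) auto
  then have "shoot z' t0 * shoot' z t0 > 0" using t0 by simp
  moreover have "shoot z' t0 \<ge> 0" using assms(2)[of t0] assms(3,5) t0 by (cases "t0 = T") auto
  ultimately show False using t0(5) by (simp add: zero_less_mult_iff)
qed

lemma shoot_pos_of_nonpos:
  assumes "z \<le> 0" "t > 0" shows "shoot z t > 0" "shoot' z t > 0"
proof -
  have p: "shoot z t > 0" if t_pos: "t > 0" for t
  proof (rule ccontr)
    assume "\<not> ?thesis"
    then obtain t0 where t0: "0 < t0" "t0 \<le> t" "shoot z t0 = 0" "\<And>t. 0 < t \<Longrightarrow> t < t0 \<Longrightarrow> shoot z t > 0"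
      "shoot' z t0 < 0"
      using shoot_first_zero_ex[OF t_pos, of z] by blast
    have "shoot' z 0 < shoot' z t0"
    proof (rule DERIV_pos_imp_increasing_open[OF t0(1)])
      fix s assume "0 < s" "s < t0"
      then show "\<exists>y. (shoot' z has_real_derivative y) (at s) \<and> 0 < y"
        using shoot_deriv(2)[OF DERIV_ident, of z s UNIV] t0(4)[of s] assms(1) by force
    qed (intro continuous_intros)
    then show False using t0(5) by (simp add: shoot_0)
  qed
  then show "shoot z t > 0" using assms by simp
  have "shoot' z 0 < shoot' z t"
  proof (rule DERIV_pos_imp_increasing_open[OF assms(2)])
    fix s assume "0 < s" "s < t"
    then show "\<exists>y. (shoot' z has_real_derivative y) (at s) \<and> 0 < y"
      using shoot_deriv(2)[OF DERIV_ident, of z s UNIV] p[of s] assms(1) by force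
  qed (intro continuous_intros)
  then show "shoot' z t > 0" by (simp add: shoot_0)
qed

text \<open>On \<open>[0, T/8]\<close> the equation is \<open>y'' = -q y\<close> with \<open>q \<ge> T/8\<close>, and \<open>T/8\<close> exceeds the square of the
  frequency \<open>8\<pi>/T\<close> of the sine that vanishes at both ends of this interval. So \<open>y\<close> must vanish there too.\<close>
lemma shoot_oscillates:
  assumes "T > 0" "z \<ge> T / 4" "T ^ 3 > 512 * pi\<^sup>2"
  shows "\<exists>t. 0 < t \<and> t \<le> T \<and> shoot z t \<le> 0"
proof (rule ccontr)
  assume "\<not> ?thesis"
  then have pos: "shoot z t > 0" if "0 < t" "t \<le> T" for t using that by force
  define k where "k = 8 * pi / T"
  have k: "k > 0" "k * (T / 8) = pi" using assms by (auto simp: k_def)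
  have "k\<^sup>2 = 64 * pi\<^sup>2 / T\<^sup>2" by (simp add: k_def power2_eq_square)
  also have "\<dots> < T / 8" using assms by (simp add: field_simps power3_eq_cube power2_eq_square)
  finally have k2: "k\<^sup>2 < T / 8" .
  let ?W = "\<lambda>t. shoot' z t * sin (k * t) - shoot z t * (k * cos (k * t))"
  have cont: "continuous_on {0..T / 8} ?W"
    by (intro continuous_shoot_t continuous_on_diff continuous_on_mult continuous_on_sin continuous_on_cos
        continuous_on_id continuous_on_const)
  have "T / 8 > 0" using assms by simp
  then have "?W (T / 8) < ?W 0"
  proof (rule DERIV_neg_imp_decreasing_open[OF _ _ cont])
    fix t assume t: "0 < t" "t < T / 8"
    have "(?W has_real_derivative (t - z + k\<^sup>2) * (shoot z t * sin (k * t))) (at t)"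
      by (rule derivative_eq_intros refl | simp add: algebra_simps power2_eq_square)+
    moreover have "k * t < k * (T / 8)" using t k(1) by (intro mult_strict_left_mono)
    then have "k * t < pi" using k(2) by (simp only:)
    then have "sin (k * t) > 0" using t k(1) by (intro sin_gt_zero) auto
    then have "(t - z + k\<^sup>2) * (shoot z t * sin (k * t)) < 0"
      using assms t k2 pos[of t] by (intro mult_neg_pos mult_pos_pos) auto
    ultimately show "\<exists>y. (?W has_real_derivative y) (at t) \<and> y < 0" by blast
  qed
  then have "shoot z (T / 8) * k < 0" using k by (simp add: shoot_0)
  then show False using pos[of "T/8"] assms k by (simp add: mult_less_0_iff)
qed

text \<open>The smallest \<open>z\<close> for which the solution vanishes at \<open>T\<close> is the supremum of the set \<open>Z\<close> of those \<open>z\<close>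
  for which it is positive on \<open>(0, T]\<close>. The limit solution is nonnegative and has no double zeros, so it is
  positive inside. It vanishes at \<open>T\<close>, as otherwise slightly larger \<open>z\<close> would belong to \<open>Z\<close>.\<close>
lemma first_dirichlet:
  assumes "T > 0" "T ^ 3 > 512 * pi\<^sup>2"
  obtains z1 where "0 < z1" "z1 \<le> T / 4" "shoot z1 T = 0" "\<And>t. 0 < t \<Longrightarrow> t < T \<Longrightarrow> shoot z1 t > 0"
    "shoot' z1 T < 0"
proof -
  define Z where "Z = {z. \<forall>t. 0 < t \<and> t \<le> T \<longrightarrow> shoot z t > 0}"
  have "0 \<in> Z" unfolding Z_def using shoot_pos_of_nonpos by auto
  have bd: "z \<le> T / 4" if "z \<in> Z" for z
    using shoot_oscillates[of T z] that assms unfolding Z_def by force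
  have bdd: "bdd_above Z" using bd by (rule bdd_aboveI)
  define z1 where "z1 = Sup Z"
  have z1_le: "z1 \<le> T / 4" unfolding z1_def using \<open>0 \<in> Z\<close> bd by (intro cSup_least) auto
  have "z1 \<in> closure Z" unfolding z1_def using \<open>0 \<in> Z\<close> bdd by (intro closure_contains_Sup) auto
  then obtain x where x: "\<And>n. x n \<in> Z" "x \<longlonglongrightarrow> z1" unfolding closure_sequential by blast
  have nonneg: "shoot z1 t \<ge> 0" if "0 < t" "t \<le> T" for t
  proof (rule LIMSEQ_le_const)
    show "(\<lambda>n. shoot (x n) t) \<longlonglongrightarrow> shoot z1 t" by (intro tendsto_intros x)
    show "\<exists>N. \<forall>n\<ge>N. 0 \<le> shoot (x n) t" using x(1) that by (auto simp: Z_def intro: less_imp_le)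
  qed
  have pos: "shoot z1 t > 0" if t: "0 < t" "t < T" for t
  proof (rule ccontr)
    assume "\<not> ?thesis"
    then obtain t0 where t0: "0 < t0" "t0 \<le> t" "shoot z1 t0 = 0" "shoot' z1 t0 < 0"
      using shoot_first_zero_ex[OF t(1), of z1] by blast
    obtain e where e: "e > 0" "\<And>h. 0 < h \<Longrightarrow> h < e \<Longrightarrow> shoot z1 (t0 + h) < shoot z1 t0"
      using DERIV_neg_dec_right[of "shoot z1" "shoot' z1 t0" t0] shoot_deriv(1)[OF DERIV_ident, of z1 t0 UNIV] t0
      by auto
    have "shoot z1 (t0 + min (e/2) (T - t0)) < 0"
      using e(2)[of "min (e/2) (T - t0)"] e(1) t0 that by auto
    moreover have "shoot z1 (t0 + min (e/2) (T - t0)) \<ge> 0" using e(1) t0 that by (intro nonneg) auto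
    ultimately show False by simp
  qed
  have zT: "shoot z1 T = 0"
  proof (rule ccontr)
    assume "shoot z1 T \<noteq> 0"
    then have pos': "shoot z1 t > 0" if "0 < t" "t \<le> T" for t
      using pos[of t] nonneg[of T] that assms(1) by (cases "t = T") auto
    \<comment> \<open>Openness of \<open>Z\<close>: zeros for parameters decreasing to \<open>z1\<close> would accumulate at a zero of the limit in \<open>(0, T]\<close> or at 0, and the latter would force a vanishing initial slope by the theorem of Rolle.\<close>
    have "\<exists>t. 0 < t \<and> t \<le> T \<and> shoot (z1 + 1 / Suc n) t \<le> 0" for n
    proof (rule ccontr)
      assume "\<not> ?thesis"
      then have "z1 + 1 / Suc n \<in> Z" unfolding Z_def by force
      then have "z1 + 1 / Suc n \<le> z1" unfolding z1_def using bdd by (rule cSup_upper)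
      then show False by (simp add: field_simps)
    qed
    then have "\<exists>t. 0 < t \<and> t \<le> T \<and> shoot (z1 + 1 / Suc n) t = 0" for n
      using shoot_first_zero_ex by (metis not_less order.trans)
    then obtain t where t: "\<And>n. 0 < t n" "\<And>n. t n \<le> T" "\<And>n. shoot (z1 + 1 / Suc n) (t n) = 0" by metis
    have "\<exists>s. 0 < s \<and> s < t n \<and> shoot' (z1 + 1 / Suc n) s = 0" for n
    proof -
      have d: "(shoot (z1 + 1 / Suc n) has_derivative (*) (shoot' (z1 + 1 / Suc n) x)) (at x)" for x
        using shoot_deriv(1)[OF DERIV_ident, of "z1 + 1 / Suc n" x UNIV] by (simp add: has_field_derivative_def)
      have "\<exists>s>0. s < t n \<and> ((*) (shoot' (z1 + 1 / Suc n) s) = (\<lambda>v. 0))"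
        by (rule Rolle_deriv[OF t(1)[of n] _ continuous_shoot_t(1) d]) (simp only: t(3) shoot_0)
      then show ?thesis by (metis mult.right_neutral)
    qed
    then obtain s where s: "\<And>n. 0 < s n" "\<And>n. s n < t n" "\<And>n. shoot' (z1 + 1 / Suc n) (s n) = 0" by metis
    have "compact ({0..T} :: real set)" by simp
    moreover have "\<forall>n. t n \<in> {0..T}" using t by (auto intro: less_imp_le)
    ultimately obtain l r where r: "l \<in> {0..T}" "strict_mono r" "(t \<circ> r) \<longlonglongrightarrow> l"
      unfolding compact_def by blast
    have zl: "(\<lambda>n. z1 + 1 / Suc (r n)) \<longlonglongrightarrow> z1 + 0"
      using LIMSEQ_subseq_LIMSEQ[OF LIMSEQ_inverse_real_of_nat r(2)]
      by (intro tendsto_add tendsto_const) (simp add: o_def inverse_eq_divide)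
    have "(\<lambda>n. shoot (z1 + 1 / Suc (r n)) (t (r n))) \<longlonglongrightarrow> shoot (z1+0) l"
      using zl r(3) by (intro tendsto_shoot) (simp_all add: o_def)
    then have "shoot z1 l = 0" using t(3) by (simp add: LIMSEQ_const_iff)
    then have "l = 0" using pos'[of l] r(1) by force
    then have "(\<lambda>n. s (r n)) \<longlonglongrightarrow> 0"
      using r(3) s(1,2) by (intro tendsto_sandwich[of "\<lambda>_. 0" "\<lambda>n. s (r n)" sequentially "t \<circ> r" 0])
        (auto intro!: always_eventually less_imp_le)
    then have "(\<lambda>n. shoot' (z1 + 1 / Suc (r n)) (s (r n))) \<longlonglongrightarrow> shoot' (z1+0) 0"
      using zl by (intro tendsto_shoot)
    then show False using s(3) by (simp add: LIMSEQ_const_iff shoot_0)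
  qed
  have neg: "shoot' z1 T < 0"
  proof -
    obtain t0 where t0: "0 < t0" "t0 \<le> T" "shoot z1 t0 = 0" "shoot' z1 t0 < 0"
      using shoot_first_zero_ex[OF assms(1), of z1] zT by auto
    then have "t0 = T" using pos[of t0] by force
    then show ?thesis using t0 by simp
  qed
  have "0 < z1" using shoot_pos_of_nonpos(1)[of z1 T] zT assms(1) by force
  then show thesis using that z1_le zT pos neg by blast
qed

text \<open>Below \<open>z1\<close> the solution is positive at \<open>T\<close>, and Sturm comparison says that its logarithmic
  derivative at \<open>T\<close> strictly decreases in \<open>z\<close>. It is positive at \<open>z = 0\<close>, and the slope is negative at \<open>z1\<close>, so
  the slope vanishes for exactly one \<open>z\<close> below \<open>z1\<close>.\<close>
lemma first_neumann:
  assumes "T > 0" "0 < z1" "shoot z1 T = 0" "\<And>t. 0 < t \<Longrightarrow> t < T \<Longrightarrow> shoot z1 t > 0" "shoot' z1 T < 0"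
  obtains z0 where "0 < z0" "z0 < z1" "shoot' z0 T = 0"
    "\<And>z. z < z1 \<Longrightarrow> shoot' z T = 0 \<Longrightarrow> z = z0"
proof -
  have "shoot' 0 T > 0" using shoot_pos_of_nonpos assms by auto
  then obtain z0 where z0: "0 \<le> z0" "z0 \<le> z1" "shoot' z0 T = 0"
    using IVT2'[of "\<lambda>z. shoot' z T" z1 0 0] assms continuous_shoot_z(2)[of _ T] by auto
  have "z0 \<noteq> 0" "z0 \<noteq> z1" using z0 \<open>shoot' 0 T > 0\<close> assms(5) by auto
  then have "0 < z0" "z0 < z1" using z0 by auto
  have pos: "shoot z t > 0" if "z < z1" "0 < t" "t \<le> T" for z t
    using shoot_mono_pos[of z z1 T t] that assms by auto
  have mono: False if "z < z'" "z' < z1" "shoot' z T = 0" "shoot' z' T = 0" for z z'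
    using shoot_wronskian_neg[OF that(1) assms(1)] pos[of z] pos[of z'] that by auto
  have uniq: "z = z0" if "z < z1" "shoot' z T = 0" for z
  proof (rule ccontr)
    assume "z \<noteq> z0"
    then consider "z < z0" | "z0 < z" by linarith
    then show False
      using mono that z0(3) \<open>0 < z0\<close> \<open>z0 < z1\<close> by cases blast+
  qed
  show thesis using that[OF \<open>0 < z0\<close> \<open>z0 < z1\<close> z0(3) uniq] .
qed

section \<open>The gap of the Sturm-Liouville problem\<close>

text \<open>The increase of the Wronskian of the two solutions over \<open>[0, T]\<close> is \<open>z1 - z0\<close> times the integral of
  their product, up to sign, and at \<open>T\<close> the Wronskian is \<open>- q m\<close>, where \<open>m\<close> is the end value of the Neumann
  solution and \<open>- q\<close> the end slope of the Dirichlet solution. To the right of \<open>T/4\<close> both solutions are convex,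
  so at \<open>T/2\<close> they exceed \<open>m\<close> and \<open>q\<close> by factors \<open>T\<^sup>3/32\<close> and \<open>T/2\<close>, which bounds the integral from
  below. The true decay is exponential, but any power of \<open>T\<close> with an exponent above 2
  survives the rescaling in \<open>sl_first_two_ex\<close>.\<close>
lemma shoot_gap_bound:
  assumes "T > 0" "z0 < z1" "z1 \<le> T / 4" "shoot z1 T = 0" "\<And>t. 0 < t \<Longrightarrow> t < T \<Longrightarrow> shoot z1 t > 0"
    "shoot' z1 T < 0" "shoot' z0 T = 0"
  shows "z1 - z0 \<le> 256 / T ^ 5"
proof -
  define m q where "m = shoot z0 T" and "q = - shoot' z1 T"
  have pos0: "shoot z0 t > 0" if "0 < t" "t \<le> T" for t
    using shoot_mono_pos[of z0 z1 T t] assms that by auto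
  have nn1: "shoot z1 t \<ge> 0" if "0 < t" "t \<le> T" for t
    using assms(4) assms(5)[of t] that by (cases "t = T") (auto intro: less_imp_le)
  have m: "m > 0" and q: "q > 0" using pos0[of T] assms by (auto simp: m_def q_def)
  have D: "(shoot z has_real_derivative shoot' z t) (at t)"
    "(shoot' z has_real_derivative (t - z) * shoot z t) (at t)" for z t
    using shoot_deriv[OF DERIV_ident, of z t UNIV] by auto
  have d0: "shoot' z0 t \<le> 0" if "T / 4 \<le> t" "t \<le> T" for t
  proof -
    have "shoot' z0 t \<le> shoot' z0 T"
    proof (rule DERIV_nonneg_imp_nondecreasing[OF that(2)])
      fix x assume "t \<le> x" "x \<le> T"
      then have "(x - z0) * shoot z0 x \<ge> 0" using assms that pos0[of x] by (intro mult_nonneg_nonneg) auto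
      then show "\<exists>y. (shoot' z0 has_real_derivative y) (at x) \<and> 0 \<le> y" using D by blast
    qed
    then show ?thesis using assms by simp
  qed
  have d1: "shoot' z1 t \<le> - q" if "T / 4 \<le> t" "t \<le> T" for t
  proof -
    have "shoot' z1 t \<le> shoot' z1 T"
    proof (rule DERIV_nonneg_imp_nondecreasing[OF that(2)])
      fix x assume "t \<le> x" "x \<le> T"
      then have "(x - z1) * shoot z1 x \<ge> 0" using assms that nn1[of x] by (intro mult_nonneg_nonneg) auto
      then show "\<exists>y. (shoot' z1 has_real_derivative y) (at x) \<and> 0 \<le> y" using D by blast
    qed
    then show ?thesis by (simp add: q_def)
  qed
  have dec0: "shoot z0 b \<le> shoot z0 a" if "T / 4 \<le> a" "a \<le> b" "b \<le> T" for a b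
  proof (rule DERIV_nonpos_imp_nonincreasing[OF that(2)])
    fix x assume "a \<le> x" "x \<le> b"
    then show "\<exists>y. (shoot z0 has_real_derivative y) (at x) \<and> y \<le> 0" using D(1) d0[of x] that by force
  qed
  have dec1: "shoot z1 b + q * b \<le> shoot z1 a + q * a" if "T / 4 \<le> a" "a \<le> b" "b \<le> T" for a b
  proof (rule DERIV_nonpos_imp_nonincreasing[OF that(2)])
    fix x assume x: "a \<le> x" "x \<le> b"
    have "((\<lambda>x. shoot z1 x + q * x) has_real_derivative shoot' z1 x + q) (at x)"
      by (rule derivative_eq_intros refl | simp)+
    then show "\<exists>y. ((\<lambda>x. shoot z1 x + q * x) has_real_derivative y) (at x) \<and> y \<le> 0"
      using d1[of x] that x by force
  qed
  have b1: "shoot z1 (T / 2) \<ge> q * (T / 2)"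
    using dec1[of "T/2" T] assms by (simp add: algebra_simps)
  have b0: "shoot z0 (T / 2) \<ge> m * (T ^ 3 / 32)"
  proof -
    let ?g = "\<lambda>t. shoot z0 t - m * (T / 8) * (T - t)\<^sup>2"
    let ?g' = "\<lambda>t. shoot' z0 t + m * (T / 4) * (T - t)"
    have g'T: "?g' T = 0" using assms by simp
    have g': "?g' t \<le> 0" if "T / 2 \<le> t" "t \<le> T" for t
    proof -
      have "?g' t \<le> ?g' T"
      proof (rule DERIV_nonneg_imp_nondecreasing[OF that(2)])
        fix x assume x: "t \<le> x" "x \<le> T"
        have "(?g' has_real_derivative (x - z0) * shoot z0 x - m * (T / 4)) (at x)"
          by (rule derivative_eq_intros refl | simp)+
        moreover have "T / 4 * m \<le> (x - z0) * shoot z0 x"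
          using dec0[of x T] x that assms m by (intro mult_mono) (auto simp: m_def)
        ultimately show "\<exists>y. (?g' has_real_derivative y) (at x) \<and> 0 \<le> y" by (force simp: mult.commute)
      qed
      then show ?thesis using g'T by simp
    qed
    have "?g T \<le> ?g (T / 2)"
    proof (rule DERIV_nonpos_imp_nonincreasing[where f = ?g])
      fix x assume x: "T / 2 \<le> x" "x \<le> T"
      have "(?g has_real_derivative shoot' z0 x * 1 - m * (T / 8) * (2 * (T - x) * - 1)) (at x)"
        by (rule derivative_eq_intros refl | simp)+
      then have "(?g has_real_derivative ?g' x) (at x)"
        by (rule back_subst[where P = "\<lambda>d. (?g has_real_derivative d) (at x)"]) (simp add: field_simps)
      then show "\<exists>y. (?g has_real_derivative y) (at x) \<and> y \<le> 0" using g'[OF x] by blast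
    qed (use assms in simp)
    then have "m \<le> shoot z0 (T / 2) - m * (T / 8) * (T / 2)\<^sup>2" by (simp add: m_def)
    also have "m * (T / 8) * (T / 2)\<^sup>2 = m * (T ^ 3 / 32)" by (simp add: power3_eq_cube power2_eq_square)
    finally show ?thesis using m by simp
  qed
  let ?W = "\<lambda>t. shoot' z1 t * shoot z0 t - shoot z1 t * shoot' z0 t"
  define M where "M = shoot z0 (T / 2) * shoot z1 (T / 2)"
  have W': "(?W has_real_derivative - ((z1 - z0) * (shoot z0 t * shoot z1 t))) (at t)" for t
    by (rule derivative_eq_intros refl | simp add: algebra_simps)+
  have nn: "(z1 - z0) * (shoot z0 t * shoot z1 t) \<ge> 0" if "0 \<le> t" "t \<le> T" for t
    using assms pos0[of t] nn1[of t] that by (cases "t = 0") (auto simp: shoot_0 intro!: mult_nonneg_nonneg less_imp_le)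
  have Wdec: "?W b \<le> ?W a" if "0 \<le> a" "a \<le> b" "b \<le> T" for a b
  proof (rule DERIV_nonpos_imp_nonincreasing[OF that(2)])
    fix x assume "a \<le> x" "x \<le> b"
    then show "\<exists>y. (?W has_real_derivative y) (at x) \<and> y \<le> 0" using W'[of x] nn[of x] that by force
  qed
  have "?W (T / 2) + (z1 - z0) * M * (T / 2) \<le> ?W (T / 4) + (z1 - z0) * M * (T / 4)"
  proof (rule DERIV_nonpos_imp_nonincreasing[where f = "\<lambda>t. ?W t + (z1 - z0) * M * t"])
    fix x assume x: "T / 4 \<le> x" "x \<le> T / 2"
    have "((\<lambda>t. ?W t + (z1 - z0) * M * t) has_real_derivative
        - ((z1 - z0) * (shoot z0 x * shoot z1 x)) + (z1 - z0) * M) (at x)"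
      by (rule derivative_eq_intros W' refl | simp)+
    moreover have "M \<le> shoot z0 x * shoot z1 x"
    proof -
      have "q * (x - T / 2) \<le> 0" using q x by (simp add: mult_le_0_iff)
      then have "shoot z1 (T / 2) \<le> shoot z1 x" using dec1[of x "T / 2"] x assms by (simp add: algebra_simps)
      then show ?thesis unfolding M_def using dec0[of x "T/2"] x assms pos0[of x] nn1[of "T/2"]
        by (intro mult_mono) auto
    qed
    then have "- ((z1 - z0) * (shoot z0 x * shoot z1 x)) + (z1 - z0) * M \<le> 0"
      using mult_left_mono[of M "shoot z0 x * shoot z1 x" "z1 - z0"] assms by simp
    ultimately show "\<exists>y. ((\<lambda>t. ?W t + (z1 - z0) * M * t) has_real_derivative y) (at x) \<and> y \<le> 0" by blast
  qed (use assms in simp)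
  moreover have "?W (T / 4) \<le> ?W 0" "?W T \<le> ?W (T / 2)" using assms by (intro Wdec; simp)+
  ultimately have "(z1 - z0) * M * (T / 4) \<le> - ?W T" by (simp add: shoot_0 algebra_simps)
  also have "- ?W T = m * q" using assms by (simp add: m_def q_def)
  finally have 1: "(z1 - z0) * M * (T / 4) \<le> m * q" .
  have "(m * (T ^ 3 / 32)) * (q * (T / 2)) \<le> M"
    unfolding M_def using b0 b1 m q assms(1) pos0[of "T/2"] by (intro mult_mono) auto
  then have "(z1 - z0) * ((m * (T ^ 3 / 32)) * (q * (T / 2))) * (T / 4) \<le> (z1 - z0) * M * (T / 4)"
    using assms by (intro mult_right_mono mult_left_mono) auto
  with 1 have "(z1 - z0) * ((m * (T ^ 3 / 32)) * (q * (T / 2))) * (T / 4) \<le> m * q" by linarith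
  also have "(z1 - z0) * ((m * (T ^ 3 / 32)) * (q * (T / 2))) * (T / 4) = (z1 - z0) * T ^ 5 / 256 * (m * q)"
    by (simp add: power_numeral_reduce)
  finally have "(z1 - z0) * T ^ 5 / 256 \<le> 1" using m q by (metis mult_pos_pos mult_le_cancel_right2 not_less)
  then show ?thesis using assms by (simp add: field_simps)
qed

text \<open>The Wronskian of a Sturm--Liouville solution with a solution \<open>f\<close> of the model equation, read from
  the right end.\<close>
lemma sl_wronskian:
  fixes f f' w v :: "real \<Rightarrow> real"
  assumes f: "\<And>t. (f has_real_derivative f' t) (at t)" "\<And>t. (f' has_real_derivative (t - z) * f t) (at t)"
    and w: "\<And>s. s \<in> {0..l} \<Longrightarrow> (w has_real_derivative v s) (at s within {0..l})"
    and v: "\<And>s. s \<in> {0..l} \<Longrightarrow> (v has_real_derivative k\<^sup>2 * (T - k * s - z) * w s) (at s within {0..l})"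
    and s: "s \<in> {0..l}"
  shows "f (T - k * s) * v s + k * f' (T - k * s) * w s = f T * v 0 + k * f' T * w 0"
proof -
  let ?R = "\<lambda>s. f (T - k * s) * v s + k * f' (T - k * s) * w s"
  have "\<exists>c. \<forall>x\<in>{0..l}. ?R x = c"
  proof (rule has_field_derivative_zero_constant)
    fix x assume x: "x \<in> {0..l}"
    have inner: "((\<lambda>s. T - k * s) has_real_derivative - k) (at x within {0..l})"
      by (rule derivative_eq_intros refl | simp)+
    note [derivative_intros] = DERIV_chain2[OF f(1) inner] DERIV_chain2[OF f(2) inner] w[OF x] v[OF x]
    show "(?R has_real_derivative 0) (at x within {0..l})"
      by (rule derivative_eq_intros refl | simp add: algebra_simps power2_eq_square)+
  qed simp
  then obtain c where "\<And>x. x \<in> {0..l} \<Longrightarrow> ?R x = c" by blast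
  then have "?R s = c" "?R 0 = c" using s by (blast, force)
  then show ?thesis by simp
qed

text \<open>The potential is even, so a solution extends evenly if its slope at the centre vanishes and oddly if its
  value does. For the converse, the Wronskians with the model solutions shot from both ends vanish at the ends, and
  at the centre they yield \<open>Y v(0) = 0\<close> and \<open>Y' w(0) = 0\<close>, where \<open>Y\<close> and \<open>Y'\<close> are the value and
  the slope of the model solution. If neither of these is 0, the eigenfunction vanishes
  identically.\<close>
lemma sl_eigenvalue_iff:
  assumes D: "D > 0" and k: "k > 0" and T: "T = k * (D / 2)"
  shows "sl_eigenvalue D (k ^ 3) (k\<^sup>2 * (z - T)) \<longleftrightarrow> shoot z T = 0 \<or> shoot' z T = 0"
proof
  assume "sl_eigenvalue D (k ^ 3) (k\<^sup>2 * (z - T))"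
  then obtain w v where
    w: "\<And>s. s \<in> {-D/2..D/2} \<Longrightarrow> (w has_real_derivative v s) (at s within {-D/2..D/2})" and
    v: "\<And>s. s \<in> {-D/2..D/2} \<Longrightarrow> \<exists>w''. (v has_real_derivative w'') (at s within {-D/2..D/2}) \<and>
                  w'' + k ^ 3 * \<bar>s\<bar> * w s = - (k\<^sup>2 * (z - T)) * w s"
    and bc: "w (-D/2) = 0" "w (D/2) = 0" and ne: "\<exists>s\<in>{-D/2..D/2}. w s \<noteq> 0"
    unfolding sl_eigenvalue_def by blast
  have v': "(v has_real_derivative k\<^sup>2 * (T - k * \<bar>s\<bar> - z) * w s) (at s within {-D/2..D/2})"
    if s: "s \<in> {-D/2..D/2}" for s
  proof -
    obtain w'' where w'': "(v has_real_derivative w'') (at s within {-D/2..D/2})"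
       "w'' + k ^ 3 * \<bar>s\<bar> * w s = - (k\<^sup>2 * (z - T)) * w s" using v[OF s] by blast
    have "w'' = k\<^sup>2 * (T - k * \<bar>s\<bar> - z) * w s" using w''(2) by algebra
    then show ?thesis using w'' by simp
  qed
  let ?I = "{0..D/2}"
  have rw: "(w has_real_derivative v s) (at s within ?I)"
    and rv: "(v has_real_derivative k\<^sup>2 * (T - k * s - z) * w s) (at s within ?I)" if "s \<in> ?I" for s
    using DERIV_subset[OF w, of s ?I] DERIV_subset[OF v', of s ?I] that by auto
  have lw: "((\<lambda>s. w (-s)) has_real_derivative - v (-s)) (at s within ?I)"
    and lv: "((\<lambda>s. - v (-s)) has_real_derivative k\<^sup>2 * (T - k * s - z) * w (-s)) (at s within ?I)" if s: "s \<in> ?I" for s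
  proof -
    have sub: "(\<lambda>s. - s) ` ?I \<subseteq> {-D/2..D/2}" by auto
    have ms: "- s \<in> {-D/2..D/2}" using s by auto
    have u: "((\<lambda>s. - s) has_real_derivative -1) (at s within ?I)"
      by (rule derivative_eq_intros refl | simp)+
    show "((\<lambda>s. w (-s)) has_real_derivative - v (-s)) (at s within ?I)"
      using DERIV_image_chain[OF DERIV_subset[OF w[OF ms] sub] u] by (simp add: o_def)
    have "((\<lambda>s. v (-s)) has_real_derivative - (k\<^sup>2 * (T - k * s - z) * w (-s))) (at s within ?I)"
      using DERIV_image_chain[OF DERIV_subset[OF v'[OF ms] sub] u] s by (simp add: o_def)
    then show "((\<lambda>s. - v (-s)) has_real_derivative k\<^sup>2 * (T - k * s - z) * w (-s)) (at s within ?I)"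
      using DERIV_minus by fastforce
  qed
  have sd: "(shoot z has_real_derivative shoot' z t) (at t)"
    "(shoot' z has_real_derivative (t - z) * shoot z t) (at t)" for t
    using shoot_deriv[OF DERIV_ident, of z t UNIV] by auto
  have e: "D / 2 \<in> ?I" using D by simp
  have T0: "T - k * (D / 2) = 0" using T by simp
  have r: "shoot z T * v 0 + k * shoot' z T * w 0 = 0"
    using sl_wronskian[OF sd rw rv e, unfolded T0] bc by (simp add: shoot_0)
  have l: "- shoot z T * v 0 + k * shoot' z T * w 0 = 0"
    using sl_wronskian[OF sd lw lv e, unfolded T0] bc by (simp add: shoot_0)
  show "shoot z T = 0 \<or> shoot' z T = 0"
  proof (rule ccontr)
    assume "\<not> ?thesis"
    then have z: "w 0 = 0" "v 0 = 0" using r l k by auto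
    have ad: "((\<lambda>t. airy a b (t - z)) has_real_derivative airy' a b (t - z)) (at t)"
      "((\<lambda>t. airy' a b (t - z)) has_real_derivative (t - z) * airy a b (t - z)) (at t)" for a b t
      by (rule derivative_eq_intros refl | simp)+
    have zero: "x = 0" if "\<And>a b. airy a b y * c + k * airy' a b y * x = 0" for x c y
    proof -
      have "k * x * (airy 1 0 y * airy' 0 1 y - airy' 1 0 y * airy 0 1 y) = 0"
        using that[of 1 0] that[of 0 1] by algebra
      then show ?thesis using airy_wronskian k by simp
    qed
    have "w s = 0" if "s \<in> ?I" for s
      by (rule zero[of "T - k * s - z" "v s"]) (use sl_wronskian[OF ad rw rv that] z in simp)
    moreover have neg: "w (-s) = 0" if "s \<in> ?I" for s
      by (rule zero[of "T - k * s - z" "- v (-s)"]) (use sl_wronskian[OF ad lw lv that] z in simp)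
    ultimately have "w s = 0" if "s \<in> {-D/2..D/2}" for s
      using that neg[of "-s"] by (cases "s \<ge> 0") auto
    then show False using ne by blast
  qed
next
  assume ev: "shoot z T = 0 \<or> shoot' z T = 0"
  \<comment> \<open>The extension is even for \<open>c = 1\<close> and odd for \<open>c = -1\<close>.\<close>
  define c :: real where "c = (if shoot' z T = 0 then 1 else -1)"
  have c: "shoot z T = c * shoot z T" "k * shoot' z T = - (c * (k * shoot' z T))"
    "shoot z T = 0 \<or> c = 1"
    using ev by (auto simp: c_def)
  let ?L = "{..0::real}" and ?R = "{0::real<..}"
  define w where "w = (\<lambda>s. if s \<in> ?L then shoot z (T + k * s) else c * shoot z (T - k * s))"
  define v where "v = (\<lambda>s. if s \<in> ?L then k * shoot' z (T + k * s) else - (c * (k * shoot' z (T - k * s))))"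
  have U: "?L \<union> ?R = UNIV" by auto
  have cl: "closure ?L \<inter> closure ?R = {0}" by auto
  have w': "(w has_real_derivative v s) (at s)" for s
  proof -
    have "(w has_vector_derivative v s) (at s within ?L \<union> ?R)"
      unfolding w_def v_def
    proof (rule has_vector_derivative_If_within_closures)
      show "((\<lambda>s. shoot z (T + k * s)) has_vector_derivative k * shoot' z (T + k * s)) (at s within ?L \<union> closure ?L \<inter> closure ?R)"
        unfolding has_real_derivative_iff_has_vector_derivative[symmetric]
        by (rule derivative_eq_intros refl | simp)+
      show "((\<lambda>s. c * shoot z (T - k * s)) has_vector_derivative - (c * (k * shoot' z (T - k * s)))) (at s within ?R \<union> closure ?L \<inter> closure ?R)"
        unfolding has_real_derivative_iff_has_vector_derivative[symmetric]
        by (rule derivative_eq_intros refl | simp)+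
    qed (use c in auto)
    then show ?thesis unfolding U has_real_derivative_iff_has_vector_derivative .
  qed
  have v': "(v has_real_derivative k\<^sup>2 * (T - k * \<bar>s\<bar> - z) * w s) (at s)" for s
  proof -
    have "(v has_vector_derivative (if s \<in> ?L then k * (k * (T + k * s - z) * shoot z (T + k * s)) else
        c * (k * (k * (T - k * s - z) * shoot z (T - k * s))))) (at s within ?L \<union> ?R)"
      unfolding v_def
    proof (rule has_vector_derivative_If_within_closures)
      show "((\<lambda>s. k * shoot' z (T + k * s)) has_vector_derivative k * (k * (T + k * s - z) * shoot z (T + k * s))) (at s within ?L \<union> closure ?L \<inter> closure ?R)"
        unfolding has_real_derivative_iff_has_vector_derivative[symmetric]
        by (rule derivative_eq_intros refl | simp)+
      show "((\<lambda>s. - (c * (k * shoot' z (T - k * s)))) has_vector_derivative c * (k * (k * (T - k * s - z) * shoot z (T - k * s)))) (at s within ?R \<union> closure ?L \<inter> closure ?R)"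
        unfolding has_real_derivative_iff_has_vector_derivative[symmetric]
        by (rule derivative_eq_intros refl | simp)+
    qed (use c in auto)
    then have "(v has_vector_derivative k\<^sup>2 * (T - k * \<bar>s\<bar> - z) * w s) (at s within ?L \<union> ?R)"
      by (rule back_subst[where P = "\<lambda>d. (v has_vector_derivative d) (at s within ?L \<union> ?R)"])
         (auto simp: w_def algebra_simps power2_eq_square)
    then show ?thesis unfolding U has_real_derivative_iff_has_vector_derivative .
  qed
  have nz: "\<exists>s\<in>{-D/2..D/2}. w s \<noteq> 0"
  proof -
    obtain d where d: "d > 0" "\<And>t. 0 < t \<Longrightarrow> t < d \<Longrightarrow> shoot z t > 0" using shoot_pos_near_0[of z] by auto
    have "T > 0" using mult_pos_pos[OF k, of "D / 2"] T D by simp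
    define t where "t = min (d / 2) (T / 2)"
    have t: "0 < t" "t < d" "t < T" using d \<open>T > 0\<close> by (auto simp: t_def)
    have "t / k < D / 2" using t(3) T k by (simp add: field_simps)
    moreover have "t / k > 0" using t k by simp
    ultimately have s: "t / k - D / 2 \<in> {-D/2..D/2}" "t / k - D / 2 \<le> 0" by auto
    moreover have "T + k * (t / k - D / 2) = t" using T k by (simp add: algebra_simps)
    then have "w (t / k - D / 2) = shoot z t" using s(2) by (simp only: w_def atMost_iff if_True)
    ultimately show ?thesis using d(2)[of t] t by (intro bexI[of _ "t / k - D / 2"]) simp_all
  qed
  have "T + k * (-D/2) = 0" "T - k * (D/2) = 0" using T by simp_all
  then have bc: "w (-D/2) = 0" "w (D/2) = 0" using D unfolding w_def by (simp_all only: shoot_0) simp_all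
  show "sl_eigenvalue D (k ^ 3) (k\<^sup>2 * (z - T))"
    unfolding sl_eigenvalue_def
  proof (rule exI[of _ w], rule exI[of _ v], intro conjI ballI bc nz)
    fix s assume "s \<in> {-D/2..D/2}"
    show "(w has_real_derivative v s) (at s within {-D/2..D/2})"
      using w' by (rule has_field_derivative_at_within)
    show "\<exists>w''. (v has_real_derivative w'') (at s within {-D/2..D/2}) \<and>
        w'' + k ^ 3 * \<bar>s\<bar> * w s = - (k\<^sup>2 * (z - T)) * w s"
      using has_field_derivative_at_within[OF v', of s "{-D/2..D/2}"]
      by (intro exI[of _ "k\<^sup>2 * (T - k * \<bar>s\<bar> - z) * w s"] conjI)
        (simp_all add: algebra_simps power2_eq_square power3_eq_cube)
  qed
qed

text \<open>With \<open>k = 2T/D\<close> and \<open>\<sigma> = k\<^sup>3\<close> the substitution \<open>t = T - k\<bar>s\<bar>\<close> turns the equation into the model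
  equation, with \<open>\<mu> = k\<^sup>2 (z - T)\<close>. The large parameter is now \<open>T\<close>.\<close>
lemma sl_first_two_ex:
  assumes D: "D > 0" and T: "T > 0" "T ^ 3 > 512 * pi\<^sup>2"
  defines "k \<equiv> T / (D / 2)"
  obtains \<mu>0 \<mu>1 where "sl_first_two_eigenvalues D (k ^ 3) \<mu>0 \<mu>1" "\<mu>1 - \<mu>0 \<le> 256 * k\<^sup>2 / T ^ 5"
proof -
  obtain z1 where z1: "0 < z1" "z1 \<le> T / 4" "shoot z1 T = 0" "\<And>t. 0 < t \<Longrightarrow> t < T \<Longrightarrow> shoot z1 t > 0"
    "shoot' z1 T < 0" using first_dirichlet[OF T] by blast
  obtain z0 where z0: "0 < z0" "z0 < z1" "shoot' z0 T = 0"
    "\<And>z. z < z1 \<Longrightarrow> shoot' z T = 0 \<Longrightarrow> z = z0"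
    using first_neumann[OF T(1) z1(1,3,4,5)] by blast
  have k: "k > 0" "T = k * (D / 2)" using D T by (auto simp: k_def)
  have nz: "shoot z T > 0" if "z < z1" for z
    using shoot_mono_pos[OF that z1(4)] z1(3) T by simp
  have ev: "sl_eigenvalue D (k ^ 3) \<mu> \<longleftrightarrow> shoot (\<mu> / k\<^sup>2 + T) T = 0 \<or> shoot' (\<mu> / k\<^sup>2 + T) T = 0" for \<mu>
    using sl_eigenvalue_iff[OF D k, of "\<mu> / k\<^sup>2 + T"] k(1) by simp
  define \<mu> where "\<mu> = (\<lambda>z. k\<^sup>2 * (z - T))"
  have lt: "\<mu> a < \<mu> b \<longleftrightarrow> a < b" and le: "\<mu> a \<le> \<mu> b \<longleftrightarrow> a \<le> b" for a b using k(1) by (auto simp: \<mu>_def)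
  have inv: "m = \<mu> (m / k\<^sup>2 + T)" for m using k(1) by (simp add: \<mu>_def)
  have "{m. sl_eigenvalue D (k ^ 3) m \<and> m \<le> \<mu> z1} = {\<mu> z0, \<mu> z1}"
  proof (intro equalityI subsetI)
    fix m assume "m \<in> {m. sl_eigenvalue D (k ^ 3) m \<and> m \<le> \<mu> z1}"
    then have m: "sl_eigenvalue D (k ^ 3) m" "m \<le> \<mu> z1" by auto
    define z where "z = m / k\<^sup>2 + T"
    have mz: "m = \<mu> z" unfolding z_def by (rule inv)
    have "shoot z T = 0 \<or> shoot' z T = 0" using m ev unfolding z_def by blast
    moreover have "z \<le> z1" using m le mz by simp
    ultimately have "z = z1 \<or> z = z0" using nz[of z] z0(4)[of z] by force
    then show "m \<in> {\<mu> z0, \<mu> z1}" using mz by auto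
  next
    fix m assume "m \<in> {\<mu> z0, \<mu> z1}"
    moreover have "sl_eigenvalue D (k ^ 3) (\<mu> z0)" "sl_eigenvalue D (k ^ 3) (\<mu> z1)"
      unfolding \<mu>_def sl_eigenvalue_iff[OF D k] by (simp_all only: z0(3) z1(3) simp_thms)
    moreover have "\<mu> z0 \<le> \<mu> z1" "\<mu> z1 \<le> \<mu> z1" using le z0(2) by simp_all
    ultimately show "m \<in> {m. sl_eigenvalue D (k ^ 3) m \<and> m \<le> \<mu> z1}" by blast
  qed
  then have "sl_first_two_eigenvalues D (k ^ 3) (\<mu> z0) (\<mu> z1)"
    unfolding sl_first_two_eigenvalues_def using z0(2) lt by simp
  moreover have "\<mu> z1 - \<mu> z0 = k\<^sup>2 * (z1 - z0)" by (simp add: \<mu>_def algebra_simps)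
  moreover have "z1 - z0 \<le> 256 / T ^ 5"
    using shoot_gap_bound[OF T(1) z0(2) z1(2,3,4,5) z0(3)] by blast
  then have "k\<^sup>2 * (z1 - z0) \<le> k\<^sup>2 * (256 / T ^ 5)" by (intro mult_left_mono) auto
  ultimately show thesis using that[of "\<mu> z0" "\<mu> z1"] by (simp add: mult.commute)
qed

lemma sl_gap_small:
  assumes "D > 0" "\<epsilon> > 0"
  shows "\<exists>\<sigma>>0. \<exists>\<mu>0 \<mu>1. sl_first_two_eigenvalues D \<sigma> \<mu>0 \<mu>1 \<and> (1/4) * (\<mu>1 - \<mu>0) < \<epsilon>"
proof -
  define T where "T = 1 + 512 * pi\<^sup>2 + 256 / (D\<^sup>2 * \<epsilon>)"
  have "256 / (D\<^sup>2 * \<epsilon>) > 0" using assms by simp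
  then have T: "T > 1" "T > 512 * pi\<^sup>2" "T > 256 / (D\<^sup>2 * \<epsilon>)"
    using pi_gt_zero by (auto simp: T_def intro: add_pos_pos add_pos_nonneg)
  have T3: "T ^ n \<ge> T" if "n \<ge> 1" for n using T(1) that by (simp add: self_le_power)
  have "T ^ 3 > 512 * pi\<^sup>2" using T(2) T3[of 3] by simp
  then obtain \<mu>0 \<mu>1 where m: "sl_first_two_eigenvalues D ((T / (D / 2)) ^ 3) \<mu>0 \<mu>1"
    "\<mu>1 - \<mu>0 \<le> 256 * (T / (D / 2))\<^sup>2 / T ^ 5"
    using sl_first_two_ex[OF assms(1), of T] T by auto
  have "256 * (T / (D / 2))\<^sup>2 / T ^ 5 = 1024 / (D\<^sup>2 * T ^ 3)"
    using T(1) assms by (simp add: field_simps power_numeral_reduce)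
  also have "\<dots> \<le> 1024 / (D\<^sup>2 * T)"
    using T(1) T3[of 3] assms by (intro divide_left_mono mult_left_mono mult_pos_pos) auto
  also have "\<dots> < 4 * \<epsilon>" using T assms by (simp add: field_simps)
  finally have "(1/4) * (\<mu>1 - \<mu>0) < \<epsilon>" using m(2) by simp
  then show ?thesis using m T(1) assms by (intro exI[of _ "(T / (D / 2)) ^ 3"]) auto
qed

section \<open>Second order data and maximum principles\<close>

text \<open>Differentiability of second order at a point, with gradient \<open>g\<close> and Hessian \<open>H\<close>. The gradient field
  \<open>F\<close> is existential, so that one does not have to carry it through sums, products and quotients.\<close>
definition has_hessian :: "('a::euclidean_space \<Rightarrow> real) \<Rightarrow> 'a \<Rightarrow> 'a \<Rightarrow> ('a \<Rightarrow> 'a) \<Rightarrow> bool" where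
  "has_hessian f x g H \<longleftrightarrow> (\<exists>F. (\<forall>\<^sub>F z in nhds x. (f has_derivative (\<lambda>h. F z \<bullet> h)) (at z)) \<and> F x = g \<and>
     (F has_derivative H) (at x))"

definition trace_of :: "('a::euclidean_space \<Rightarrow> 'a) \<Rightarrow> real" where
  "trace_of H = (\<Sum>b\<in>Basis. b \<bullet> H b)"

lemma trace_of_lincomb: "trace_of (\<lambda>h. a *\<^sub>R A h + b *\<^sub>R B h) = a * trace_of A + b * trace_of B"
  by (simp add: trace_of_def inner_add_right sum.distrib sum_distrib_left)

lemma trace_of_mult:
  "trace_of (\<lambda>h. a *\<^sub>R H' h + (g \<bullet> h) *\<^sub>R g' + (b *\<^sub>R H h + (g' \<bullet> h) *\<^sub>R g))
    = a * trace_of H' + b * trace_of H + 2 * (g \<bullet> g')"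
proof -
  have "(\<Sum>i\<in>Basis. (g \<bullet> i) * (i \<bullet> g')) = g \<bullet> g'" for g g' :: 'a
    using euclidean_inner[of g g'] by (simp add: inner_commute)
  then show ?thesis
    by (simp add: trace_of_def inner_add_right sum.distrib sum_distrib_left inner_commute[of g' g])
qed

lemma trace_of_rank_one_update:
  "trace_of (\<lambda>h. a *\<^sub>R H h + (b * (g \<bullet> h)) *\<^sub>R g) = a * trace_of H + b * (norm g)\<^sup>2"
proof -
  have "(norm g)\<^sup>2 = (\<Sum>i\<in>Basis. (g \<bullet> i) * (i \<bullet> g))"
    unfolding power2_norm_eq_inner using euclidean_inner[of g g] by (simp add: inner_commute)
  then show ?thesis
    by (simp add: trace_of_def inner_add_right sum.distrib sum_distrib_left mult_ac)
qed

lemma has_hessian_gradient: "has_hessian f x g H \<Longrightarrow> (f has_derivative (\<lambda>h. g \<bullet> h)) (at x)"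
  unfolding has_hessian_def by (metis eventually_nhds_x_imp_x)

lemma has_hessian_linear: "has_hessian f x g H \<Longrightarrow> linear H"
  unfolding has_hessian_def by (meson has_derivative_linear)

lemma has_hessian_cong:
  assumes "has_hessian f x g H" "\<forall>\<^sub>F z in nhds x. f z = f' z"
  shows "has_hessian f' x g H"
proof -
  obtain F where F: "\<forall>\<^sub>F z in nhds x. (f has_derivative (\<lambda>h. F z \<bullet> h)) (at z)" "F x = g" "(F has_derivative H) (at x)"
    using assms(1) unfolding has_hessian_def by blast
  have "\<forall>\<^sub>F z in nhds x. \<forall>\<^sub>F y in nhds z. f y = f' y" using assms(2) by (simp add: eventually_eventually)
  with F(1) have "\<forall>\<^sub>F z in nhds x. (f' has_derivative (\<lambda>h. F z \<bullet> h)) (at z)"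
  proof eventually_elim
    case (elim z)
    show ?case
      by (rule has_derivative_transform_eventually[OF elim(1)])
        (use elim(2) in \<open>auto simp: eventually_nhds_conv_at\<close>)
  qed
  then show ?thesis using F unfolding has_hessian_def by blast
qed

lemma has_hessian_unique:
  assumes "has_hessian f x g H" "has_hessian f x g' H'"
  shows "g = g'" "H = H'"
proof -
  obtain F where F: "\<forall>\<^sub>F z in nhds x. (f has_derivative (\<lambda>h. F z \<bullet> h)) (at z)" "F x = g" "(F has_derivative H) (at x)"
    using assms(1) unfolding has_hessian_def by blast
  obtain G where G: "\<forall>\<^sub>F z in nhds x. (f has_derivative (\<lambda>h. G z \<bullet> h)) (at z)" "G x = g'" "(G has_derivative H') (at x)"
    using assms(2) unfolding has_hessian_def by blast
  have ev: "\<forall>\<^sub>F z in nhds x. F z = G z"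
    using F(1) G(1)
  proof eventually_elim
    case (elim z)
    then have "(\<lambda>h. F z \<bullet> h) = (\<lambda>h. G z \<bullet> h)" by (rule has_derivative_unique)
    then have "\<forall>h. F z \<bullet> h = G z \<bullet> h" by (simp add: fun_eq_iff)
    then show ?case by (simp add: vector_eq_rdot)
  qed
  then show "g = g'" using F G eventually_nhds_x_imp_x by blast
  have "(G has_derivative H) (at x)"
    by (rule has_derivative_transform_eventually[OF F(3)]) (use ev in \<open>auto simp: eventually_nhds_conv_at\<close>)
  then show "H = H'" using G(3) by (rule has_derivative_unique)
qed

lemma has_hessian_const: "has_hessian (\<lambda>_. c) x 0 (\<lambda>_. 0)"
  unfolding has_hessian_def by (rule exI[of _ "\<lambda>_. 0"]) (simp add: has_derivative_const inner_zero_left[abs_def])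

lemma has_hessian_add:
  assumes "has_hessian f x g H" "has_hessian f' x g' H'"
  shows "has_hessian (\<lambda>z. f z + f' z) x (g + g') (\<lambda>h. H h + H' h)"
proof -
  obtain F where F: "\<forall>\<^sub>F z in nhds x. (f has_derivative (\<lambda>h. F z \<bullet> h)) (at z)" "F x = g" "(F has_derivative H) (at x)"
    using assms(1) unfolding has_hessian_def by blast
  obtain G where G: "\<forall>\<^sub>F z in nhds x. (f' has_derivative (\<lambda>h. G z \<bullet> h)) (at z)" "G x = g'" "(G has_derivative H') (at x)"
    using assms(2) unfolding has_hessian_def by blast
  have "\<forall>\<^sub>F z in nhds x. ((\<lambda>z. f z + f' z) has_derivative (\<lambda>h. (F z + G z) \<bullet> h)) (at z)"
    using F(1) G(1) by eventually_elim (auto intro!: derivative_eq_intros simp: inner_add_left)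
  moreover have "((\<lambda>z. F z + G z) has_derivative (\<lambda>h. H h + H' h)) (at x)"
    using F G by (auto intro!: derivative_eq_intros)
  ultimately show ?thesis unfolding has_hessian_def using F G by (intro exI[of _ "\<lambda>z. F z + G z"]) auto
qed

lemma has_hessian_mult:
  assumes "has_hessian f x g H" "has_hessian f' x g' H'"
  shows "has_hessian (\<lambda>z. f z * f' z) x (f x *\<^sub>R g' + f' x *\<^sub>R g)
    (\<lambda>h. f x *\<^sub>R H' h + (g \<bullet> h) *\<^sub>R g' + (f' x *\<^sub>R H h + (g' \<bullet> h) *\<^sub>R g))"
proof -
  obtain F where F: "\<forall>\<^sub>F z in nhds x. (f has_derivative (\<lambda>h. F z \<bullet> h)) (at z)" "F x = g" "(F has_derivative H) (at x)"
    using assms(1) unfolding has_hessian_def by blast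
  obtain G where G: "\<forall>\<^sub>F z in nhds x. (f' has_derivative (\<lambda>h. G z \<bullet> h)) (at z)" "G x = g'" "(G has_derivative H') (at x)"
    using assms(2) unfolding has_hessian_def by blast
  have "\<forall>\<^sub>F z in nhds x. ((\<lambda>z. f z * f' z) has_derivative (\<lambda>h. (f z *\<^sub>R G z + f' z *\<^sub>R F z) \<bullet> h)) (at z)"
    using F(1) G(1) by eventually_elim (auto intro!: derivative_eq_intros simp: algebra_simps)
  moreover have "((\<lambda>z. f z *\<^sub>R G z + f' z *\<^sub>R F z) has_derivative
      (\<lambda>h. f x *\<^sub>R H' h + (g \<bullet> h) *\<^sub>R g' + (f' x *\<^sub>R H h + (g' \<bullet> h) *\<^sub>R g))) (at x)"
    by (rule derivative_eq_intros has_hessian_gradient[OF assms(1)] has_hessian_gradient[OF assms(2)] F(3) G(3) refl)+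
      (simp add: F G)
  ultimately show ?thesis unfolding has_hessian_def using F G
    by (intro exI[of _ "\<lambda>z. f z *\<^sub>R G z + f' z *\<^sub>R F z"]) auto
qed

lemma has_hessian_cmult:
  assumes "has_hessian f x g H"
  shows "has_hessian (\<lambda>z. c * f z) x (c *\<^sub>R g) (\<lambda>h. c *\<^sub>R H h)"
  using has_hessian_mult[OF has_hessian_const[of c] assms] by simp

lemma has_hessian_compose:
  assumes f: "has_hessian f x g H"
    and p: "\<forall>\<^sub>F s in nhds (f x). (p has_real_derivative p1 s) (at s)" "(p1 has_real_derivative p2) (at (f x))"
  shows "has_hessian (\<lambda>z. p (f z)) x (p1 (f x) *\<^sub>R g) (\<lambda>h. p1 (f x) *\<^sub>R H h + (p2 * (g \<bullet> h)) *\<^sub>R g)"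
proof -
  obtain F where F: "\<forall>\<^sub>F z in nhds x. (f has_derivative (\<lambda>h. F z \<bullet> h)) (at z)" "F x = g" "(F has_derivative H) (at x)"
    using f unfolding has_hessian_def by blast
  have df: "(f has_derivative (\<lambda>h. g \<bullet> h)) (at x)" by (rule has_hessian_gradient[OF f])
  have "isCont f x" using df has_derivative_continuous by blast
  then have "filterlim f (nhds (f x)) (nhds x)" by (simp add: isCont_def tendsto_at_iff_tendsto_nhds)
  then have "\<forall>\<^sub>F z in nhds x. (p has_real_derivative p1 (f z)) (at (f z))"
    using p(1) unfolding filterlim_iff by blast
  with F(1) have "\<forall>\<^sub>F z in nhds x. ((\<lambda>z. p (f z)) has_derivative (\<lambda>h. (p1 (f z) *\<^sub>R F z) \<bullet> h)) (at z)"
  proof eventually_elim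
    case (elim z)
    show ?case
      using has_derivative_compose[OF elim(1) elim(2)[unfolded has_field_derivative_def]] by simp
  qed
  moreover have "((\<lambda>z. p1 (f z)) has_derivative (\<lambda>h. p2 * (g \<bullet> h))) (at x)"
    using has_derivative_compose[OF df p(2)[unfolded has_field_derivative_def]] by simp
  then have "((\<lambda>z. p1 (f z) *\<^sub>R F z) has_derivative (\<lambda>h. p1 (f x) *\<^sub>R H h + (p2 * (g \<bullet> h)) *\<^sub>R g)) (at x)"
    using F by (auto intro!: derivative_eq_intros)
  ultimately show ?thesis unfolding has_hessian_def
    by (intro exI[of _ "\<lambda>z. p1 (f z) *\<^sub>R F z"] conjI) (simp_all only: F(2))
qed

lemma has_hessian_inverse:
  assumes f: "has_hessian f x g H" and "f x \<noteq> 0"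
  shows "has_hessian (\<lambda>z. inverse (f z)) x ((- (1 / (f x)\<^sup>2)) *\<^sub>R g)
    (\<lambda>h. (- (1 / (f x)\<^sup>2)) *\<^sub>R H h + ((2 / (f x) ^ 3) * (g \<bullet> h)) *\<^sub>R g)"
proof (rule has_hessian_compose[OF f])
  have "\<forall>\<^sub>F s in nhds (f x). s \<noteq> 0"
    using assms(2) by (intro eventually_nhds_in_open[of "- {0}", simplified]) auto
  then show "\<forall>\<^sub>F s in nhds (f x). (inverse has_real_derivative - (1 / s\<^sup>2)) (at s)"
    by eventually_elim (auto intro!: derivative_eq_intros simp: divide_simps power2_eq_square)
  show "((\<lambda>s. - (1 / s\<^sup>2)) has_real_derivative 2 / f x ^ 3) (at (f x))"
    using assms(2) by (auto intro!: derivative_eq_intros simp: divide_simps power_numeral_reduce)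
qed

text \<open>Second order conditions on straight lines suffice below, and there they are statements about
  functions of one real variable.\<close>
lemma has_hessian_line:
  assumes "has_hessian f x g H"
  obtains f1 where "\<forall>\<^sub>F t in nhds 0. ((\<lambda>t. f (x + t *\<^sub>R v)) has_real_derivative f1 t) (at t)"
    "f1 0 = g \<bullet> v" "(f1 has_real_derivative v \<bullet> H v) (at (0::real))"
proof -
  obtain F where F: "\<forall>\<^sub>F z in nhds x. (f has_derivative (\<lambda>h. F z \<bullet> h)) (at z)" "F x = g" "(F has_derivative H) (at x)"
    using assms unfolding has_hessian_def by blast
  have l: "((\<lambda>t. x + t *\<^sub>R v) has_derivative (\<lambda>t. t *\<^sub>R v)) (at t)" for t
    by (auto intro!: derivative_eq_intros)
  have "((\<lambda>t. x + t *\<^sub>R v) \<longlongrightarrow> x + 0 *\<^sub>R v) (nhds 0)" by (intro tendsto_intros filterlim_ident)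
  then have "((\<lambda>t. x + t *\<^sub>R v) \<longlongrightarrow> x) (nhds 0)" by simp
  then have "\<forall>\<^sub>F t in nhds 0. (f has_derivative (\<lambda>h. F (x + t *\<^sub>R v) \<bullet> h)) (at (x + t *\<^sub>R v))"
    using F(1) by (rule eventually_compose_filterlim[rotated])
  then have "\<forall>\<^sub>F t in nhds 0. ((\<lambda>t. f (x + t *\<^sub>R v)) has_real_derivative F (x + t *\<^sub>R v) \<bullet> v) (at t)"
  proof eventually_elim
    case (elim t)
    have "(*) (F (x + t *\<^sub>R v) \<bullet> v) = (\<lambda>h. h * (F (x + t *\<^sub>R v) \<bullet> v))" by (auto simp: mult.commute)
    then show ?case using has_derivative_compose[OF l elim]
      by (simp add: has_field_derivative_def)
  qed
  moreover have "((\<lambda>t. F (x + t *\<^sub>R v) \<bullet> v) has_real_derivative v \<bullet> H v) (at 0)"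
  proof -
    have "(F has_derivative H) (at (x + 0 *\<^sub>R v))" using F by simp
    from has_derivative_compose[OF l this]
    have "((\<lambda>t. F (x + t *\<^sub>R v) \<bullet> v) has_derivative (\<lambda>t. H (t *\<^sub>R v) \<bullet> v)) (at 0)"
      by (rule has_derivative_inner_left)
    moreover have "(\<lambda>t. H (t *\<^sub>R v) \<bullet> v) = (*) (v \<bullet> H v)"
      using linear_scale[OF has_derivative_linear[OF F(3)]] by (auto simp: inner_commute)
    ultimately show ?thesis by (simp add: has_field_derivative_def)
  qed
  ultimately show thesis using F(2) by (intro that[of "\<lambda>t. F (x + t *\<^sub>R v) \<bullet> v"]) auto
qed

lemma real_local_max_second:
  fixes f f1 :: "real \<Rightarrow> real"
  assumes "\<forall>\<^sub>F t in nhds 0. (f has_real_derivative f1 t) (at t)" "(f1 has_real_derivative d) (at 0)"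
    and max: "\<forall>\<^sub>F t in nhds 0. f t \<le> f 0"
  shows "f1 0 = 0" "d \<le> 0"
proof -
  obtain e where e: "e > 0" "\<And>t. \<bar>t\<bar> < e \<Longrightarrow> (f has_real_derivative f1 t) (at t) \<and> f t \<le> f 0"
    using eventually_conj[OF assms(1) max] unfolding eventually_nhds_metric by (auto simp: dist_real_def)
  show z: "f1 0 = 0"
  proof (rule DERIV_local_max[of f "f1 0" 0 e])
    show "(f has_real_derivative f1 0) (at 0)" using e by simp
    show "\<forall>y. \<bar>0 - y\<bar> < e \<longrightarrow> f y \<le> f 0" using e by simp
  qed (use e in simp)
  show "d \<le> 0"
  proof (rule ccontr)
    assume "\<not> d \<le> 0"
    then obtain e2 where e2: "e2 > 0" "\<And>h. 0 < h \<Longrightarrow> h < e2 \<Longrightarrow> f1 0 < f1 (0 + h)"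
      using DERIV_pos_inc_right[OF assms(2)] by auto
    define t where "t = min e e2 / 2"
    have t: "0 < t" "t < e" "t < e2" using e e2 by (auto simp: t_def)
    have "f 0 < f t"
    proof (rule DERIV_pos_imp_increasing_open[OF t(1)])
      fix x assume "0 < x" "x < t"
      then show "\<exists>y. (f has_real_derivative y) (at x) \<and> 0 < y" using e(2)[of x] e2(2)[of x] t z by auto
    next
      show "continuous_on {0..t} f"
      proof (rule continuous_at_imp_continuous_on, rule)
        fix x assume "x \<in> {0..t}"
        then have "(f has_real_derivative f1 x) (at x)" using e t by auto
        then show "isCont f x" by (rule DERIV_isCont)
      qed
    qed
    then show False using e(2)[of t] t by simp
  qed
qed

lemma local_max_hessian:
  assumes f: "has_hessian f x g H" and max: "\<forall>\<^sub>F z in nhds x. f z \<le> f x"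
  shows "g = 0" "trace_of H \<le> 0"
proof -
  have *: "g \<bullet> v = 0 \<and> v \<bullet> H v \<le> 0" for v
  proof -
    obtain f1 where f1: "\<forall>\<^sub>F t in nhds 0. ((\<lambda>t. f (x + t *\<^sub>R v)) has_real_derivative f1 t) (at t)"
      "f1 0 = g \<bullet> v" "(f1 has_real_derivative v \<bullet> H v) (at (0::real))"
      by (rule has_hessian_line[OF f])
    have "((\<lambda>t. x + t *\<^sub>R v) \<longlongrightarrow> x + 0 *\<^sub>R v) (nhds 0)" by (intro tendsto_intros filterlim_ident)
  then have "((\<lambda>t. x + t *\<^sub>R v) \<longlongrightarrow> x) (nhds 0)" by simp
    then have "\<forall>\<^sub>F t in nhds 0. f (x + t *\<^sub>R v) \<le> f x"
      using max by (rule eventually_compose_filterlim[rotated])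
    then have "\<forall>\<^sub>F t in nhds 0. f (x + t *\<^sub>R v) \<le> f (x + 0 *\<^sub>R v)" by simp
    from real_local_max_second[OF f1(1,3) this] f1(2) show ?thesis by simp
  qed
  show "g = 0" using * by (metis inner_eq_zero_iff)
  show "trace_of H \<le> 0" unfolding trace_of_def using * by (intro sum_nonpos) auto
qed

text \<open>The trace may be computed in the orthonormal basis obtained by reflecting the standard one in the
  hyperplane orthogonal to \<open>e\<close>. This avoids completing \<open>e\<close> to an orthonormal basis.\<close>
lemma trace_of_reflection:
  assumes "linear H" "norm e = 1"
  shows "(\<Sum>b\<in>Basis. (b - (2 * (b \<bullet> e)) *\<^sub>R e) \<bullet> H (b - (2 * (b \<bullet> e)) *\<^sub>R e)) = trace_of H"
proof -
  have ee: "e \<bullet> e = 1" using assms(2) by (simp add: dot_square_norm)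
  have s1: "(\<Sum>b\<in>Basis. (b \<bullet> e) * (e \<bullet> H b)) = e \<bullet> H e"
  proof -
    have "(\<Sum>b\<in>Basis. (b \<bullet> e) * (e \<bullet> H b)) = e \<bullet> H (\<Sum>b\<in>Basis. (b \<bullet> e) *\<^sub>R b)"
      by (simp add: linear_sum[OF assms(1)] linear_scale[OF assms(1)] inner_sum_right)
    also have "(\<Sum>b\<in>Basis. (b \<bullet> e) *\<^sub>R b) = e" by (subst inner_commute) (rule euclidean_representation)
    finally show ?thesis .
  qed
  have s2: "(\<Sum>b\<in>Basis. (b \<bullet> e) * (b \<bullet> H e)) = e \<bullet> H e"
    by (subst euclidean_inner[of e "H e"]) (simp add: inner_commute)
  have s3: "(\<Sum>b\<in>Basis. (b \<bullet> e)\<^sup>2) = 1"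
    using euclidean_inner[of e e] ee by (simp add: inner_commute power2_eq_square)
  have "(b - (2 * (b \<bullet> e)) *\<^sub>R e) \<bullet> H (b - (2 * (b \<bullet> e)) *\<^sub>R e)
    = b \<bullet> H b - 2 * ((b \<bullet> e) * (b \<bullet> H e)) - 2 * ((b \<bullet> e) * (e \<bullet> H b)) + 4 * (e \<bullet> H e) * (b \<bullet> e)\<^sup>2" for b
    by (simp add: linear_diff[OF assms(1)] linear_scale[OF assms(1)] inner_diff_left inner_diff_right algebra_simps power2_eq_square)
  then have "(\<Sum>b\<in>Basis. (b - (2 * (b \<bullet> e)) *\<^sub>R e) \<bullet> H (b - (2 * (b \<bullet> e)) *\<^sub>R e))
    = trace_of H - 2 * (\<Sum>b\<in>Basis. (b \<bullet> e) * (b \<bullet> H e)) - 2 * (\<Sum>b\<in>Basis. (b \<bullet> e) * (e \<bullet> H b)) + 4 * (e \<bullet> H e) * (\<Sum>b\<in>Basis. (b \<bullet> e)\<^sup>2)"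
    by (simp add: sum.distrib sum_subtractf sum_distrib_left trace_of_def)
  then show ?thesis by (simp add: s1 s2 s3)
qed

text \<open>Moving \<open>x\<close> by \<open>ta\<close> and \<open>y\<close> by \<open>tb\<close> changes the distance at the rate \<open>s\<close> as long as
  \<open>b - a = s e\<close>; then \<open>y - x\<close> keeps its direction. For \<open>b\<close> equal to \<open>a\<close> the distance is constant, and this
  makes the gradients opposite; moving \<open>y\<close> alone determines them. For \<open>b\<close> the mirror image of \<open>a\<close> one has \<open>s = -2 a\<cdot>e\<close>, and the sum over
  an orthonormal basis of the second order conditions gives both traces and \<open>4 p''\<close>.\<close>
lemma two_point_max_hessian:
  fixes x y :: "'a::euclidean_space"
  assumes f: "has_hessian f x g H" and f': "has_hessian f' y g' H'"
    and "x \<noteq> y"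
    and p: "\<And>s. (p has_real_derivative p1 s) (at s)" "(p1 has_real_derivative p2) (at (dist x y))"
    and max: "\<forall>\<^sub>F z in nhds (x, y). f (fst z) + f' (snd z) - p (dist (fst z) (snd z)) \<le> f x + f' y - p (dist x y)"
  defines "e \<equiv> (1 / dist x y) *\<^sub>R (y - x)"
  shows "g = - p1 (dist x y) *\<^sub>R e" "g' = p1 (dist x y) *\<^sub>R e"
    "trace_of H + trace_of H' \<le> 4 * p2"
proof -
  let ?r = "dist x y"
  have r: "?r > 0" using assms by simp
  have ne: "norm e = 1" using r by (simp add: e_def dist_norm norm_minus_commute)
  have ee: "e \<bullet> e = 1" using ne by (simp add: dot_square_norm)
  have yx: "y - x = ?r *\<^sub>R e" using r by (simp add: e_def)
  have lim: "((\<lambda>t. (x + t *\<^sub>R a, y + t *\<^sub>R b)) \<longlongrightarrow> (x, y)) (nhds 0)" for a b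
  proof -
    have "((\<lambda>t. (x + t *\<^sub>R a, y + t *\<^sub>R b)) \<longlongrightarrow> (x + 0 *\<^sub>R a, y + 0 *\<^sub>R b)) (nhds 0)"
      by (intro tendsto_intros filterlim_ident)
    then show ?thesis by simp
  qed
  have main: "g \<bullet> a + g' \<bullet> b = p1 ?r * s" "a \<bullet> H a + b \<bullet> H' b \<le> p2 * s\<^sup>2" if s: "b - a = s *\<^sub>R e" for a b s
  proof -
    obtain f1 where f1: "\<forall>\<^sub>F t in nhds 0. ((\<lambda>t. f (x + t *\<^sub>R a)) has_real_derivative f1 t) (at t)"
      "f1 0 = g \<bullet> a" "(f1 has_real_derivative a \<bullet> H a) (at (0::real))"
      by (rule has_hessian_line[OF f])
    obtain f2 where f2: "\<forall>\<^sub>F t in nhds 0. ((\<lambda>t. f' (y + t *\<^sub>R b)) has_real_derivative f2 t) (at t)"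
      "f2 0 = g' \<bullet> b" "(f2 has_real_derivative b \<bullet> H' b) (at (0::real))"
      by (rule has_hessian_line[OF f'])
    let ?h = "\<lambda>t. f (x + t *\<^sub>R a) + f' (y + t *\<^sub>R b) - p (?r + t * s)"
    have "\<forall>\<^sub>F t in nhds 0. ?r + t * s > 0"
    proof -
      have "((\<lambda>t. ?r + t * s) \<longlongrightarrow> ?r + 0 * s) (nhds 0)" by (intro tendsto_intros filterlim_ident)
      then show ?thesis using r by (intro order_tendstoD(1)) auto
    qed
    moreover have "\<forall>\<^sub>F t in nhds 0. f (x + t *\<^sub>R a) + f' (y + t *\<^sub>R b) - p (dist (x + t *\<^sub>R a) (y + t *\<^sub>R b)) \<le> f x + f' y - p ?r"
      using eventually_compose_filterlim[OF max lim[of a b]] by simp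
    ultimately have mx: "\<forall>\<^sub>F t in nhds 0. ?h t \<le> ?h 0"
    proof eventually_elim
      case (elim t)
      have "y + t *\<^sub>R b - (x + t *\<^sub>R a) = (y - x) + t *\<^sub>R (b - a)" by (simp add: algebra_simps)
      also have "\<dots> = (?r + t * s) *\<^sub>R e" by (simp only: s yx) (simp add: algebra_simps)
      finally have "dist (x + t *\<^sub>R a) (y + t *\<^sub>R b) = ?r + t * s"
        using elim(1) ne by (metis abs_of_pos dist_commute dist_norm mult.right_neutral norm_scaleR)
      then show ?case using elim(2) by simp
    qed
    have "\<forall>\<^sub>F t in nhds 0. (?h has_real_derivative f1 t + f2 t - p1 (?r + t * s) * s) (at t)"
      using f1(1) f2(1)
    proof eventually_elim
      case (elim t)
      have "((\<lambda>t. ?r + t * s) has_real_derivative s) (at t)"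
        by (rule derivative_eq_intros refl | simp)+
      note [derivative_intros] = elim DERIV_chain2[OF p(1) this]
      show ?case by (rule derivative_eq_intros refl | simp)+
    qed
    moreover have "((\<lambda>t. f1 t + f2 t - p1 (?r + t * s) * s) has_real_derivative
        a \<bullet> H a + b \<bullet> H' b - p2 * s * s) (at 0)"
    proof -
      have "(p1 has_real_derivative p2) (at (?r + 0 * s))" using p(2) by simp
      moreover have "((\<lambda>t. ?r + t * s) has_real_derivative s) (at 0)"
        by (rule derivative_eq_intros refl | simp)+
      ultimately have "((\<lambda>t. p1 (?r + t * s)) has_real_derivative p2 * s) (at 0)" by (rule DERIV_chain2)
      note [derivative_intros] = f1(3) f2(3) this
      show ?thesis by (rule derivative_eq_intros refl | simp)+
    qed
    ultimately have "f1 0 + f2 0 - p1 (?r + 0 * s) * s = 0" "a \<bullet> H a + b \<bullet> H' b - p2 * s * s \<le> 0"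
      using real_local_max_second[of ?h "\<lambda>t. f1 t + f2 t - p1 (?r + t * s) * s", OF _ _ mx] by blast+
    then show "g \<bullet> a + g' \<bullet> b = p1 ?r * s" "a \<bullet> H a + b \<bullet> H' b \<le> p2 * s\<^sup>2"
      using f1(2) f2(2) by (simp_all add: power2_eq_square algebra_simps)
  qed
  have sum0: "g + g' = 0"
  proof -
    have "(g + g') \<bullet> a = 0" for a using main(1)[of a a 0] by (simp add: inner_add_left)
    then show ?thesis by (metis inner_eq_zero_iff)
  qed
  show g': "g' = p1 ?r *\<^sub>R e"
  proof -
    have "((\<lambda>z. (x, z)) \<longlongrightarrow> (x, y)) (nhds y)" by (intro tendsto_intros filterlim_ident)
    then have "\<forall>\<^sub>F z in nhds y. f' z - p (norm (z - x)) \<le> f' y - p (norm (y - x))"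
      using eventually_compose_filterlim[OF max] by (fastforce simp: dist_norm norm_minus_commute elim: eventually_mono)
    then obtain S where S: "open S" "y \<in> S" "\<And>z. z \<in> S \<Longrightarrow> f' z - p (norm (z - x)) \<le> f' y - p (norm (y - x))"
      unfolding eventually_nhds by blast
    have "((\<lambda>z. z - x) has_derivative (\<lambda>h. h)) (at y)" by (auto intro!: derivative_eq_intros)
    moreover have "(norm has_derivative (\<lambda>h. e \<bullet> h)) (at (y - x))"
      using has_derivative_norm[of "y - x"] assms(3) by (simp add: e_def sgn_div_norm dist_norm norm_minus_commute divide_inverse_commute inner_commute)
    ultimately have "((\<lambda>z. norm (z - x)) has_derivative (\<lambda>h. e \<bullet> h)) (at y)" by (rule has_derivative_compose)
    then have "((\<lambda>z. p (norm (z - x))) has_derivative (\<lambda>h. p1 (norm (y - x)) * (e \<bullet> h))) (at y)"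
      by (rule has_derivative_compose) (use p(1) in \<open>simp add: has_field_derivative_def\<close>)
    then have "((\<lambda>z. f' z - p (norm (z - x))) has_derivative (\<lambda>h. g' \<bullet> h - p1 (norm (y - x)) * (e \<bullet> h))) (at y)"
      by (intro has_derivative_diff has_hessian_gradient[OF f'])
    then have "(\<lambda>h. g' \<bullet> h - p1 (norm (y - x)) * (e \<bullet> h)) = (\<lambda>h. 0)"
      by (rule differential_zero_maxmin[OF S(2,1)]) (use S(3) in blast)
    then have "g' \<bullet> h - p1 (norm (y - x)) * (e \<bullet> h) = 0" for h
      by (rule fun_cong)
    then have "\<forall>h. g' \<bullet> h = (p1 ?r *\<^sub>R e) \<bullet> h" by (simp add: dist_norm norm_minus_commute)
    then show ?thesis by (simp only: vector_eq_rdot)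
  qed
  then show "g = - p1 ?r *\<^sub>R e" using sum0 by (metis add_eq_0_iff scaleR_minus_left add.commute)
  let ?R = "\<lambda>b. b - (2 * (b \<bullet> e)) *\<^sub>R e"
  have "trace_of H + trace_of H' = (\<Sum>b\<in>Basis. b \<bullet> H b + ?R b \<bullet> H' (?R b))"
    unfolding sum.distrib trace_of_reflection[OF has_hessian_linear[OF f'] ne] by (simp add: trace_of_def)
  also have "\<dots> \<le> (\<Sum>b\<in>Basis. p2 * (- 2 * (b \<bullet> e))\<^sup>2)"
    by (intro sum_mono main(2)) simp
  also have "\<dots> = 4 * p2 * (\<Sum>b\<in>Basis. (b \<bullet> e)\<^sup>2)" by (simp add: sum_distrib_left power_mult_distrib algebra_simps)
  also have "(\<Sum>b\<in>Basis. (b \<bullet> e)\<^sup>2) = 1"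
    using euclidean_inner[of e e] ee by (simp add: inner_commute power2_eq_square)
  finally show "trace_of H + trace_of H' \<le> 4 * p2" by simp
qed

section \<open>Partial derivatives and norms of differentiable functions\<close>

lemma basis_sum_scaleR: "(\<Sum>i\<in>UNIV. (h $ i) *\<^sub>R axis i 1) = (h :: real^'n::finite)"
  using basis_expansion[of h] by (simp add: scalar_mult_eq_scaleR)

lemma derivative_via_partials:
  fixes f :: "real^'n::finite \<Rightarrow> 'b::real_normed_vector"
  assumes "f differentiable (at z)"
  shows "(f has_derivative (\<lambda>h. \<Sum>i\<in>UNIV. (h $ i) *\<^sub>R partial_deriv i f z)) (at z)"
proof -
  have d: "(f has_derivative frechet_derivative f (at z)) (at z)"
    using assms by (simp add: frechet_derivative_works)
  then have l: "linear (frechet_derivative f (at z))" by (rule has_derivative_linear)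
  have "frechet_derivative f (at z) h = (\<Sum>i\<in>UNIV. (h $ i) *\<^sub>R partial_deriv i f z)" for h
  proof -
    have "frechet_derivative f (at z) h = frechet_derivative f (at z) (\<Sum>i\<in>UNIV. (h $ i) *\<^sub>R axis i 1)"
      by (simp add: basis_sum_scaleR)
    then show ?thesis by (simp add: linear_sum[OF l] linear_scale[OF l] partial_deriv_def)
  qed
  then have "frechet_derivative f (at z) = (\<lambda>h. \<Sum>i\<in>UNIV. (h $ i) *\<^sub>R partial_deriv i f z)" by (rule ext)
  then show ?thesis using d by (simp only:)
qed

lemma partial_deriv_eq:
  assumes "(f has_derivative D) (at x)" shows "partial_deriv i f x = D (axis i 1)"
  using frechet_derivative_at[OF assms] by (simp add: partial_deriv_def)

lemma sum_Basis_cart: "(\<Sum>b\<in>Basis. g b) = (\<Sum>i\<in>UNIV. g (axis i 1 :: real^'n::finite))"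
proof -
  have "bij_betw (\<lambda>i. axis i 1) UNIV (Basis :: (real^'n) set)"
    by (auto simp: bij_betw_def inj_on_def axis_eq_axis Basis_vec_def)
  then show ?thesis by (rule sum.reindex_bij_betw[symmetric])
qed

lemma Ck_on_differentiable:
  assumes "Ck_on k U f" "length is < k" "x \<in> U"
  shows "partial_derivs is f differentiable (at x)"
  using assms unfolding Ck_on_def by blast

lemma Ck_on_2_differentiable:
  assumes "Ck_on 2 U f" "x \<in> U"
  shows "f differentiable (at x)" "partial_deriv i f differentiable (at x)"
  using Ck_on_differentiable[OF assms(1) _ assms(2), of "[]"] Ck_on_differentiable[OF assms(1) _ assms(2), of "[i]"]
  by simp_all

text \<open>The functional \<open>L\<close> makes the lemma apply to real functions and the real parts of complex multiples of complex
  functions alike.\<close>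
lemma Ck2_has_hessian:
  fixes f :: "real^'n::finite \<Rightarrow> 'b::real_normed_vector"
  assumes U: "open U" "x \<in> U" "Ck_on 2 U f" and L: "bounded_linear L"
  obtains H where "has_hessian (\<lambda>z. L (f z)) x (\<chi> i. L (partial_deriv i f x)) H"
    "trace_of H = L (laplacian f x)"
proof -
  interpret L: bounded_linear L by (rule L)
  let ?F = "\<lambda>z. \<chi> i. L (partial_deriv i f z)"
  let ?H = "\<lambda>h. \<chi> i. L (\<Sum>j\<in>UNIV. (h $ j) *\<^sub>R partial_deriv j (partial_deriv i f) x)"
  have 1: "((\<lambda>z. L (f z)) has_derivative (\<lambda>h. ?F z \<bullet> h)) (at z)" if "z \<in> U" for z
  proof -
    have "((\<lambda>z. L (f z)) has_derivative (\<lambda>h. L (\<Sum>i\<in>UNIV. (h $ i) *\<^sub>R partial_deriv i f z))) (at z)"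
      by (rule L.has_derivative[OF derivative_via_partials[OF Ck_on_2_differentiable(1)[OF U(3) that]]])
    moreover have "L (\<Sum>i\<in>UNIV. (h $ i) *\<^sub>R partial_deriv i f z) = ?F z \<bullet> h" for h
      by (simp add: L.sum L.scaleR inner_vec_def mult.commute)
    ultimately show ?thesis by simp
  qed
  have 2: "(?F has_derivative ?H) (at x)"
  proof (rule has_derivative_componentwise_within[THEN iffD2], rule)
    fix b :: "real^'n" assume "b \<in> Basis"
    then obtain i where b: "b = axis i 1" by (auto simp: Basis_vec_def)
    have "((\<lambda>z. L (partial_deriv i f z)) has_derivative
        (\<lambda>h. L (\<Sum>j\<in>UNIV. (h $ j) *\<^sub>R partial_deriv j (partial_deriv i f) x))) (at x)"
      by (rule L.has_derivative[OF derivative_via_partials[OF Ck_on_2_differentiable(2)[OF U(3,2)]]])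
    then show "((\<lambda>z. ?F z \<bullet> b) has_derivative (\<lambda>h. ?H h \<bullet> b)) (at x)"
      by (simp add: b inner_axis)
  qed
  have "has_hessian (\<lambda>z. L (f z)) x (?F x) ?H"
    unfolding has_hessian_def
    by (rule exI[of _ ?F]) (use 1 2 eventually_nhds_in_open[OF U(1,2)] in \<open>auto elim!: eventually_mono\<close>)
  moreover have "trace_of ?H = L (laplacian f x)"
  proof -
    have "(\<Sum>j\<in>UNIV. (axis i 1 :: real^'n) $ j *\<^sub>R partial_deriv j (partial_deriv i f) x) = partial_deriv i (partial_deriv i f) x" for i
      by (simp add: axis_def if_distrib[of "\<lambda>c. c *\<^sub>R _"] cong: if_cong)
    then show ?thesis
      by (simp add: trace_of_def sum_Basis_cart laplacian_def inner_axis') (simp add: L.sum)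
  qed
  ultimately show thesis by (rule that)
qed

text \<open>A supremum of reals says something about its members only if they are bounded, which is the first
  hypothesis. There are finitely many multi-indices of each length, so it can be used for each of them separately.\<close>
lemma Ck_norm_upper:
  fixes f :: "real^'n::finite \<Rightarrow> 'b::real_normed_vector"
  assumes bd: "\<And>is. length is \<le> k \<Longrightarrow> \<exists>C. \<forall>x\<in>\<Omega>. norm (partial_derivs is f x) \<le> C"
    and "x \<in> \<Omega>" "length is \<le> k"
  shows "norm (partial_derivs is f x) \<le> Ck_norm k \<Omega> f"
proof -
  let ?g = "\<lambda>(is, x). norm (partial_derivs is f x)"
  let ?P = "\<lambda>m. {is. length is = m} \<times> \<Omega> :: ('n list \<times> (real^'n)) set"
  have bdd: "bdd_above (?g ` ?P m)" if m: "m \<le> k" for m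
  proof -
    obtain C where C: "\<And>is x. length is = m \<Longrightarrow> x \<in> \<Omega> \<Longrightarrow> norm (partial_derivs is f x) \<le> C is"
    proof -
      have "\<forall>is. \<exists>C. length is = m \<longrightarrow> (\<forall>x\<in>\<Omega>. norm (partial_derivs is f x) \<le> C)" using bd m by blast
      from choice[OF this] show thesis using that by blast
    qed
    have fin: "finite {is :: 'n list. length is = m}"
      using finite_lists_length_eq[of "UNIV :: 'n set" m] by simp
    have "?g p \<le> Max (C ` {is. length is = m})" if "p \<in> ?P m" for p
    proof -
      obtain js y where p: "p = (js, y)" by fastforce
      have "?g p \<le> C js" using that C by (auto simp: p)
      also have "\<dots> \<le> Max (C ` {is. length is = m})" using that fin by (auto simp: p intro!: Max_ge)
      finally show ?thesis .
    qed
    then show ?thesis by (rule bdd_aboveI2)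
  qed
  have upper: "?g p \<le> (SUP p\<in>?P m. ?g p)" if "m \<le> k" "p \<in> ?P m" for m p
    using that bdd by (intro cSUP_upper) auto
  have nonneg: "0 \<le> (SUP p\<in>?P m. ?g p)" if "m \<le> k" for m
  proof -
    have p: "(replicate m undefined, x) \<in> ?P m" using assms by simp
    have "0 \<le> ?g (replicate m undefined, x)" by simp
    also have "\<dots> \<le> (SUP p\<in>?P m. ?g p)" by (rule upper[OF that p])
    finally show ?thesis .
  qed
  have "norm (partial_derivs is f x) \<le> (SUP p\<in>?P (length is). ?g p)"
    using upper[of "length is" "(is, x)"] assms by simp
  also have "\<dots> \<le> (\<Sum>m\<le>k. SUP p\<in>?P m. ?g p)"
    using assms by (intro member_le_sum nonneg) auto
  finally show ?thesis unfolding Ck_norm_def .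
qed

lemma Ck_closure_bounded:
  assumes "Ck_closure k \<Omega> f" "bounded \<Omega>" "length is \<le> k"
  shows "\<exists>C. \<forall>x\<in>\<Omega>. norm (partial_derivs is f x) \<le> C"
proof -
  obtain g where g: "continuous_on (closure \<Omega>) g" "\<forall>x\<in>\<Omega>. g x = partial_derivs is f x"
    using assms unfolding Ck_closure_def by blast
  have "compact (g ` closure \<Omega>)"
    using g assms by (intro compact_continuous_image) (auto simp: compact_eq_bounded_closed)
  then obtain C where "\<And>y. y \<in> g ` closure \<Omega> \<Longrightarrow> norm y \<le> C"
    using compact_imp_bounded bounded_iff by metis
  then show ?thesis using g(2) closure_subset[of \<Omega>] by (intro exI[of _ C]) force
qed

lemma partials_Lipschitz:
  fixes F :: "real^'n::finite \<Rightarrow> 'b::real_normed_vector"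
  assumes "convex S" "\<And>z. z \<in> S \<Longrightarrow> F differentiable (at z)"
    and M: "\<And>i z. z \<in> S \<Longrightarrow> norm (partial_deriv i F z) \<le> M" and "x \<in> S" "y \<in> S"
  shows "norm (F y - F x) \<le> real CARD('n) * M * norm (y - x)"
proof (rule differentiable_bound[OF assms(1) _ _ assms(5,4)])
  fix z assume z: "z \<in> S"
  show "(F has_derivative (\<lambda>h. \<Sum>i\<in>UNIV. (h $ i) *\<^sub>R partial_deriv i F z)) (at z within S)"
    by (rule has_derivative_at_withinI[OF derivative_via_partials[OF assms(2)[OF z]]])
  show "onorm (\<lambda>h. \<Sum>i\<in>UNIV. (h $ i) *\<^sub>R partial_deriv i F z) \<le> real CARD('n) * M"
  proof (rule onorm_le)
    fix h :: "real^'n"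
    have "norm (\<Sum>i\<in>UNIV. (h $ i) *\<^sub>R partial_deriv i F z) \<le> (\<Sum>i\<in>(UNIV::'n set). norm h * M)"
      using M[OF z] component_le_norm_cart[of h]
      by (intro sum_norm_le) (auto intro!: mult_mono)
    then show "norm (\<Sum>i\<in>UNIV. (h $ i) *\<^sub>R partial_deriv i F z) \<le> real CARD('n) * M * norm h"
      by (simp add: mult_ac)
  qed
qed

lemma mean_value_gradient:
  fixes f :: "'a::euclidean_space \<Rightarrow> real"
  assumes "x \<noteq> y" "continuous_on (closed_segment x y) f"
    "\<And>z. z \<in> open_segment x y \<Longrightarrow> (f has_derivative (\<lambda>h. F z \<bullet> h)) (at z)"
  obtains z where "z \<in> open_segment x y" "f y - f x = F z \<bullet> (y - x)"
proof -
  let ?l = "\<lambda>t. x + t *\<^sub>R (y - x)"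
  have op: "?l t \<in> open_segment x y" if "0 < t" "t < 1" for t
    using assms(1) that unfolding in_segment by (auto simp: algebra_simps intro!: exI[of _ t])
  have "continuous_on {0..1} (\<lambda>t. f (?l t))"
  proof (rule continuous_on_compose2[OF assms(2)])
    show "?l ` {0..1} \<subseteq> closed_segment x y" by (auto simp: in_segment algebra_simps intro!: exI)
  qed (intro continuous_intros)
  moreover have "((\<lambda>t. f (?l t)) has_derivative (\<lambda>s. F (?l t) \<bullet> (s *\<^sub>R (y - x)))) (at t)" if "0 < t" "t < 1" for t
  proof -
    have "(?l has_derivative (\<lambda>s. s *\<^sub>R (y - x))) (at t)" by (auto intro!: derivative_eq_intros)
    from has_derivative_compose[OF this assms(3)[OF op[OF that]]] show ?thesis .
  qed
  ultimately obtain t where t: "0 < t" "t < 1" "f (?l 1) - f (?l 0) = F (?l t) \<bullet> ((1 - 0) *\<^sub>R (y - x))"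
    using mvt[of 0 1 "\<lambda>t. f (?l t)" "\<lambda>t s. F (?l t) \<bullet> (s *\<^sub>R (y - x))"] by auto
  then show thesis using that[OF op] by simp
qed

lemma taylor_bound:
  fixes f :: "'a::euclidean_space \<Rightarrow> real"
  assumes "convex S" "x \<in> S" "y \<in> S" "\<And>z. z \<in> S \<Longrightarrow> (f has_derivative (\<lambda>h. F z \<bullet> h)) (at z)"
    "\<And>z. z \<in> S \<Longrightarrow> norm (F z - F x) \<le> K * norm (z - x)" "K \<ge> 0"
  shows "\<bar>f y - f x - F x \<bullet> (y - x)\<bar> \<le> K * (norm (y - x))\<^sup>2"
proof (cases "x = y")
  case False
  have seg: "closed_segment x y \<subseteq> S" using assms by (intro closed_segment_subset)
  have "continuous_on S f"
    by (rule has_derivative_continuous_on[OF has_derivative_at_withinI[OF assms(4)]])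
  then have "continuous_on (closed_segment x y) f" using seg by (rule continuous_on_subset)
  then obtain z where z: "z \<in> open_segment x y" "f y - f x = F z \<bullet> (y - x)"
  proof (rule mean_value_gradient[OF False])
    fix z assume "z \<in> open_segment x y"
    then have "z \<in> S" using seg segment_open_subset_closed by blast
    then show "(f has_derivative (\<lambda>h. F z \<bullet> h)) (at z)" by (rule assms(4))
  qed
  have zS: "z \<in> S" using z(1) seg segment_open_subset_closed by blast
  have "norm (z - x) \<le> norm (y - x)"
    using segment_bound(1)[of z x y] z(1) segment_open_subset_closed by blast
  then have "norm (F z - F x) \<le> K * norm (y - x)"
    using assms(5)[OF zS] assms(6) by (meson mult_left_mono order_trans)
  then have "norm (F z - F x) * norm (y - x) \<le> K * norm (y - x) * norm (y - x)" by (rule mult_right_mono) simp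
  moreover have "\<bar>(F z - F x) \<bullet> (y - x)\<bar> \<le> norm (F z - F x) * norm (y - x)" by (rule Cauchy_Schwarz_ineq2)
  ultimately show ?thesis using z(2) by (simp add: inner_diff_left power2_eq_square)
qed (use assms in simp)

lemma grad_has_derivative:
  fixes f :: "real^'n::finite \<Rightarrow> real"
  assumes "f differentiable (at z)"
  shows "(f has_derivative (\<lambda>h. grad f z \<bullet> h)) (at z)"
  using derivative_via_partials[OF assms] by (simp add: grad_def inner_vec_def mult.commute)

lemma grad_differentiable:
  fixes f :: "real^'n::finite \<Rightarrow> real"
  assumes "\<And>i. partial_deriv i f differentiable (at z)"
  shows "grad f differentiable (at z)" "partial_deriv i (grad f) z = (\<chi> j. partial_deriv i (partial_deriv j f) z)"
proof -
  let ?H = "\<lambda>h. \<chi> j. frechet_derivative (partial_deriv j f) (at z) h"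
  have d: "(grad f has_derivative ?H) (at z)"
  proof (rule has_derivative_componentwise_within[THEN iffD2], rule)
    fix b :: "real^'n" assume "b \<in> Basis"
    then obtain i where b: "b = axis i 1" by (auto simp: Basis_vec_def)
    show "((\<lambda>z. grad f z \<bullet> b) has_derivative (\<lambda>h. ?H h \<bullet> b)) (at z)"
      using assms[of i] by (simp add: b inner_axis grad_def frechet_derivative_works)
  qed
  then show "grad f differentiable (at z)" by (auto simp: differentiable_def)
  show "partial_deriv i (grad f) z = (\<chi> j. partial_deriv i (partial_deriv j f) z)"
    unfolding partial_deriv_eq[OF d] by (simp add: partial_deriv_def)
qed

lemma norm_vec_le:
  fixes v :: "real^'n::finite" assumes "\<And>i. \<bar>v $ i\<bar> \<le> M"
  shows "norm v \<le> real CARD('n) * M"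
proof -
  have "norm v \<le> (\<Sum>i\<in>UNIV. \<bar>v $ i\<bar>)" by (rule norm_le_l1_cart)
  also have "\<dots> \<le> (\<Sum>i\<in>(UNIV::'n set). M)" by (intro sum_mono assms)
  finally show ?thesis by simp
qed

section \<open>Interior balls and Hopf's lemma\<close>

text \<open>A boundary given by a \<open>C\<^sup>2\<close> function \<open>\<rho>\<close> without critical points can be touched by balls from inside: for \<open>x\<close> in a ball of
  radius \<open>R\<close> that touches \<open>p\<close> in the direction of \<open>- \<nabla>\<rho>(p)\<close>, the square of \<open>\<bar>x - p\<bar>\<close> is at most \<open>2R\<close> times the
  inward component of \<open>x - p\<close>, so for small \<open>R\<close> the linear term of \<open>\<rho>\<close> dominates.\<close>
lemma interior_ball:
  fixes \<Omega> :: "(real^'n::finite) set"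
  assumes "open \<Omega>" "smooth_boundary \<Omega>" "p \<in> frontier \<Omega>"
  obtains z R where "R > 0" "ball z R \<subseteq> \<Omega>" "dist z p = R"
proof -
  obtain U \<rho> where U: "open U" "p \<in> U" "\<And>k. Ck_on k U \<rho>" "\<And>x. x \<in> U \<Longrightarrow> grad \<rho> x \<noteq> 0"
    "\<Omega> \<inter> U = {x\<in>U. \<rho> x < 0}"
    using bspec[OF assms(2)[unfolded smooth_boundary_def] assms(3)] by (elim exE conjE) auto
  obtain s where s: "s > 0" "cball p s \<subseteq> U" using U(1,2) open_contains_cball by blast
  have d2: "\<rho> differentiable (at x)" "partial_deriv i \<rho> differentiable (at x)" if "x \<in> U" for x i
    using Ck_on_2_differentiable[OF U(3) that] by auto
  have "\<exists>M. \<forall>i j. \<forall>x\<in>cball p s. \<bar>partial_deriv i (partial_deriv j \<rho>) x\<bar> \<le> M"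
  proof -
    have "\<exists>M. \<forall>x\<in>cball p s. \<bar>partial_deriv i (partial_deriv j \<rho>) x\<bar> \<le> M" for i j
    proof -
      have "continuous_on U (partial_derivs [i, j] \<rho>)"
        using U(3)[of 2] unfolding Ck_on_def by (elim conjE allE[of _ "[i, j]"]) simp
      then have "continuous_on (cball p s) (partial_deriv i (partial_deriv j \<rho>))"
        using s(2) by (simp add: continuous_on_subset)
      then have "bounded (partial_deriv i (partial_deriv j \<rho>) ` cball p s)"
        by (intro compact_imp_bounded compact_continuous_image compact_cball)
      then show ?thesis unfolding bounded_iff by auto
    qed
    then have "\<exists>M. \<forall>q. \<forall>x\<in>cball p s. \<bar>partial_deriv (fst q) (partial_deriv (snd q) \<rho>) x\<bar> \<le> M q"
      by (intro choice allI)
    then obtain M where M: "\<And>q x. x \<in> cball p s \<Longrightarrow> \<bar>partial_deriv (fst q) (partial_deriv (snd q) \<rho>) x\<bar> \<le> M q"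
      by blast
    have "\<bar>partial_deriv i (partial_deriv j \<rho>) x\<bar> \<le> Max (range M)" if "x \<in> cball p s" for i j x
    proof -
      have "\<bar>partial_deriv i (partial_deriv j \<rho>) x\<bar> \<le> M (i, j)" using M[OF that, of "(i, j)"] by simp
      also have "\<dots> \<le> Max (range M)" by (intro Max_ge) auto
      finally show ?thesis .
    qed
    then show ?thesis by blast
  qed
  then obtain M where M: "\<And>i j x. x \<in> cball p s \<Longrightarrow> \<bar>partial_deriv i (partial_deriv j \<rho>) x\<bar> \<le> M" by blast
  define K where "K = real CARD('n) * (real CARD('n) * M)"
  have M0: "M \<ge> 0" using M[of p undefined undefined] s by force
  then have K0: "K \<ge> 0" by (simp add: K_def)
  have lip: "norm (grad \<rho> x - grad \<rho> p) \<le> K * norm (x - p)" if "x \<in> cball p s" for x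
    unfolding K_def
  proof (rule partials_Lipschitz[OF convex_cball _ _ _ that])
    fix z assume z: "z \<in> cball p s"
    then have zU: "z \<in> U" using s by blast
    show "grad \<rho> differentiable (at z)" by (rule grad_differentiable(1)[OF d2(2)[OF zU]])
    show "norm (partial_deriv i (grad \<rho>) z) \<le> real CARD('n) * M" for i
      unfolding grad_differentiable(2)[OF d2(2)[OF zU]] by (intro norm_vec_le) (use M[OF z] in simp)
  qed (use s in simp)
  have p0: "\<rho> p \<le> 0"
  proof -
    have "p \<in> closure \<Omega>" using assms(3) by (simp add: frontier_def)
    then obtain x where x: "\<And>n. x n \<in> \<Omega>" "x \<longlonglongrightarrow> p" unfolding closure_sequential by blast
    have "isCont \<rho> p" using d2(1)[OF U(2)] differentiable_imp_continuous_within by blast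
    then have "(\<lambda>n. \<rho> (x n)) \<longlonglongrightarrow> \<rho> p" using x(2) by (rule isCont_tendsto_compose)
    moreover have "\<forall>\<^sub>F n in sequentially. x n \<in> U" using x(2) U(1,2) by (rule topological_tendstoD)
    then have "\<forall>\<^sub>F n in sequentially. \<rho> (x n) \<le> 0"
      by eventually_elim (use U(5) x(1) in force)
    ultimately show ?thesis by (rule tendsto_upperbound) simp
  qed
  define N where "N = norm (grad \<rho> p)"
  have N: "N > 0" using U(2,4) by (simp add: N_def)
  define R where "R = min (s / 2) (N / (2 * (K + 1)))"
  have R: "R > 0" "2 * R \<le> s" "2 * R * K < N"
  proof -
    show "R > 0" "2 * R \<le> s" using s N K0 by (auto simp: R_def)
    have "R \<le> N / (2 * (K + 1))" by (simp add: R_def)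
    then have "2 * R * (K + 1) \<le> N" using K0 by (simp add: field_simps)
    then show "2 * R * K < N" using \<open>R > 0\<close> by (simp add: algebra_simps)
  qed
  define z where "z = p - (R / N) *\<^sub>R grad \<rho> p"
  have zp: "dist z p = R" using R N by (simp add: z_def dist_norm N_def[symmetric])
  have "x \<in> \<Omega>" if "x \<in> ball z R" for x
  proof -
    have "dist x p \<le> dist x z + dist z p" by (rule dist_triangle)
    then have xp: "dist x p \<le> 2 * R" using that zp by (simp add: dist_commute)
    then have xs: "x \<in> cball p s" using R by (simp add: dist_commute)
    then have xU: "x \<in> U" using s by blast
    have "\<bar>\<rho> x - \<rho> p - grad \<rho> p \<bullet> (x - p)\<bar> \<le> K * (norm (x - p))\<^sup>2"
      by (rule taylor_bound[OF convex_cball _ xs grad_has_derivative lip K0]) (use s d2 in auto)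
    then have le: "\<rho> x \<le> grad \<rho> p \<bullet> (x - p) + K * (norm (x - p))\<^sup>2" using p0 by linarith
    have "(norm (x - z))\<^sup>2 < R\<^sup>2" using that R by (simp add: dist_norm norm_minus_commute power_strict_mono)
    moreover have "(norm (a + c *\<^sub>R b))\<^sup>2 = (norm a)\<^sup>2 + 2 * c * (b \<bullet> a) + c\<^sup>2 * (norm b)\<^sup>2" for a b :: "real^'n" and c
      unfolding power2_norm_eq_inner
      by (simp add: inner_add_left inner_add_right inner_commute power2_eq_square algebra_simps)
    from this[of "x - p" "R / N" "grad \<rho> p"]
    have "(norm (x - z))\<^sup>2 = (norm (x - p))\<^sup>2 + 2 * (R / N) * (grad \<rho> p \<bullet> (x - p)) + (R / N)\<^sup>2 * N\<^sup>2"
      by (simp add: N_def z_def algebra_simps)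
    moreover have "(R / N)\<^sup>2 * N\<^sup>2 = R\<^sup>2" using N by (simp add: power_divide)
    ultimately have neg: "(norm (x - p))\<^sup>2 < - (2 * (R / N) * (grad \<rho> p \<bullet> (x - p)))" by linarith
    define q where "q = - (grad \<rho> p \<bullet> (x - p))"
    have nq: "(norm (x - p))\<^sup>2 < 2 * R / N * q" using neg by (simp add: q_def)
    then have "0 < 2 * R / N * q" by (rule le_less_trans[rotated]) simp
    then have q: "q > 0" using R N by (simp add: zero_less_mult_iff zero_less_divide_iff)
    have "K * (norm (x - p))\<^sup>2 \<le> K * (2 * R / N * q)" using nq K0 by (intro mult_left_mono) auto
    also have "\<dots> = (2 * R * K / N) * q" by simp
    also have "\<dots> < 1 * q" using R(3) N q by (intro mult_strict_right_mono) auto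
    finally have "\<rho> x < 0" using le by (simp add: q_def)
    then show ?thesis using U(5) xU by blast
  qed
  then show thesis using that[of R z] R zp by blast
qed

lemma has_hessian_norm_sq: "has_hessian (\<lambda>x. (norm (x - z))\<^sup>2) x (2 *\<^sub>R (x - z)) (\<lambda>h. 2 *\<^sub>R h)"
  unfolding has_hessian_def power2_norm_eq_inner
  by (rule exI[of _ "\<lambda>x. 2 *\<^sub>R (x - z)"]) (auto intro!: derivative_eq_intros always_eventually simp: inner_commute algebra_simps)

text \<open>The classical comparison with \<open>exp(-\<alpha>\<bar>x - z\<bar>\<^sup>2) - exp(-\<alpha>R\<^sup>2)\<close>, which vanishes on the sphere of
  radius \<open>R\<close> with nonzero slope and is a strict subsolution on the annulus if \<open>\<alpha>\<close> is large. At a positive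
  interior maximum of \<open>\<kappa> v - u\<close> the zeroth order term has a good sign because \<open>M \<ge> 0\<close>.\<close>
lemma hopf_lower_bound:
  fixes u :: "'a::euclidean_space \<Rightarrow> real"
  assumes R: "R > 0" and cont: "continuous_on (cball z R) u"
    and nonneg: "\<And>x. x \<in> cball z R \<Longrightarrow> u x \<ge> 0" and pos: "\<And>x. x \<in> ball z R \<Longrightarrow> u x > 0"
    and hess: "\<And>x. x \<in> ball z R \<Longrightarrow> has_hessian u x (g x) (H x)"
    and super: "\<And>x. x \<in> ball z R \<Longrightarrow> trace_of (H x) - B x \<bullet> g x \<le> M * u x"
    and B: "\<And>x. x \<in> ball z R \<Longrightarrow> norm (B x) \<le> \<beta>" and M: "M \<ge> 0"
  obtains c where "c > 0" "\<And>x. R / 2 \<le> dist z x \<Longrightarrow> dist z x \<le> R \<Longrightarrow> u x \<ge> c * (R - dist z x)"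
proof -
  let ?n = "real DIM('a)"
  have "z \<in> ball z R" using R by simp
  then have \<beta>: "\<beta> \<ge> 0" using B norm_ge_zero order_trans by blast
  define \<alpha> where "\<alpha> = 1 + (2 * ?n + 2 * R * \<beta> + M) / R\<^sup>2"
  have \<alpha>1: "\<alpha> \<ge> 1" using R \<beta> M by (simp add: \<alpha>_def)
  have "\<alpha> * R\<^sup>2 = R\<^sup>2 + 2 * ?n + 2 * R * \<beta> + M" using R by (simp add: \<alpha>_def field_simps)
  then have "\<alpha>\<^sup>2 * R\<^sup>2 = \<alpha> * (R\<^sup>2 + 2 * ?n + 2 * R * \<beta> + M)" by (simp add: power2_eq_square)
  moreover have "\<alpha> * M \<ge> 1 * M" using \<alpha>1 M by (intro mult_right_mono)
  moreover have "\<alpha> * R\<^sup>2 > 0" using \<alpha>1 R by simp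
  ultimately have \<alpha>: "\<alpha>\<^sup>2 * R\<^sup>2 - 2 * \<alpha> * ?n - 2 * \<alpha> * R * \<beta> - M > 0" by (simp add: algebra_simps)
  let ?e = "\<lambda>x. exp (- \<alpha> * (norm (x - z))\<^sup>2)"
  define E where "E = exp (- \<alpha> * R\<^sup>2)"
  define v where "v = (\<lambda>x. ?e x - E)"
  have E: "E > 0" by (simp add: E_def)
  have v_hess: "has_hessian v x ((- \<alpha> * ?e x) *\<^sub>R (2 *\<^sub>R (x - z)))
      (\<lambda>h. (- \<alpha> * ?e x) *\<^sub>R (2 *\<^sub>R h) + (\<alpha>\<^sup>2 * ?e x * ((2 *\<^sub>R (x - z)) \<bullet> h)) *\<^sub>R (2 *\<^sub>R (x - z)))" for x
    unfolding v_def
    by (rule has_hessian_compose[where f = "\<lambda>x. (norm (x - z))\<^sup>2" and p = "\<lambda>s. exp (- \<alpha> * s) - E"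
        and ?p1.0 = "\<lambda>s. - \<alpha> * exp (- \<alpha> * s)" and ?p2.0 = "\<alpha>\<^sup>2 * ?e x", OF has_hessian_norm_sq])
      (auto intro!: derivative_eq_intros always_eventually simp: power2_eq_square)
  obtain x1 where x1: "x1 \<in> sphere z (R / 2)" "\<And>x. x \<in> sphere z (R / 2) \<Longrightarrow> u x1 \<le> u x"
  proof -
    have ne: "sphere z (R / 2) \<noteq> {}" using R by simp
    have "continuous_on (sphere z (R / 2)) u"
      using R by (intro continuous_on_subset[OF cont]) auto
    then show thesis using that continuous_attains_inf[OF compact_sphere ne] by blast
  qed
  have u1: "u x1 > 0" using x1 R by (intro pos) auto
  define \<kappa> where "\<kappa> = u x1"
  have cmp: "\<kappa> * v x \<le> u x" if x: "R / 2 \<le> dist z x" "dist z x \<le> R" for x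
  proof -
    define A where "A = {x. R / 2 \<le> dist z x} \<inter> cball z R"
    have "compact A" unfolding A_def
      by (intro closed_Int_compact compact_cball closed_Collect_le continuous_intros)
    moreover have "x \<in> A" using x by (simp add: A_def)
    moreover have "continuous_on A (\<lambda>x. \<kappa> * v x - u x)"
      unfolding v_def by (intro continuous_intros continuous_on_subset[OF cont]) (auto simp: A_def)
    ultimately obtain x0 where x0: "x0 \<in> A" "\<And>y. y \<in> A \<Longrightarrow> \<kappa> * v y - u y \<le> \<kappa> * v x0 - u x0"
      using continuous_attains_sup[of A "\<lambda>x. \<kappa> * v x - u x"] by blast
    have "\<kappa> * v x0 - u x0 \<le> 0"
    proof (rule ccontr)
      assume "\<not> ?thesis"
      then have gt: "u x0 < \<kappa> * v x0" by simp
      have d: "R / 2 \<le> dist z x0" "dist z x0 \<le> R" using x0 by (auto simp: A_def)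
      have "dist z x0 \<noteq> R"
      proof
        assume "dist z x0 = R"
        then have "v x0 = 0" by (simp add: v_def E_def dist_norm norm_minus_commute)
        then show False using gt nonneg[of x0] d by simp
      qed
      moreover have "dist z x0 \<noteq> R / 2"
      proof
        assume "dist z x0 = R / 2"
        then have "\<kappa> \<le> u x0" using x1(2) by (simp add: \<kappa>_def)
        moreover have "?e x0 \<le> 1" using \<alpha>1 by simp
        then have "v x0 \<le> 1" using E unfolding v_def by linarith
        then have "\<kappa> * v x0 \<le> \<kappa> * 1" using u1 by (intro mult_left_mono) (auto simp: \<kappa>_def)
        ultimately show False using gt by simp
      qed
      ultimately have d': "R / 2 < dist z x0" "dist z x0 < R" using d by auto
      then have xb: "x0 \<in> ball z R" by simp
      have "open ({x. R / 2 < dist z x} \<inter> ball z R)"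
        by (intro open_Int open_Collect_less continuous_intros open_ball)
      then have "\<forall>\<^sub>F y in nhds x0. y \<in> {x. R / 2 < dist z x} \<inter> ball z R"
        using d' by (intro eventually_nhds_in_open) auto
      then have mx: "\<forall>\<^sub>F y in nhds x0. \<kappa> * v y + - 1 * u y \<le> \<kappa> * v x0 + - 1 * u x0"
        by eventually_elim (use x0(2) in \<open>auto simp: A_def\<close>)
      let ?gv = "(- \<alpha> * ?e x0) *\<^sub>R (2 *\<^sub>R (x0 - z))"
      let ?Hv = "\<lambda>h. (- \<alpha> * ?e x0) *\<^sub>R (2 *\<^sub>R h) + (\<alpha>\<^sup>2 * ?e x0 * ((2 *\<^sub>R (x0 - z)) \<bullet> h)) *\<^sub>R (2 *\<^sub>R (x0 - z))"
      have hh: "has_hessian (\<lambda>y. \<kappa> * v y + - 1 * u y) x0 (\<kappa> *\<^sub>R ?gv + - 1 *\<^sub>R g x0) (\<lambda>h. \<kappa> *\<^sub>R ?Hv h + - 1 *\<^sub>R H x0 h)"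
        by (intro has_hessian_add has_hessian_cmult v_hess hess xb)
      from local_max_hessian[OF hh mx]
      have g0: "g x0 = \<kappa> *\<^sub>R ?gv" and tr: "trace_of (\<lambda>h. \<kappa> *\<^sub>R ?Hv h + - 1 *\<^sub>R H x0 h) \<le> 0" by simp_all
      define s where "s = norm (x0 - z)"
      have s: "R / 2 < s" "s < R" using d' by (simp_all add: s_def dist_norm norm_minus_commute)
      have "trace_of (\<lambda>h. \<kappa> *\<^sub>R ?Hv h + - 1 *\<^sub>R H x0 h) = \<kappa> * trace_of ?Hv - trace_of (H x0)"
        by (subst trace_of_lincomb) simp
      also have "trace_of ?Hv = (- \<alpha> * ?e x0) * trace_of (\<lambda>h :: 'a. 2 *\<^sub>R h) + \<alpha>\<^sup>2 * ?e x0 * (norm (2 *\<^sub>R (x0 - z)))\<^sup>2"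
        by (rule trace_of_rank_one_update)

      also have "\<dots> = ?e x0 * (4 * \<alpha>\<^sup>2 * s\<^sup>2 - 2 * \<alpha> * ?n)"
        unfolding s_def norm_scaleR power_mult_distrib by (simp add: trace_of_def algebra_simps)
      finally have "\<kappa> * (?e x0 * (4 * \<alpha>\<^sup>2 * s\<^sup>2 - 2 * \<alpha> * ?n)) \<le> trace_of (H x0)" using tr by simp
      also have "\<dots> \<le> B x0 \<bullet> g x0 + M * u x0" using super[OF xb] by simp
      also have "B x0 \<bullet> g x0 \<le> \<kappa> * (?e x0 * (2 * \<alpha> * R * \<beta>))"
      proof -
        have "B x0 \<bullet> g x0 \<le> norm (B x0) * norm (g x0)" by (rule norm_cauchy_schwarz)
        also have "norm (g x0) = \<kappa> * (?e x0 * (2 * \<alpha> * s))" using u1 \<alpha>1 by (simp add: g0 s_def \<kappa>_def abs_mult)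
        also have "norm (B x0) * (\<kappa> * (?e x0 * (2 * \<alpha> * s))) \<le> \<beta> * (\<kappa> * (?e x0 * (2 * \<alpha> * R)))"
          using B[OF xb] \<beta> u1 \<alpha>1 s R by (intro mult_mono) (auto simp: \<kappa>_def)
        finally show ?thesis by (simp add: mult_ac)
      qed
      also have "M * u x0 \<le> M * (\<kappa> * v x0)" using gt M by (intro mult_left_mono) auto
      also have "M * (\<kappa> * v x0) \<le> M * (\<kappa> * ?e x0)"
        using M u1 E by (intro mult_left_mono) (auto simp: v_def \<kappa>_def)
      finally have "(\<kappa> * ?e x0) * (4 * \<alpha>\<^sup>2 * s\<^sup>2 - 2 * \<alpha> * ?n - 2 * \<alpha> * R * \<beta> - M) \<le> 0"
        by (simp add: algebra_simps)
      moreover have "\<kappa> * ?e x0 > 0" using u1 by (simp add: \<kappa>_def)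
      ultimately have "\<not> 4 * \<alpha>\<^sup>2 * s\<^sup>2 - 2 * \<alpha> * ?n - 2 * \<alpha> * R * \<beta> - M > 0"
        using mult_pos_pos by (metis not_less)
      moreover have "(R / 2)\<^sup>2 \<le> s\<^sup>2" using s R by (intro power_mono) auto
      then have "\<alpha>\<^sup>2 * R\<^sup>2 \<le> 4 * \<alpha>\<^sup>2 * s\<^sup>2"
        using mult_left_mono[of "(R / 2)\<^sup>2" "s\<^sup>2" "4 * \<alpha>\<^sup>2"] by (simp add: power_divide)
      ultimately show False using \<alpha> by linarith
    qed
    then show ?thesis using x0(2)[OF \<open>x \<in> A\<close>] by simp
  qed
  have low: "E * (\<alpha> * R) * (R - dist z x) \<le> v x" if x: "R / 2 \<le> dist z x" "dist z x \<le> R" for x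
  proof -
    define s where "s = dist z x"
    have e: "?e x = E * exp (\<alpha> * (R\<^sup>2 - s\<^sup>2))"
      by (simp add: E_def s_def dist_norm norm_minus_commute exp_add[symmetric] algebra_simps)
    have "R * (R - s) \<le> (R + s) * (R - s)" using x R by (intro mult_right_mono) (auto simp: s_def)
    then have "\<alpha> * (R * (R - s)) \<le> \<alpha> * (R\<^sup>2 - s\<^sup>2)" using \<alpha>1 by (intro mult_left_mono) (auto simp: power2_eq_square algebra_simps)
    also have "\<dots> \<le> exp (\<alpha> * (R\<^sup>2 - s\<^sup>2)) - 1" using exp_ge_add_one_self[of "\<alpha> * (R\<^sup>2 - s\<^sup>2)"] by linarith
    finally have "E * (\<alpha> * (R * (R - s))) \<le> E * (exp (\<alpha> * (R\<^sup>2 - s\<^sup>2)) - 1)" using E by (intro mult_left_mono) auto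
    then show ?thesis unfolding v_def e by (simp add: algebra_simps s_def)
  qed
  show thesis
  proof (rule that[of "\<kappa> * (E * (\<alpha> * R))"])
    show "\<kappa> * (E * (\<alpha> * R)) > 0" using u1 E \<alpha>1 R by (simp add: \<kappa>_def)
    fix x assume x: "R / 2 \<le> dist z x" "dist z x \<le> R"
    have "\<kappa> * (E * (\<alpha> * R) * (R - dist z x)) \<le> \<kappa> * v x"
      using low[OF x] u1 by (intro mult_left_mono) (auto simp: \<kappa>_def)
    then show "\<kappa> * (E * (\<alpha> * R)) * (R - dist z x) \<le> u x" using cmp[OF x] by (simp add: mult.assoc)
  qed
qed

section \<open>Distance to the boundary of a convex domain\<close>

lemma continuous_image_bounded:
  fixes f :: "'a::euclidean_space \<Rightarrow> 'b::real_normed_vector"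
  assumes "continuous_on (closure S) f" "bounded S"
  obtains C where "C \<ge> 0" "\<And>x. x \<in> closure S \<Longrightarrow> norm (f x) \<le> C"
proof -
  have "compact (f ` closure S)"
    using assms by (intro compact_continuous_image) (auto simp: compact_eq_bounded_closed)
  then obtain C where C: "\<And>y. y \<in> f ` closure S \<Longrightarrow> norm y \<le> C"
    using compact_imp_bounded bounded_iff by metis
  show thesis
  proof (rule that[of "max C 0"])
    fix x assume "x \<in> closure S"
    then have "norm (f x) \<le> C" using C by blast
    then show "norm (f x) \<le> max C 0" by simp
  qed simp
qed

lemma ball_infdist_frontier:
  fixes S :: "'a::euclidean_space set"
  assumes "x \<in> S" shows "ball x (infdist x (frontier S)) \<subseteq> S"
proof (rule ccontr)
  let ?d = "infdist x (frontier S)"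
  assume "\<not> ball x ?d \<subseteq> S"
  then have ne: "ball x ?d - S \<noteq> {}" by blast
  then have "x \<in> ball x ?d" by (metis Diff_empty ball_eq_empty centre_in_ball empty_Diff not_less)
  then have "ball x ?d \<inter> S \<noteq> {}" using assms by blast
  then have "ball x ?d \<inter> frontier S \<noteq> {}" using ne by (intro connected_Int_frontier convex_connected convex_ball)
  then obtain q where "q \<in> frontier S" "dist x q < ?d" by auto
  then show False using infdist_le[of q "frontier S" x] by simp
qed

text \<open>If the inequality failed, the ball around \<open>y\<close> inside \<open>S\<close> would contain a point \<open>y'\<close> strictly beyond the
  tangent hyperplane at \<open>p\<close> of the ball around \<open>x\<close>. The line from \<open>y'\<close> through \<open>p\<close> enters that ball, so \<open>p\<close> would lie
  between two points of the open convex set \<open>S\<close>.\<close>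
lemma convex_frontier_halfspace:
  fixes S :: "'a::euclidean_space set"
  assumes S: "convex S" "open S" and x: "x \<in> S" and y: "y \<in> S" and p: "p \<in> frontier S"
    and d: "d > 0" "ball x d \<subseteq> S" "dist x p = d"
  shows "infdist y (frontier S) \<le> (y - p) \<bullet> ((1 / d) *\<^sub>R (x - p))"
proof (rule ccontr)
  let ?r = "infdist y (frontier S)"
  define n where "n = (1 / d) *\<^sub>R (x - p)"
  assume "\<not> ?thesis"
  then have lt: "(y - p) \<bullet> n < ?r" by (simp only: n_def not_le)
  have n1: "norm n = 1" unfolding n_def norm_scaleR d(3)[unfolded dist_norm] using d(1) by simp
  then have nn: "n \<bullet> n = 1" by (simp only: norm_eq_1)
  have xp: "x - p = d *\<^sub>R n" using d(1) by (simp add: n_def)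
  obtain t where t: "(y - p) \<bullet> n < t" "t < ?r" "t \<ge> 0"
  proof (cases "(y - p) \<bullet> n < 0")
    case True
    have "y \<notin> frontier S" using S y by (metis Diff_iff frontier_def interior_open)
    then have "?r > 0" using in_closed_iff_infdist_zero[OF frontier_closed, of S y] p infdist_nonneg[of y "frontier S"]
      by (metis empty_iff less_eq_real_def)
    then show thesis using that[of 0] True by simp
  next
    case False
    obtain t where "(y - p) \<bullet> n < t" "t < ?r" using lt dense by blast
    then show thesis using that[of t] False by simp
  qed
  define y' where "y' = y - t *\<^sub>R n"
  have "y' \<in> ball y ?r" using t n1 by (simp add: y'_def dist_norm)
  then have y': "y' \<in> S" using ball_infdist_frontier[OF y] by blast
  have neg: "(y' - p) \<bullet> n < 0" using t(1) nn by (simp add: y'_def inner_diff_left)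
  define q where "q = p - y'"
  have qn: "q \<bullet> n > 0" using neg by (simp add: q_def inner_diff_left)
  have q0: "q \<noteq> 0" using qn by auto
  \<comment> \<open>This \<open>s\<close> makes \<open>p + s q\<close> the point of the line nearest to \<open>x\<close>.\<close>
  define s where "s = d * (q \<bullet> n) / (norm q)\<^sup>2"
  have s: "s > 0" using qn d q0 by (simp add: s_def)
  have "s * (norm q)\<^sup>2 = d * (q \<bullet> n)" using q0 by (simp add: s_def)
  moreover have "d * (q \<bullet> n) = q \<bullet> (x - p)" by (simp add: xp)
  ultimately have sq: "s * (norm q)\<^sup>2 = q \<bullet> (x - p)" by simp
  have "(norm ((x - p) - s *\<^sub>R q))\<^sup>2 = (norm (x - p))\<^sup>2 - 2 * s * (q \<bullet> (x - p)) + s * (s * (norm q)\<^sup>2)"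
    unfolding power2_norm_eq_inner by (simp add: inner_diff_left inner_diff_right inner_commute algebra_simps)
  also have "\<dots> = (norm (x - p))\<^sup>2 - s * (q \<bullet> (x - p))" unfolding sq by (simp add: algebra_simps)
  also have "\<dots> < (norm (x - p))\<^sup>2" using s sq q0 by (metis diff_gt_0_iff_gt diff_diff_eq2 add_diff_cancel_left' mult_pos_pos zero_less_norm_iff zero_less_power)
  finally have "norm ((x - p) - s *\<^sub>R q) < d" using d(1,3) by (metis dist_norm norm_ge_zero power_less_imp_less_base)
  then have "p + s *\<^sub>R q \<in> ball x d" by (simp add: dist_norm algebra_simps)
  then have zS: "p + s *\<^sub>R q \<in> S" using d by blast
  have "p = (1 / (1 + s)) *\<^sub>R (p + s *\<^sub>R q) + (s / (1 + s)) *\<^sub>R y'"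
  proof -
    have "p + s *\<^sub>R q + s *\<^sub>R y' = (1 + s) *\<^sub>R p" by (simp add: q_def algebra_simps)
    moreover have "(1 / (1 + s)) *\<^sub>R (p + s *\<^sub>R q) + (s / (1 + s)) *\<^sub>R y' = (1 / (1 + s)) *\<^sub>R (p + s *\<^sub>R q + s *\<^sub>R y')"
      by (simp add: scaleR_add_right)
    ultimately show ?thesis using s by simp
  qed
  also have "\<dots> \<in> S" using s by (intro convexD[OF S(1) zS y']) (auto simp: field_simps)
  finally have "p \<in> S" .
  then show False using p S by (simp add: frontier_def interior_open)
qed

section \<open>The principal eigenfunction up to the boundary\<close>

text \<open>The constant of \<open>log_grad_bound\<close>, where \<open>k\<close> is a Lipschitz constant of \<open>\<nabla>u\<^sub>0\<close> and \<open>g\<close> a bound for its length. The first entry of the maximum belongs to points within \<open>\<theta> / (4k)\<close> of the boundary,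
  the second to the others, where \<open>min \<delta> (\<theta>\<^sup>2 / (16 k))\<close> is a lower bound for \<open>u\<^sub>0\<close>.\<close>
definition concavity_const :: "real \<Rightarrow> real \<Rightarrow> real \<Rightarrow> real \<Rightarrow> real" where
  "concavity_const k g \<delta> \<theta> = max (6 * k / \<theta>) (g / min \<delta> (\<theta>\<^sup>2 / (16 * k)) + 4 * k / \<theta>)"

locale principal_pair =
  fixes \<Omega> :: "(real^'n::finite) set" and B :: "real^'n \<Rightarrow> real^'n" and c :: "real^'n \<Rightarrow> real"
    and lam0 :: real and u0 :: "real^'n \<Rightarrow> real"
  assumes open_dom: "open \<Omega>" and nonempty: "\<Omega> \<noteq> {}" and bounded_dom: "bounded \<Omega>" and convex_dom: "convex \<Omega>"
    and smooth_bd: "smooth_boundary \<Omega>"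
    and B_C3: "\<And>j. Ck_closure 3 \<Omega> (\<lambda>x. B x $ j)" and c_C2: "Ck_closure 2 \<Omega> c"
    and c_nonneg: "\<And>x. x \<in> \<Omega> \<Longrightarrow> c x \<ge> 0"
    and pair: "principal_eigenpair \<Omega> B c lam0 u0"
begin

lemma u0_pos: "x \<in> \<Omega> \<Longrightarrow> 0 < u0 x"
  using pair unfolding principal_eigenpair_def by blast

lemma u0_C2: "Ck_closure 2 \<Omega> u0"
  using pair unfolding principal_eigenpair_def by blast

lemma u0_Ck_on: "Ck_on 2 \<Omega> u0"
  using u0_C2 unfolding Ck_closure_def by blast

lemma u0_cont: "continuous_on (closure \<Omega>) u0"
  using u0_C2 unfolding Ck_closure_def by blast

lemma u0_frontier: "x \<in> frontier \<Omega> \<Longrightarrow> u0 x = 0"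
  using pair unfolding principal_eigenpair_def dirichlet_eigenfunction_def by auto

lemma u0_nonneg: "x \<in> closure \<Omega> \<Longrightarrow> 0 \<le> u0 x"
  using u0_pos[of x] u0_frontier[of x] by (cases "x \<in> \<Omega>") (auto simp: frontier_def open_dom interior_open)

lemma closure_cases: "x \<in> closure \<Omega> \<Longrightarrow> x \<in> \<Omega> \<or> x \<in> frontier \<Omega>"
  by (auto simp: frontier_def open_dom interior_open)

lemma frontier_disj: "x \<in> \<Omega> \<Longrightarrow> x \<notin> frontier \<Omega>"
  by (auto simp: frontier_def open_dom interior_open)

lemma frontier_closure: "x \<in> frontier \<Omega> \<Longrightarrow> x \<in> closure \<Omega>"
  by (simp add: frontier_def)

lemma u0_differentiable: "x \<in> \<Omega> \<Longrightarrow> u0 differentiable (at x)" "x \<in> \<Omega> \<Longrightarrow> partial_deriv i u0 differentiable (at x)"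
  using Ck_on_2_differentiable[OF u0_Ck_on] by auto

lemma u0_grad: "x \<in> \<Omega> \<Longrightarrow> (u0 has_derivative (\<lambda>h. grad u0 x \<bullet> h)) (at x)"
  by (intro grad_has_derivative u0_differentiable)

text \<open>The eigenvalue equation is stated for the complexification of \<open>u0\<close>. Its real part has the same
  second order data as \<open>u0\<close>, by uniqueness.\<close>
lemma u0_hessian:
  assumes x: "x \<in> \<Omega>"
  obtains H where "has_hessian u0 x (grad u0 x) H" "trace_of H = B x \<bullet> grad u0 x + (c x - lam0) * u0 x"
proof -
  let ?u = "\<lambda>x. complex_of_real (u0 x)"
  have ef: "Ck_on 2 \<Omega> ?u" "L_op B c ?u x = - of_real lam0 * ?u x"
    using pair x unfolding principal_eigenpair_def dirichlet_eigenfunction_def by auto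
  obtain H where H: "has_hessian (\<lambda>z. u0 z) x (\<chi> i. partial_deriv i u0 x) H" "trace_of H = laplacian u0 x"
    by (rule Ck2_has_hessian[OF open_dom x u0_Ck_on bounded_linear_ident])
  obtain H' where H': "has_hessian (\<lambda>z. Re (?u z)) x (\<chi> i. Re (partial_deriv i ?u x)) H'" "trace_of H' = Re (laplacian ?u x)"
    by (rule Ck2_has_hessian[OF open_dom x ef(1) bounded_linear_Re])
  have H'': "has_hessian u0 x (\<chi> i. Re (partial_deriv i ?u x)) H'" using H' by simp
  have g: "has_hessian u0 x (grad u0 x) H" using H by (simp add: grad_def)
  have eq: "(\<chi> i. Re (partial_deriv i ?u x)) = grad u0 x" "H' = H"
    using has_hessian_unique[OF g H''] by auto
  have "Re (L_op B c ?u x) = Re (laplacian ?u x) - (\<Sum>i\<in>UNIV. B x $ i * Re (partial_deriv i ?u x)) - c x * u0 x"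
    by (simp add: L_op_def)
  also have "(\<Sum>i\<in>UNIV. B x $ i * Re (partial_deriv i ?u x)) = B x \<bullet> grad u0 x"
    unfolding eq(1)[symmetric] by (simp add: inner_vec_def)
  finally have "trace_of H = B x \<bullet> grad u0 x + (c x - lam0) * u0 x"
    using ef(2) H'(2) eq(2) by (simp add: algebra_simps)
  with g show thesis by (rule that)
qed

definition grad_ext :: "real^'n \<Rightarrow> real^'n" where
  "grad_ext = (SOME g. continuous_on (closure \<Omega>) g \<and> (\<forall>x\<in>\<Omega>. g x = grad u0 x))"

lemma grad_ext: "continuous_on (closure \<Omega>) grad_ext" "x \<in> \<Omega> \<Longrightarrow> grad_ext x = grad u0 x"
proof -
  have "\<forall>j. \<exists>g. continuous_on (closure \<Omega>) g \<and> (\<forall>x\<in>\<Omega>. g x = partial_derivs [j] u0 x)"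
  proof
    fix j show "\<exists>g. continuous_on (closure \<Omega>) g \<and> (\<forall>x\<in>\<Omega>. g x = partial_derivs [j] u0 x)"
      using u0_C2 unfolding Ck_closure_def by (elim conjE allE[of _ "[j]"]) simp
  qed
  from choice[OF this] obtain g where
    "\<forall>j. continuous_on (closure \<Omega>) (g j) \<and> (\<forall>x\<in>\<Omega>. g j x = partial_derivs [j] u0 x)" by blast
  then have g: "\<And>j. continuous_on (closure \<Omega>) (g j)" "\<And>j x. x \<in> \<Omega> \<Longrightarrow> g j x = partial_deriv j u0 x" by auto
  have "continuous_on (closure \<Omega>) (\<lambda>x. \<chi> j. g j x)" by (intro continuous_on_vec_lambda g)
  moreover have "\<forall>x\<in>\<Omega>. (\<chi> j. g j x) = grad u0 x" using g(2) by (simp add: grad_def)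
  ultimately have "\<exists>g. continuous_on (closure \<Omega>) g \<and> (\<forall>x\<in>\<Omega>. g x = grad u0 x)" by blast
  from someI_ex[OF this] show "continuous_on (closure \<Omega>) grad_ext" "x \<in> \<Omega> \<Longrightarrow> grad_ext x = grad u0 x"
    unfolding grad_ext_def by blast+
qed

abbreviation grad_norm :: real where "grad_norm \<equiv> Ck_norm 1 \<Omega> (grad u0)"

lemma grad_partials_bounded:
  assumes "length is \<le> 1" shows "\<exists>C. \<forall>x\<in>\<Omega>. norm (partial_derivs is (grad u0) x) \<le> C"
proof (cases "is")
  case Nil
  obtain C where "C \<ge> 0" "\<And>x. x \<in> closure \<Omega> \<Longrightarrow> norm (grad_ext x) \<le> C"
    using continuous_image_bounded[OF grad_ext(1) bounded_dom] by blast
  then have "\<forall>x\<in>\<Omega>. norm (grad u0 x) \<le> C"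
    using grad_ext(2) closure_subset[of \<Omega>] by (metis subsetD)
  then show ?thesis using Nil by auto
next
  case (Cons i js)
  then have i: "is = [i]" using assms by simp
  have "\<forall>j. \<exists>C. \<forall>x\<in>\<Omega>. norm (partial_derivs [i, j] u0 x) \<le> C"
    by (intro allI Ck_closure_bounded[OF u0_C2 bounded_dom]) simp
  from choice[OF this] obtain C where C: "\<And>j x. x \<in> \<Omega> \<Longrightarrow> \<bar>partial_deriv i (partial_deriv j u0) x\<bar> \<le> C j" by auto
  have "norm (partial_deriv i (grad u0) x) \<le> real CARD('n) * Max (range C)" if x: "x \<in> \<Omega>" for x
    unfolding grad_differentiable(2)[OF u0_differentiable(2)[OF x]]
  proof (rule norm_vec_le)
    fix j show "\<bar>(\<chi> j. partial_deriv i (partial_deriv j u0) x) $ j\<bar> \<le> Max (range C)"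
      using order_trans[OF C[OF x, of j] Max_ge[of "range C" "C j"]] by simp
  qed
  then show ?thesis using i by auto
qed

lemma grad_bound: "x \<in> \<Omega> \<Longrightarrow> norm (grad u0 x) \<le> grad_norm"
  using Ck_norm_upper[of 1 \<Omega> "grad u0" x "[]", OF grad_partials_bounded] by simp

definition hess_bound :: real where "hess_bound = real CARD('n) * grad_norm"

lemma grad_norm_nonneg: "grad_norm \<ge> 0"
  using nonempty grad_bound norm_ge_zero order_trans by blast

lemma hess_bound_nonneg: "hess_bound \<ge> 0"
  using grad_norm_nonneg by (simp add: hess_bound_def)

lemma grad_Lipschitz:
  assumes "x \<in> \<Omega>" "y \<in> \<Omega>" shows "norm (grad u0 y - grad u0 x) \<le> hess_bound * norm (y - x)"
  unfolding hess_bound_def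
proof (rule partials_Lipschitz[OF convex_dom _ _ assms])
  fix z assume z: "z \<in> \<Omega>"
  show "grad u0 differentiable (at z)" by (rule grad_differentiable(1)[OF u0_differentiable(2)[OF z]])
  show "norm (partial_deriv i (grad u0) z) \<le> grad_norm" for i
    using Ck_norm_upper[of 1 \<Omega> "grad u0" z "[i]", OF grad_partials_bounded z] by simp
qed

text \<open>Inequalities between points of the domain carry over to the boundary by continuity; first order data at the
  boundary are always those of \<open>grad_ext\<close>.\<close>
lemma grad_ext_Lipschitz:
  assumes "x \<in> \<Omega>" "p \<in> closure \<Omega>" shows "norm (grad_ext p - grad u0 x) \<le> hess_bound * norm (p - x)"
proof -
  have "norm (grad_ext p - grad u0 x) - hess_bound * norm (p - x) \<le> 0"
  proof (rule continuous_le_on_closure[OF _ assms(2), of "\<lambda>p. norm (grad_ext p - grad u0 x) - hess_bound * norm (p - x)"])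
    show "continuous_on (closure \<Omega>) (\<lambda>p. norm (grad_ext p - grad u0 x) - hess_bound * norm (p - x))"
      by (intro continuous_intros grad_ext)
  qed (use grad_Lipschitz[OF assms(1)] grad_ext(2) in auto)
  then show ?thesis by simp
qed

lemma u0_taylor:
  assumes "x \<in> \<Omega>" "p \<in> closure \<Omega>" shows "\<bar>u0 p - u0 x - grad u0 x \<bullet> (p - x)\<bar> \<le> hess_bound * (norm (p - x))\<^sup>2"
proof -
  have "\<bar>u0 p - u0 x - grad u0 x \<bullet> (p - x)\<bar> - hess_bound * (norm (p - x))\<^sup>2 \<le> 0"
  proof (rule continuous_le_on_closure[OF _ assms(2), of "\<lambda>p. \<bar>u0 p - u0 x - grad u0 x \<bullet> (p - x)\<bar> - hess_bound * (norm (p - x))\<^sup>2"])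
    show "continuous_on (closure \<Omega>) (\<lambda>p. \<bar>u0 p - u0 x - grad u0 x \<bullet> (p - x)\<bar> - hess_bound * (norm (p - x))\<^sup>2)"
      by (intro continuous_intros u0_cont)
    fix y assume "y \<in> \<Omega>"
    then have "\<bar>u0 y - u0 x - grad u0 x \<bullet> (y - x)\<bar> \<le> hess_bound * (norm (y - x))\<^sup>2"
      by (intro taylor_bound[OF convex_dom assms(1) _ u0_grad grad_Lipschitz[OF assms(1)] hess_bound_nonneg])
    then show "\<bar>u0 y - u0 x - grad u0 x \<bullet> (y - x)\<bar> - hess_bound * (norm (y - x))\<^sup>2 \<le> 0" by simp
  qed
  then show ?thesis by simp
qed

lemma Ck_closure_cont_bounded:
  assumes "Ck_closure k \<Omega> f" shows "\<exists>C. \<forall>x\<in>\<Omega>. norm (f x) \<le> C"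
  using Ck_closure_bounded[OF assms bounded_dom, of "[]"] by simp

lemma B_bound: "x \<in> \<Omega> \<Longrightarrow> norm (B x) \<le> (\<Sum>j\<in>UNIV. Ck_norm 2 \<Omega> (\<lambda>x. B x $ j))"
proof -
  assume x: "x \<in> \<Omega>"
  have "norm (B x) \<le> (\<Sum>j\<in>UNIV. \<bar>B x $ j\<bar>)" by (rule norm_le_l1_cart)
  also have "\<dots> \<le> (\<Sum>j\<in>UNIV. Ck_norm 2 \<Omega> (\<lambda>x. B x $ j))"
  proof (rule sum_mono)
    fix j
    have "norm (partial_derivs [] (\<lambda>x. B x $ j) x) \<le> Ck_norm 2 \<Omega> (\<lambda>x. B x $ j)"
      by (rule Ck_norm_upper[OF Ck_closure_bounded[OF B_C3 bounded_dom] x]) auto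
    then show "\<bar>B x $ j\<bar> \<le> Ck_norm 2 \<Omega> (\<lambda>x. B x $ j)" by simp
  qed
  finally show ?thesis .
qed

text \<open>With zero gradient at \<open>p\<close>, Taylor's formula with a Lipschitz gradient makes \<open>u0\<close> quadratically small
  towards \<open>p\<close>, whereas Hopf's lemma gives linear growth.\<close>
lemma grad_ext_frontier_nonzero:
  assumes p: "p \<in> frontier \<Omega>" shows "grad_ext p \<noteq> 0"
proof
  assume g0: "grad_ext p = 0"
  obtain z R where R: "R > 0" "ball z R \<subseteq> \<Omega>" "dist z p = R"
    by (rule interior_ball[OF open_dom smooth_bd p])
  have cb: "cball z R \<subseteq> closure \<Omega>" using closure_mono[OF R(2)] R(1) by simp
  obtain C where C: "\<And>x. x \<in> \<Omega> \<Longrightarrow> \<bar>c x\<bar> \<le> C" using Ck_closure_cont_bounded[OF c_C2] by auto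
  have "\<forall>x\<in>\<Omega>. \<exists>H. has_hessian u0 x (grad u0 x) H \<and> trace_of H = B x \<bullet> grad u0 x + (c x - lam0) * u0 x"
    using u0_hessian by metis
  from bchoice[OF this] obtain H where H: "\<And>x. x \<in> \<Omega> \<Longrightarrow> has_hessian u0 x (grad u0 x) (H x)"
    "\<And>x. x \<in> \<Omega> \<Longrightarrow> trace_of (H x) = B x \<bullet> grad u0 x + (c x - lam0) * u0 x" by blast
  have zO: "z \<in> \<Omega>" using R by auto
  obtain k where k: "k > 0" "\<And>x. R / 2 \<le> dist z x \<Longrightarrow> dist z x \<le> R \<Longrightarrow> u0 x \<ge> k * (R - dist z x)"
  proof -
    assume *: "\<And>k. k > 0 \<Longrightarrow> (\<And>x. R / 2 \<le> dist z x \<Longrightarrow> dist z x \<le> R \<Longrightarrow> u0 x \<ge> k * (R - dist z x)) \<Longrightarrow> thesis"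
    show thesis
    proof (rule hopf_lower_bound[of R z u0 "grad u0" H B "C + \<bar>lam0\<bar>" "\<Sum>j\<in>UNIV. Ck_norm 2 \<Omega> (\<lambda>x. B x $ j)"])
      show "\<And>k. k > 0 \<Longrightarrow> (\<And>x. R / 2 \<le> dist z x \<Longrightarrow> dist z x \<le> R \<Longrightarrow> k * (R - dist z x) \<le> u0 x) \<Longrightarrow> thesis"
        by (rule *)
    show "R > 0" by (rule R)
    show "continuous_on (cball z R) u0" using u0_cont cb by (rule continuous_on_subset)
    show "\<And>x. x \<in> cball z R \<Longrightarrow> 0 \<le> u0 x" using cb u0_nonneg by blast
    show "\<And>x. x \<in> ball z R \<Longrightarrow> 0 < u0 x" using R(2) u0_pos by blast
    show "\<And>x. x \<in> ball z R \<Longrightarrow> has_hessian u0 x (grad u0 x) (H x)" using R(2) H(1) by blast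
    show "\<And>x. x \<in> ball z R \<Longrightarrow> norm (B x) \<le> (\<Sum>j\<in>UNIV. Ck_norm 2 \<Omega> (\<lambda>x. B x $ j))" using R(2) B_bound by blast
    show "0 \<le> C + \<bar>lam0\<bar>" using C[OF zO] by linarith
    fix x assume "x \<in> ball z R"
    then have x: "x \<in> \<Omega>" using R by blast
    have "(c x - lam0) * u0 x \<le> (C + \<bar>lam0\<bar>) * u0 x"
      using C[OF x] u0_pos[OF x] by (intro mult_right_mono) auto
    then show "trace_of (H x) - B x \<bullet> grad u0 x \<le> (C + \<bar>lam0\<bar>) * u0 x" using H(2)[OF x] by simp
    qed
  qed
  \<comment> \<open>A step from \<open>p\<close> towards the centre, small enough for the linear lower bound to exceed the quadratic upper bound.\<close>
  define t where "t = min (1 / 2) (k / (4 * (hess_bound + 1) * R))"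
  have t: "0 < t" "t \<le> 1 / 2" "2 * hess_bound * t * R < k"
  proof -
    show "0 < t" using k R hess_bound_nonneg by (simp add: t_def)
    show "t \<le> 1 / 2" unfolding t_def by (rule min.cobounded1)
    have "t \<le> k / (4 * (hess_bound + 1) * R)" by (simp add: t_def)
    moreover have "4 * (hess_bound + 1) * R > 0" using hess_bound_nonneg R by simp
    ultimately have "4 * (hess_bound + 1) * R * t \<le> k" by (simp add: pos_le_divide_eq mult.commute)
    moreover have "hess_bound * t * R \<ge> 0" "R * t > 0" using hess_bound_nonneg R \<open>0 < t\<close> by auto
    ultimately show "2 * hess_bound * t * R < k" by (simp add: algebra_simps)
  qed
  define x where "x = p + t *\<^sub>R (z - p)"
  have xp: "norm (x - p) = t * R" using t R by (simp add: x_def dist_norm)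
  have "z - x = (1 - t) *\<^sub>R (z - p)" by (simp add: x_def algebra_simps)
  then have zx: "dist z x = (1 - t) * R" using t R by (simp add: dist_norm)
  have "t * R \<le> R / 2" using t R mult_right_mono[of t "1/2" R] by simp
  then have dR: "R / 2 \<le> dist z x" "dist z x \<le> R" "dist z x < R" using zx mult_pos_pos[OF t(1) R(1)] by (simp_all add: algebra_simps)
  then have x: "x \<in> \<Omega>" using R by auto
  have low: "k * (t * R) \<le> u0 x" using k(2)[OF dR(1,2)] zx by (simp add: algebra_simps)
  have pc: "p \<in> closure \<Omega>" by (rule frontier_closure[OF p])
  have "norm (grad u0 x) \<le> hess_bound * norm (p - x)" using grad_ext_Lipschitz[OF x pc] g0 by simp
  then have gx: "norm (grad u0 x) \<le> hess_bound * (t * R)" using xp by (simp add: norm_minus_commute)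
  have "\<bar>u0 p - u0 x - grad u0 x \<bullet> (p - x)\<bar> \<le> hess_bound * (norm (p - x))\<^sup>2" by (rule u0_taylor[OF x pc])
  moreover have "\<bar>grad u0 x \<bullet> (p - x)\<bar> \<le> norm (grad u0 x) * norm (p - x)" by (rule Cauchy_Schwarz_ineq2)
  moreover have "norm (grad u0 x) * norm (p - x) \<le> hess_bound * (t * R) * (t * R)"
    using gx xp t R by (simp add: norm_minus_commute mult_right_mono)
  ultimately have "u0 x \<le> 2 * hess_bound * (t * R) * (t * R)"
    using u0_frontier[OF p] xp by (simp add: norm_minus_commute power2_eq_square)
  also have "\<dots> = (2 * hess_bound * t * R) * (t * R)" by simp
  also have "\<dots> < k * (t * R)" using t R by (intro mult_strict_right_mono) auto
  finally show False using low by simp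
qed

lemma frontier_nonempty: "frontier \<Omega> \<noteq> {}"
  using bounded_dom nonempty by (metis frontier_eq_empty not_bounded_UNIV)

text \<open>Critical points of \<open>u0\<close> stay away from the boundary, so they form a compact set, on which \<open>u0\<close> has a
  positive minimum. The set is nonempty because \<open>u0\<close> has an interior maximum.\<close>
lemma delta0_pos: "delta0 \<Omega> u0 > 0"
  and critical_large: "x \<in> \<Omega> \<Longrightarrow> grad u0 x = 0 \<Longrightarrow> u0 x \<ge> 2 * delta0 \<Omega> u0"
proof -
  let ?S = "critical_points \<Omega> u0"
  have cc: "compact (closure \<Omega>)" using bounded_dom by (simp add: compact_closure)
  have "x \<in> ?S \<longleftrightarrow> x \<in> closure \<Omega> \<and> grad_ext x = 0" for x
    using closure_cases[of x] grad_ext(2)[of x] grad_ext_frontier_nonzero[of x] frontier_disj[of x]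
      closure_subset[of \<Omega>] by (cases "x \<in> \<Omega>") (auto simp: critical_points_def)
  then have S: "?S = {x \<in> closure \<Omega>. grad_ext x = 0}" by blast
  have "closed {x \<in> closure \<Omega>. grad_ext x = 0}"
    by (intro continuous_closed_preimage_constant grad_ext closed_closure)
  then have "compact ?S" unfolding S using cc by (metis (no_types, lifting) Collect_mem_eq Collect_mono_iff bounded_subset compact_eq_bounded_closed)
  moreover have ne: "?S \<noteq> {}"
  proof -
    obtain x where x: "x \<in> closure \<Omega>" "\<And>y. y \<in> closure \<Omega> \<Longrightarrow> u0 y \<le> u0 x"
      using continuous_attains_sup[OF cc _ u0_cont] nonempty by auto
    obtain y where "y \<in> \<Omega>" using nonempty by blast
    then have "u0 x > 0" using x(2)[of y] u0_pos[of y] closure_subset[of \<Omega>] by force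
    then have xO: "x \<in> \<Omega>" using x(1) closure_cases u0_frontier by force
    have "(\<lambda>h. grad u0 x \<bullet> h) = (\<lambda>h. 0)"
      by (rule differential_zero_maxmin[OF xO open_dom u0_grad[OF xO]]) (use x(2) closure_subset in blast)
    then have "grad u0 x = 0" by (metis inner_eq_zero_iff)
    then show ?thesis using xO by (auto simp: critical_points_def)
  qed
  moreover have "continuous_on ?S u0" unfolding S by (rule continuous_on_subset[OF u0_cont]) auto
  ultimately obtain x0 where x0: "x0 \<in> ?S" "\<And>y. y \<in> ?S \<Longrightarrow> u0 x0 \<le> u0 y"
    using continuous_attains_inf by metis
  have "(INF x\<in>?S. u0 x) = u0 x0" using x0 by (intro cInf_eq_minimum) auto
  then have d: "2 * delta0 \<Omega> u0 = u0 x0" by (simp add: delta0_def)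
  have "u0 x0 > 0" using x0(1) u0_pos by (auto simp: critical_points_def)
  then show "delta0 \<Omega> u0 > 0" using d by simp
  show "x \<in> \<Omega> \<Longrightarrow> grad u0 x = 0 \<Longrightarrow> u0 x \<ge> 2 * delta0 \<Omega> u0" using x0(2)[of x] d by (auto simp: critical_points_def)
qed

lemma theta0_le: "x \<in> \<Omega> \<Longrightarrow> u0 x < delta0 \<Omega> u0 \<Longrightarrow> theta0 \<Omega> u0 \<le> norm (grad u0 x)"
  unfolding theta0_def by (rule cINF_lower) (auto simp: superlevel_def bdd_below_def intro!: exI[of _ 0])

lemma frontier_approx:
  assumes "p \<in> frontier \<Omega>"
  obtains x where "\<And>n. x n \<in> \<Omega>" "x \<longlonglongrightarrow> p" "\<forall>\<^sub>F n in sequentially. u0 (x n) < delta0 \<Omega> u0"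
proof -
  have pc: "p \<in> closure \<Omega>" by (rule frontier_closure[OF assms])
  then obtain x where x: "\<And>n. x n \<in> \<Omega>" "x \<longlonglongrightarrow> p" unfolding closure_sequential by blast
  have "(\<lambda>n. u0 (x n)) \<longlonglongrightarrow> u0 p"
    by (rule continuous_on_tendsto_compose[OF u0_cont x(2) pc]) (use x(1) closure_subset in \<open>auto intro!: always_eventually\<close>)
  then have "\<forall>\<^sub>F n in sequentially. u0 (x n) < delta0 \<Omega> u0"
    by (rule order_tendstoD) (use u0_frontier[OF assms] delta0_pos in simp)
  then show thesis using that x by blast
qed

lemma theta0_le_frontier:
  assumes "p \<in> frontier \<Omega>" shows "theta0 \<Omega> u0 \<le> norm (grad_ext p)"
proof -
  obtain x where x: "\<And>n. x n \<in> \<Omega>" "x \<longlonglongrightarrow> p" "\<forall>\<^sub>F n in sequentially. u0 (x n) < delta0 \<Omega> u0"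
    using frontier_approx[OF assms] by blast
  have "(\<lambda>n. grad_ext (x n)) \<longlonglongrightarrow> grad_ext p"
    by (rule continuous_on_tendsto_compose[OF grad_ext(1) x(2) frontier_closure[OF assms]])
      (use x(1) closure_subset in \<open>auto intro!: always_eventually\<close>)
  then have "(\<lambda>n. norm (grad_ext (x n))) \<longlonglongrightarrow> norm (grad_ext p)" by (rule tendsto_norm)
  moreover have "\<forall>\<^sub>F n in sequentially. theta0 \<Omega> u0 \<le> norm (grad_ext (x n))"
    using x(3) by eventually_elim (use x(1) theta0_le grad_ext(2) in metis)
  ultimately show ?thesis by (rule tendsto_lowerbound) simp
qed

text \<open>The gradient does not vanish on the compact set where \<open>u0\<close> is at most \<open>\<delta>\<^sub>0\<close>: inside because critical
  values are at least \<open>2\<delta>\<^sub>0\<close>, on the boundary by Hopf's lemma.\<close>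
lemma theta0_pos: "theta0 \<Omega> u0 > 0"
proof -
  let ?T = "{x \<in> closure \<Omega>. u0 x \<le> delta0 \<Omega> u0}"
  have "closed ?T" by (intro continuous_on_closed_Collect_le u0_cont continuous_on_const closed_closure)
  moreover have "bounded ?T" using bounded_closure[OF bounded_dom] by (rule bounded_subset) auto
  ultimately have cT: "compact ?T" by (simp add: compact_eq_bounded_closed)
  obtain p where p: "p \<in> frontier \<Omega>" using frontier_nonempty by blast
  have pT: "?T \<noteq> {}" using p frontier_closure[OF p] u0_frontier[OF p] delta0_pos by auto
  have "continuous_on ?T (\<lambda>x. norm (grad_ext x))"
    by (intro continuous_on_norm continuous_on_subset[OF grad_ext(1)]) auto
  then obtain x0 where x0: "x0 \<in> ?T" "\<And>y. y \<in> ?T \<Longrightarrow> norm (grad_ext x0) \<le> norm (grad_ext y)"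
    using continuous_attains_inf[OF cT pT] by blast
  have "grad_ext x0 \<noteq> 0"
  proof (cases "x0 \<in> \<Omega>")
    case True
    then show ?thesis using critical_large[OF True] x0(1) delta0_pos grad_ext(2)[OF True] by force
  next
    case False
    then show ?thesis using x0(1) closure_cases grad_ext_frontier_nonzero by blast
  qed
  then have "0 < norm (grad_ext x0)" by simp
  also have "norm (grad_ext x0) \<le> theta0 \<Omega> u0"
    unfolding theta0_def
  proof (rule cINF_greatest)
    obtain x where x: "\<And>n. x n \<in> \<Omega>" "\<forall>\<^sub>F n in sequentially. u0 (x n) < delta0 \<Omega> u0"
      using frontier_approx[OF p] by blast
    then obtain n where "u0 (x n) < delta0 \<Omega> u0" using eventually_happens trivial_limit_sequentially by blast
    then have "x n \<in> \<Omega> - superlevel \<Omega> u0 (delta0 \<Omega> u0)" using x(1) by (simp add: superlevel_def)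
    then show "\<Omega> - superlevel \<Omega> u0 (delta0 \<Omega> u0) \<noteq> {}" by blast
    fix y assume "y \<in> \<Omega> - superlevel \<Omega> u0 (delta0 \<Omega> u0)"
    then have y: "y \<in> \<Omega>" "u0 y < delta0 \<Omega> u0" by (auto simp: superlevel_def)
    then have "y \<in> ?T" using closure_subset by auto
    then show "norm (grad_ext x0) \<le> norm (grad u0 y)" using x0(2)[of y] grad_ext(2)[OF y(1)] by simp
  qed
  finally show ?thesis .
qed

lemma hess_bound_pos: "hess_bound > 0"
proof -
  obtain p where p: "p \<in> frontier \<Omega>" using frontier_nonempty by blast
  obtain x where x: "\<And>n. x n \<in> \<Omega>" "\<forall>\<^sub>F n in sequentially. u0 (x n) < delta0 \<Omega> u0"
    using frontier_approx[OF p] by blast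
  then obtain n where "u0 (x n) < delta0 \<Omega> u0" using eventually_happens trivial_limit_sequentially by blast
  then have "theta0 \<Omega> u0 \<le> grad_norm" using theta0_le[OF x(1)] grad_bound[OF x(1)] order_trans by blast
  then show ?thesis using theta0_pos by (simp add: hess_bound_def)
qed

abbreviation bdist :: "real^'n \<Rightarrow> real" where "bdist x \<equiv> infdist x (frontier \<Omega>)"

lemma bdist_pos: "x \<in> \<Omega> \<Longrightarrow> bdist x > 0"
  using frontier_disj[of x] in_closed_iff_infdist_zero[OF frontier_closed frontier_nonempty, of x] infdist_nonneg[of x "frontier \<Omega>"]
  by linarith

text \<open>Every direction with a positive component along \<open>x - p\<close> enters the ball around \<open>x\<close> that touches the boundary
  at \<open>p\<close>. As \<open>u0\<close> is positive in this ball and 0 at \<open>p\<close>, its derivative in such a direction is nonnegative. A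
  linear form that is nonnegative on a half-space is a nonnegative multiple of the normal.\<close>
lemma nearest_normal:
  assumes x: "x \<in> \<Omega>" and p: "p \<in> frontier \<Omega>" "dist x p = bdist x"
  shows "grad_ext p = norm (grad_ext p) *\<^sub>R ((1 / bdist x) *\<^sub>R (x - p))"
proof -
  define d where "d = bdist x"
  define \<nu> where "\<nu> = (1 / d) *\<^sub>R (x - p)"
  have d: "d > 0" using bdist_pos[OF x] by (simp add: d_def)
  have ball: "ball x d \<subseteq> \<Omega>" using ball_infdist_frontier[OF x] by (simp add: d_def)
  have xp: "x - p = d *\<^sub>R \<nu>" using d by (simp add: \<nu>_def)
  have n1: "norm \<nu> = 1" using d p(2) by (simp add: \<nu>_def dist_norm d_def)
  then have nn: "\<nu> \<bullet> \<nu> = 1" by (simp add: dot_square_norm)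
  let ?g = "grad_ext p"
  have key: "?g \<bullet> h \<ge> 0" if h: "h \<bullet> \<nu> > 0" for h
  proof (rule ccontr)
    assume "\<not> ?thesis"
    then have neg: "?g \<bullet> h < 0" by simp
    have h0: "norm h > 0" using h by auto
    define a where "a = - (?g \<bullet> h)"
    have a: "a > 0" using neg by (simp add: a_def)
    define t where "t = min (d * (h \<bullet> \<nu>) / (norm h)\<^sup>2) (a / (4 * (hess_bound * (norm h)\<^sup>2)))"
    have t: "t > 0" using d h h0 a hess_bound_pos by (simp add: t_def)
    have "t \<le> d * (h \<bullet> \<nu>) / (norm h)\<^sup>2" by (simp add: t_def)
    then have t1: "t * (norm h)\<^sup>2 \<le> d * (h \<bullet> \<nu>)" using h0 by (simp add: field_simps)
    have "t \<le> a / (4 * (hess_bound * (norm h)\<^sup>2))" by (simp add: t_def)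
    then have t2: "4 * (hess_bound * (norm h)\<^sup>2) * t \<le> a" using h0 hess_bound_pos by (simp add: field_simps)
    define y where "y = p + t *\<^sub>R h"
    have "(norm (d *\<^sub>R \<nu> - t *\<^sub>R h))\<^sup>2 = d\<^sup>2 - 2 * t * (d * (h \<bullet> \<nu>)) + t * (t * (norm h)\<^sup>2)"
      unfolding power2_norm_eq_inner by (simp add: inner_diff_left inner_diff_right inner_commute nn power2_eq_square algebra_simps)
    also have "\<dots> \<le> d\<^sup>2 - 2 * t * (d * (h \<bullet> \<nu>)) + t * (d * (h \<bullet> \<nu>))" using t1 t by (simp add: mult_left_mono)
    also have "\<dots> = d\<^sup>2 - t * (d * (h \<bullet> \<nu>))" by simp
    also have "\<dots> < d\<^sup>2" using t d h by simp
    finally have "norm (d *\<^sub>R \<nu> - t *\<^sub>R h) < d" using d by (meson less_imp_le power_less_imp_less_base)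
    moreover have "x - y = d *\<^sub>R \<nu> - t *\<^sub>R h" using xp by (simp add: y_def)
    ultimately have y: "y \<in> \<Omega>" using ball by (auto simp: dist_norm)
    have pc: "p \<in> closure \<Omega>" by (rule frontier_closure[OF p(1)])
    have py: "p - y = - (t *\<^sub>R h)" "norm (p - y) = t * norm h" using t by (simp_all add: y_def)
    have ty: "\<bar>u0 p - u0 y - grad u0 y \<bullet> (p - y)\<bar> \<le> hess_bound * (norm (p - y))\<^sup>2" by (rule u0_taylor[OF y pc])
    have "\<bar>(?g - grad u0 y) \<bullet> (t *\<^sub>R h)\<bar> \<le> norm (?g - grad u0 y) * norm (t *\<^sub>R h)" by (rule Cauchy_Schwarz_ineq2)
    also have "\<dots> \<le> (hess_bound * (t * norm h)) * (t * norm h)"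
      using grad_ext_Lipschitz[OF y pc] t hess_bound_nonneg by (intro mult_mono) (auto simp: py)
    also have "(?g - grad u0 y) \<bullet> (t *\<^sub>R h) = t * (?g \<bullet> h) - grad u0 y \<bullet> (t *\<^sub>R h)"
      by (simp add: inner_diff_left right_diff_distrib)
    also have "(hess_bound * (t * norm h)) * (t * norm h) = hess_bound * (t * norm h)\<^sup>2" by (simp add: power2_eq_square)
    finally have le2: "\<bar>t * (?g \<bullet> h) - grad u0 y \<bullet> (t *\<^sub>R h)\<bar> \<le> hess_bound * (t * norm h)\<^sup>2" .
    have "u0 y \<le> grad u0 y \<bullet> (t *\<^sub>R h) + hess_bound * (t * norm h)\<^sup>2"
      using ty u0_frontier[OF p(1)] t unfolding py(2) unfolding py(1) by (simp add: abs_le_iff)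
    also have "\<dots> \<le> t * (?g \<bullet> h) + 2 * (hess_bound * (t * norm h)\<^sup>2)" using le2 by linarith
    also have "\<dots> = t * (- a + (2 * (hess_bound * (norm h)\<^sup>2) * t))" by (simp add: a_def algebra_simps power2_eq_square)
    also have "\<dots> < 0" using t t2 a by (intro mult_pos_neg) auto
    finally show False using u0_pos[OF y] by simp
  qed
  have k0: "?g \<bullet> h \<ge> 0" if h: "h \<bullet> \<nu> \<ge> 0" for h
  proof (rule field_le_epsilon)
    fix e :: real assume "e > 0"
    define s where "s = e / (1 + \<bar>?g \<bullet> \<nu>\<bar>)"
    have s: "s > 0" using \<open>e > 0\<close> by (simp add: s_def)
    have "?g \<bullet> (h + s *\<^sub>R \<nu>) \<ge> 0" by (rule key) (use h s nn in \<open>simp add: inner_add_left\<close>)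
    moreover have "s * (?g \<bullet> \<nu>) \<le> e"
    proof -
      have "s * (?g \<bullet> \<nu>) \<le> s * (1 + \<bar>?g \<bullet> \<nu>\<bar>)" using s by (intro mult_left_mono) auto
      also have "\<dots> = e" by (simp add: s_def)
      finally show ?thesis .
    qed
    ultimately show "0 \<le> ?g \<bullet> h + e" by (simp add: inner_add_right)
  qed
  define q where "q = ?g - (?g \<bullet> \<nu>) *\<^sub>R \<nu>"
  have qn: "q \<bullet> \<nu> = 0" using nn by (simp add: q_def inner_diff_left)
  have "?g \<bullet> q \<ge> 0" "?g \<bullet> (- q) \<ge> 0" by (rule k0; use qn in simp)+
  then have "?g \<bullet> q = 0" by simp
  moreover have "?g \<bullet> q = q \<bullet> q + (?g \<bullet> \<nu>) * (q \<bullet> \<nu>)"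
    by (simp add: q_def inner_diff_left inner_diff_right inner_commute nn algebra_simps)
  ultimately have "q = 0" using qn by simp
  then have g: "?g = (?g \<bullet> \<nu>) *\<^sub>R \<nu>" by (simp add: q_def)
  moreover have "?g \<bullet> \<nu> \<ge> 0" by (rule k0) (use nn in simp)
  then have "norm ?g = ?g \<bullet> \<nu>" using n1 by (subst g) simp
  ultimately show ?thesis by (simp add: \<nu>_def d_def)
qed

section \<open>One-sided bounds for the logarithmic gradient\<close>

definition log_grad_const :: real where
  "log_grad_const = concavity_const hess_bound grad_norm (delta0 \<Omega> u0) (theta0 \<Omega> u0)"

text \<open>Close to the boundary, let \<open>p\<close> be the nearest boundary point, \<open>\<nu>\<close> the inward normal and \<open>s = \<bar>\<nabla>u\<^sub>0(p)\<bar>\<close>. There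
  \<open>\<nabla>u\<^sub>0(x) = s\<nu> + O(d)\<close> and \<open>u\<^sub>0(x) = s d + O(d\<^sup>2)\<close>, and convexity gives
  \<open>e\<cdot>\<nu> \<ge> (d(y) - d(x)) / \<bar>x - y\<bar>\<close>. The errors stay bounded after division by \<open>u\<^sub>0\<close>, because the distance is
  1-Lipschitz. At the other points \<open>u\<^sub>0\<close> is bounded below: where it is smaller than \<open>\<delta>\<^sub>0\<close>, its gradient has at
  least the length \<open>\<theta>\<^sub>0\<close>, and a step downhill inside the domain would otherwise make it negative.\<close>
lemma log_grad_bound:
  assumes x: "x \<in> \<Omega>" and y: "y \<in> \<Omega>" and "x \<noteq> y"
  defines "e \<equiv> (1 / dist x y) *\<^sub>R (y - x)"
  shows "- (grad u0 x \<bullet> e) / u0 x \<le> (bdist x - bdist y) / (dist x y * bdist x) + log_grad_const"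
proof -
  define \<theta> where "\<theta> = theta0 \<Omega> u0"
  define d where "d = bdist x"
  define r where "r = dist x y"
  have r: "r > 0" using assms by (simp add: r_def)
  have \<theta>: "\<theta> > 0" using theta0_pos by (simp add: \<theta>_def)
  have d: "d > 0" using bdist_pos[OF x] by (simp add: d_def)
  have ne: "norm e = 1" using r by (simp add: e_def dist_norm norm_minus_commute r_def)
  have dd: "\<bar>d - bdist y\<bar> \<le> r"
    using infdist_triangle[of x "frontier \<Omega>" y] infdist_triangle[of y "frontier \<Omega>" x]
    by (simp add: d_def r_def dist_commute)
  show ?thesis
  proof (cases "d \<le> \<theta> / (4 * hess_bound)")
    case True
    obtain p where p: "p \<in> frontier \<Omega>" "bdist x = dist x p"
      using infdist_attains_inf[OF frontier_closed frontier_nonempty] by metis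
    define \<nu> where "\<nu> = (1 / d) *\<^sub>R (x - p)"
    define s where "s = norm (grad_ext p)"
    have xp: "x - p = d *\<^sub>R \<nu>" using d by (simp add: \<nu>_def)
    have n1: "norm \<nu> = 1" using d p(2) by (simp add: \<nu>_def dist_norm d_def)
    then have nn: "\<nu> \<bullet> \<nu> = 1" by (simp add: dot_square_norm)
    have s: "s \<ge> \<theta>" using theta0_le_frontier[OF p(1)] by (simp add: s_def \<theta>_def)
    have g: "grad_ext p = s *\<^sub>R \<nu>" using nearest_normal[OF x p(1)] p(2) by (simp add: s_def \<nu>_def d_def)
    have pc: "p \<in> closure \<Omega>" by (rule frontier_closure[OF p(1)])
    have npx: "norm (p - x) = d" using p(2) by (simp add: d_def dist_norm norm_minus_commute)
    have gn: "norm (s *\<^sub>R \<nu> - grad u0 x) \<le> hess_bound * d" using grad_ext_Lipschitz[OF x pc] g npx by simp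
    have part: "\<bar>s * (\<nu> \<bullet> h) - grad u0 x \<bullet> h\<bar> \<le> hess_bound * d" if "norm h = 1" for h
      using Cauchy_Schwarz_ineq2[of "s *\<^sub>R \<nu> - grad u0 x" h] gn that by (simp add: inner_diff_left)
    have u1: "\<bar>u0 x - d * s\<bar> \<le> 2 * hess_bound * d\<^sup>2"
    proof -
      have "\<bar>u0 p - u0 x - grad u0 x \<bullet> (p - x)\<bar> \<le> hess_bound * d\<^sup>2" using u0_taylor[OF x pc] npx by simp
      moreover have "p - x = - (d *\<^sub>R \<nu>)" using xp by (simp add: algebra_simps)
      ultimately have "\<bar>u0 x - d * (grad u0 x \<bullet> \<nu>)\<bar> \<le> hess_bound * d\<^sup>2" using u0_frontier[OF p(1)] by (simp add: abs_minus_commute)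
      moreover have "\<bar>d * s - d * (grad u0 x \<bullet> \<nu>)\<bar> \<le> d * (hess_bound * d)"
        using part[OF n1] d nn by (simp add: right_diff_distrib[symmetric] abs_mult mult_left_mono)
      ultimately show ?thesis by (simp add: power2_eq_square algebra_simps abs_le_iff)
    qed
    have "4 * hess_bound * d \<le> \<theta>" using True hess_bound_pos by (simp add: field_simps)
    then have "4 * hess_bound * d \<le> s" using s by simp
    then have "4 * hess_bound * d * d \<le> s * d" using d by (intro mult_right_mono) auto
    then have u2: "u0 x \<ge> s * d / 2" using u1 by (simp add: power2_eq_square algebra_simps abs_le_iff)
    have sp: "s > 0" using s \<theta> by simp
    have u0p: "u0 x > 0" by (rule u0_pos[OF x])
    have "bdist y \<le> (y - p) \<bullet> \<nu>"
      unfolding \<nu>_def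
      by (rule convex_frontier_halfspace[OF convex_dom open_dom x y p(1) d])
        (use ball_infdist_frontier[OF x] p(2) in \<open>simp_all add: d_def\<close>)
    also have "(y - p) \<bullet> \<nu> = r * (e \<bullet> \<nu>) + d"
    proof -
      have "r *\<^sub>R e = y - x" using r by (simp add: e_def r_def)
      then have "y - p = r *\<^sub>R e + d *\<^sub>R \<nu>" unfolding xp[symmetric] by simp
      then show ?thesis by (simp add: inner_add_left nn)
    qed
    finally have "bdist y - d \<le> r * (e \<bullet> \<nu>)" by simp
    then have en: "- (\<nu> \<bullet> e) \<le> (d - bdist y) / r" using r by (simp add: field_simps inner_commute)
    have "- (grad u0 x \<bullet> e) \<le> s * (- (\<nu> \<bullet> e)) + hess_bound * d" using part[OF ne] by (simp add: abs_le_iff)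
    also have "\<dots> \<le> s * ((d - bdist y) / r) + hess_bound * d" using mult_left_mono[OF en, of s] sp by simp
    finally have "- (grad u0 x \<bullet> e) / u0 x \<le> (s * ((d - bdist y) / r) + hess_bound * d) / u0 x"
      using u0p by (intro divide_right_mono) auto
    also have "\<dots> = (d - bdist y) / (r * d) + ((d - bdist y) / r) * ((s * d - u0 x) / (u0 x * d)) + hess_bound * d / u0 x"
      using u0p d r by (simp add: field_simps)
    also have "((d - bdist y) / r) * ((s * d - u0 x) / (u0 x * d)) \<le> 4 * hess_bound / \<theta>"
    proof -
      have a1: "\<bar>(d - bdist y) / r\<bar> \<le> 1" using dd r by (simp add: abs_divide)
      have "\<bar>(s * d - u0 x) / (u0 x * d)\<bar> = \<bar>s * d - u0 x\<bar> / (u0 x * d)" using u0p d by (simp add: abs_divide abs_mult)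
      also have "\<dots> \<le> (2 * hess_bound * d\<^sup>2) / ((s * d / 2) * d)"
        using u1 u2 u0p d sp hess_bound_pos by (intro frac_le mult_right_mono) (auto simp: mult.commute abs_minus_commute)
      also have "\<dots> = 4 * hess_bound / s" using d sp by (simp add: power2_eq_square)
      also have "\<dots> \<le> 4 * hess_bound / \<theta>" using s \<theta> hess_bound_pos by (intro divide_left_mono) auto
      finally have a2: "\<bar>(s * d - u0 x) / (u0 x * d)\<bar> \<le> 4 * hess_bound / \<theta>" .
      have "((d - bdist y) / r) * ((s * d - u0 x) / (u0 x * d)) \<le> \<bar>(d - bdist y) / r\<bar> * \<bar>(s * d - u0 x) / (u0 x * d)\<bar>"
        by (metis abs_ge_self abs_mult)
      also have "\<dots> \<le> 1 * (4 * hess_bound / \<theta>)" using a1 a2 by (intro mult_mono) auto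
      finally show ?thesis by simp
    qed
    also have "hess_bound * d / u0 x \<le> 2 * hess_bound / \<theta>"
    proof -
      have "hess_bound * d / u0 x \<le> hess_bound * d / (s * d / 2)" using u2 sp d hess_bound_pos u0p by (intro divide_left_mono) auto
      also have "\<dots> = 2 * hess_bound / s" using d sp by simp
      also have "\<dots> \<le> 2 * hess_bound / \<theta>" using s \<theta> hess_bound_pos by (intro divide_left_mono) auto
      finally show ?thesis .
    qed
    finally have "- (grad u0 x \<bullet> e) / u0 x \<le> (d - bdist y) / (r * d) + 4 * hess_bound / \<theta> + 2 * hess_bound / \<theta>" by simp
    moreover have "4 * hess_bound / \<theta> + 2 * hess_bound / \<theta> = 6 * hess_bound / \<theta>" by (simp add: add_divide_distrib[symmetric])
    moreover have "6 * hess_bound / \<theta> \<le> log_grad_const" by (simp add: log_grad_const_def concavity_const_def \<theta>_def)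
    ultimately show ?thesis by (simp add: d_def r_def)
  next
    case False
    define m where "m = min (delta0 \<Omega> u0) (\<theta>\<^sup>2 / (16 * hess_bound))"
    have m: "m > 0" using delta0_pos \<theta> hess_bound_pos by (simp add: m_def)
    have um: "u0 x \<ge> m"
    proof (cases "u0 x < delta0 \<Omega> u0")
      case True
      then have gx: "norm (grad u0 x) \<ge> \<theta>" using theta0_le[OF x] by (simp add: \<theta>_def)
      define N where "N = norm (grad u0 x)"
      have N: "N > 0" "N \<ge> \<theta>" using gx \<theta> by (auto simp: N_def)
      define t where "t = \<theta> / (8 * hess_bound)"
      have t: "t > 0" "t < d" using \<theta> hess_bound_pos False by (auto simp: t_def field_simps)
      define w where "w = x - (t / N) *\<^sub>R grad u0 x"
      have xw: "norm (w - x) = t" using t N by (simp add: w_def N_def[symmetric])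
      then have "w \<in> ball x d" using t by (simp add: dist_norm norm_minus_commute)
      then have w: "w \<in> \<Omega>" using ball_infdist_frontier[OF x] by (auto simp: d_def)
      have "\<bar>u0 w - u0 x - grad u0 x \<bullet> (w - x)\<bar> \<le> hess_bound * t\<^sup>2"
        using u0_taylor[OF x, of w] w closure_subset xw by auto
      moreover have "grad u0 x \<bullet> (w - x) = - (t * N)"
        using N by (simp add: w_def dot_square_norm N_def[symmetric] power2_eq_square)
      ultimately have "u0 x \<ge> t * N - hess_bound * t\<^sup>2" using u0_pos[OF w] by (simp add: abs_le_iff)
      moreover have "t * N \<ge> t * \<theta>" using N t by (intro mult_left_mono) auto
      moreover have "hess_bound * t\<^sup>2 \<le> t * \<theta> / 2"
      proof -
        have "hess_bound * t = \<theta> / 8" using hess_bound_pos by (simp add: t_def)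
        then have "hess_bound * t\<^sup>2 = t * \<theta> / 8" by (simp add: power2_eq_square)
        moreover have "t * \<theta> > 0" using t \<theta> by simp
        ultimately show ?thesis by simp
      qed
      moreover have "t * \<theta> / 2 = \<theta>\<^sup>2 / (16 * hess_bound)" by (simp add: t_def power2_eq_square)
      ultimately show ?thesis by (simp add: m_def)
    next
      case False
      then show ?thesis by (simp add: m_def)
    qed
    have "- (grad u0 x \<bullet> e) \<le> norm (grad u0 x) * norm e"
      using Cauchy_Schwarz_ineq2[of "grad u0 x" e] by (simp add: abs_le_iff)
    also have "\<dots> \<le> grad_norm" using grad_bound[OF x] ne by simp
    finally have "- (grad u0 x \<bullet> e) / u0 x \<le> grad_norm / m"
      using um m grad_norm_nonneg by (intro frac_le) auto
    moreover have "- (4 * hess_bound / \<theta>) \<le> (d - bdist y) / (r * d)"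
    proof -
      have "1 / d \<le> 4 * hess_bound / \<theta>" using False d \<theta> hess_bound_pos by (simp add: field_simps)
      moreover have "- (1 / d) \<le> (d - bdist y) / (r * d)" using dd r d by (simp add: field_simps abs_le_iff)
      ultimately show ?thesis by linarith
    qed
    moreover have "grad_norm / m + 4 * hess_bound / \<theta> \<le> log_grad_const" by (simp add: log_grad_const_def concavity_const_def m_def \<theta>_def)
    ultimately show ?thesis by (simp add: d_def r_def)
  qed
qed

text \<open>The two singular terms add up to \<open>- (a - b)\<^sup>2 / (r a b)\<close>, where \<open>a\<close> and \<open>b\<close> are the distances of
  \<open>x\<close> and \<open>y\<close> to the boundary.\<close>
lemma log_grad_modulus:
  assumes x: "x \<in> \<Omega>" and y: "y \<in> \<Omega>" and "x \<noteq> y"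
  defines "e \<equiv> (1 / dist x y) *\<^sub>R (y - x)"
  shows "(grad u0 y \<bullet> e) / u0 y - (grad u0 x \<bullet> e) / u0 x \<le> 2 * log_grad_const"
proof -
  define r a b where "r = dist x y" and "a = bdist x" and "b = bdist y"
  have r: "r > 0" and a: "a > 0" and b: "b > 0"
    using assms bdist_pos by (auto simp: r_def a_def b_def)
  have e': "(1 / dist y x) *\<^sub>R (x - y) = - e" by (simp add: e_def dist_commute scaleR_diff_right)
  have "- (grad u0 x \<bullet> e) / u0 x \<le> (a - b) / (r * a) + log_grad_const"
    using log_grad_bound[OF x y assms(3)] by (simp add: e_def r_def a_def b_def)
  moreover have "(grad u0 y \<bullet> e) / u0 y \<le> (b - a) / (r * b) + log_grad_const"
    using log_grad_bound[OF y x assms(3)[symmetric]] unfolding e' by (simp add: r_def a_def b_def dist_commute)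
  moreover have "(a - b) / (r * a) + (b - a) / (r * b) = - ((a - b)\<^sup>2 / (r * a * b))"
    using r a b by (simp add: field_simps power2_eq_square)
  moreover have "(a - b)\<^sup>2 / (r * a * b) \<ge> 0" using r a b by simp
  ultimately show ?thesis by simp
qed

end

section \<open>The spectral gap\<close>

text \<open>The number \<open>\<epsilon> = \<kappa>\<^sup>2 exp(-\<kappa>D)\<close> with \<open>\<kappa> = \<bar>F\<bar> + 1\<close>. For \<open>\<psi>(r) = 2 - exp(-\<kappa>r)\<close> one has
  \<open>4\<psi>'' + F\<psi>' \<le> -3\<kappa>\<^sup>2 exp(-\<kappa>r) \<le> -3\<epsilon> \<le> -\<epsilon>\<psi>\<close> on \<open>[0, D]\<close>.\<close>
definition gap_const :: "real \<Rightarrow> real \<Rightarrow> real" where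
  "gap_const D F = (\<bar>F\<bar> + 1)\<^sup>2 * exp (- (\<bar>F\<bar> + 1) * D)"

lemma gap_const_pos: "gap_const D F > 0"
proof -
  have "\<bar>F\<bar> + 1 > 0" by simp
  then show ?thesis unfolding gap_const_def by (intro mult_pos_pos zero_less_power) simp_all
qed

context principal_pair
begin

text \<open>The first order coefficient of the operator \<open>w \<mapsto> (L(u\<^sub>0 w) + \<lambda>\<^sub>0 u\<^sub>0 w) / u\<^sub>0\<close>, which has no zeroth order term.\<close>
definition drift :: "real^'n \<Rightarrow> real^'n" where
  "drift x = (2 / u0 x) *\<^sub>R grad u0 x - B x"

definition drift_const :: real where
  "drift_const = 4 * log_grad_const + 2 * (\<Sum>j\<in>UNIV. Ck_norm 2 \<Omega> (\<lambda>x. B x $ j))"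

lemma drift_modulus:
  assumes x: "x \<in> \<Omega>" and y: "y \<in> \<Omega>" and "x \<noteq> y"
  defines "e \<equiv> (1 / dist x y) *\<^sub>R (y - x)"
  shows "(drift y - drift x) \<bullet> e \<le> drift_const"
proof -
  have ne: "norm e = 1" using assms by (simp add: e_def dist_norm norm_minus_commute)
  have b: "\<bar>B z \<bullet> e\<bar> \<le> (\<Sum>j\<in>UNIV. Ck_norm 2 \<Omega> (\<lambda>x. B x $ j))" if "z \<in> \<Omega>" for z
    using Cauchy_Schwarz_ineq2[of "B z" e] B_bound[OF that] ne by simp
  have "(drift y - drift x) \<bullet> e = 2 * ((grad u0 y \<bullet> e) / u0 y - (grad u0 x \<bullet> e) / u0 x) - B y \<bullet> e + B x \<bullet> e"
    by (simp add: drift_def inner_diff_left right_diff_distrib)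
  also have "\<dots> \<le> 2 * (2 * log_grad_const) + 2 * (\<Sum>j\<in>UNIV. Ck_norm 2 \<Omega> (\<lambda>x. B x $ j))"
    using log_grad_modulus[OF x y assms(3), folded e_def] b[OF x] b[OF y] by (simp add: abs_le_iff)
  finally show ?thesis by (simp add: drift_const_def)
qed

text \<open>Conjugation by \<open>u\<^sub>0\<close>: the cross term \<open>2 \<nabla>v\<cdot>\<nabla>(1/u\<^sub>0)\<close> of the product rule is absorbed by the drift.\<close>
lemma quotient_hessian:
  assumes x: "x \<in> \<Omega>" and v: "has_hessian v x gv Hv"
  obtains g H where "has_hessian (\<lambda>z. v z * inverse (u0 z)) x g H"
    "trace_of H + drift x \<bullet> g = (trace_of Hv - B x \<bullet> gv - (c x - lam0) * v x) / u0 x"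
proof -
  obtain H0 where H0: "has_hessian u0 x (grad u0 x) H0" "trace_of H0 = B x \<bullet> grad u0 x + (c x - lam0) * u0 x"
    by (rule u0_hessian[OF x])
  have u0: "u0 x > 0" by (rule u0_pos[OF x])
  let ?u = "u0 x" and ?gr = "grad u0 x"
  have i: "has_hessian (\<lambda>z. inverse (u0 z)) x ((- (1 / ?u\<^sup>2)) *\<^sub>R ?gr)
    (\<lambda>h. (- (1 / ?u\<^sup>2)) *\<^sub>R H0 h + ((2 / ?u ^ 3) * (?gr \<bullet> h)) *\<^sub>R ?gr)" (is "has_hessian _ _ ?gi ?Hi")
    by (rule has_hessian_inverse[OF H0(1)]) (use u0 in simp)
  have tri: "trace_of ?Hi = - (1 / ?u\<^sup>2) * trace_of H0 + 2 / ?u ^ 3 * (norm ?gr)\<^sup>2"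
    by (rule trace_of_rank_one_update)
  have prod: "has_hessian (\<lambda>z. v z * inverse (u0 z)) x (v x *\<^sub>R ?gi + inverse ?u *\<^sub>R gv)
    (\<lambda>h. v x *\<^sub>R ?Hi h + (gv \<bullet> h) *\<^sub>R ?gi + (inverse ?u *\<^sub>R Hv h + (?gi \<bullet> h) *\<^sub>R gv))" (is "has_hessian _ _ ?g ?H")
    by (rule has_hessian_mult[OF v i])
  have tr: "trace_of ?H = v x * trace_of ?Hi + inverse ?u * trace_of Hv + 2 * (gv \<bullet> ?gi)"
    by (rule trace_of_mult)
  have "((2 / U) *\<^sub>R p - q) \<bullet> (V *\<^sub>R (S *\<^sub>R p) + I *\<^sub>R r)
      = (2 / U) * (V * (S * (norm p)\<^sup>2) + I * (p \<bullet> r)) - (V * (S * (q \<bullet> p)) + I * (q \<bullet> r))"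
    for p q r :: "real^'n" and U V S I :: real
    by (simp add: inner_diff_left inner_add_right power2_norm_eq_inner algebra_simps)
  then have dg: "drift x \<bullet> ?g = (2 / ?u) * (v x * (- (1 / ?u\<^sup>2) * (norm ?gr)\<^sup>2) + inverse ?u * (?gr \<bullet> gv))
      - (v x * (- (1 / ?u\<^sup>2) * (B x \<bullet> ?gr)) + inverse ?u * (B x \<bullet> gv))"
    unfolding drift_def by blast
  have gg: "gv \<bullet> ?gi = - (1 / ?u\<^sup>2) * (?gr \<bullet> gv)"
    unfolding inner_scaleR_right by (simp add: inner_commute)
  have "trace_of ?H + drift x \<bullet> ?g = (trace_of Hv - B x \<bullet> gv - (c x - lam0) * v x) / u0 x"
    unfolding tr tri H0(2) dg gg
    using u0 by (simp add: field_simps power2_eq_square power3_eq_cube)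
  with prod show thesis by (rule that)
qed

text \<open>The factor \<open>\<omega>\<close> will be a phase that makes a difference of complex values real.\<close>
lemma eigenfunction_hessian:
  assumes ef: "dirichlet_eigenfunction \<Omega> B c lam u" and x: "x \<in> \<Omega>"
  obtains g H where "has_hessian (\<lambda>z. Re (\<omega> * u z)) x g H"
    "trace_of H - B x \<bullet> g - c x * Re (\<omega> * u x) = - Re (\<omega> * lam * u x)"
proof -
  have u: "Ck_on 2 \<Omega> u" "L_op B c u x = - lam * u x"
    using ef x unfolding dirichlet_eigenfunction_def by auto
  have bl: "bounded_linear (\<lambda>z. Re (\<omega> * z))"
    by (rule bounded_linear_compose[OF bounded_linear_Re bounded_linear_mult_right])
  obtain H where H: "has_hessian (\<lambda>z. Re (\<omega> * u z)) x (\<chi> i. Re (\<omega> * partial_deriv i u x)) H"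
    "trace_of H = Re (\<omega> * laplacian u x)"
    by (rule Ck2_has_hessian[OF open_dom x u(1) bl])
  have "B x \<bullet> (\<chi> i. Re (\<omega> * partial_deriv i u x)) = Re (\<omega> * (\<Sum>i\<in>UNIV. of_real (B x $ i) * partial_deriv i u x))"
    by (simp add: inner_vec_def sum_distrib_left Re_sum algebra_simps)
  moreover have "c x * Re (\<omega> * u x) = Re (\<omega> * (of_real (c x) * u x))" by (simp add: algebra_simps)
  ultimately have "trace_of H - B x \<bullet> (\<chi> i. Re (\<omega> * partial_deriv i u x)) - c x * Re (\<omega> * u x) = Re (\<omega> * L_op B c u x)"
    unfolding H(2) L_op_def by (simp only: right_diff_distrib minus_complex.sel)
  also have "\<dots> = - Re (\<omega> * lam * u x)" unfolding u(2)
    by (simp only: mult_minus_left mult_minus_right mult.assoc uminus_complex.sel)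
  finally show thesis using H(1) that by blast
qed

text \<open>The summand \<open>1/u\<^sub>0\<close> dominates quotients \<open>u/u\<^sub>0\<close> near the boundary, \<open>- A u\<^sub>0\<close> produces the term
  \<open>- 2A\<bar>\<nabla>u\<^sub>0\<bar>\<^sup>2/u\<^sub>0\<close> that compensates \<open>(\<lambda>\<^sub>0 - c)/u\<^sub>0\<close>, and \<open>A'\<close> makes the sum positive.\<close>
definition barrier :: "real \<Rightarrow> real \<Rightarrow> real^'n \<Rightarrow> real" where
  "barrier A A' z = inverse (u0 z) - A * u0 z + A'"

text \<open>Minus the drift Laplacian of the barrier.\<close>
abbreviation barrier_source :: "real \<Rightarrow> real^'n \<Rightarrow> real" where
  "barrier_source A z \<equiv> (c z - lam0) / u0 z + A * ((c z - lam0) * u0 z + 2 * (norm (grad u0 z))\<^sup>2 / u0 z)"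

lemma test_function_hessian:
  assumes ef: "dirichlet_eigenfunction \<Omega> B c lam u" and x: "x \<in> \<Omega>"
  obtains g H where
    "has_hessian (\<lambda>z. Re (\<omega> * (u z / of_real (u0 z))) - \<eta> * barrier A A' z) x g H"
    "trace_of H + drift x \<bullet> g = - Re (\<omega> * (lam - of_real lam0) * (u x / of_real (u0 x)))
      + \<eta> * barrier_source A x"
proof -
  have u0: "u0 x > 0" by (rule u0_pos[OF x])
  obtain gv Hv where v: "has_hessian (\<lambda>z. Re (\<omega> * u z)) x gv Hv"
    "trace_of Hv - B x \<bullet> gv - c x * Re (\<omega> * u x) = - Re (\<omega> * lam * u x)"
    by (rule eigenfunction_hessian[OF ef x])
  have v': "has_hessian (\<lambda>z. Re (\<omega> * u z) + - \<eta>) x (gv + 0) (\<lambda>h. Hv h + 0)"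
    by (rule has_hessian_add[OF v(1) has_hessian_const])
  obtain g1 H1 where q: "has_hessian (\<lambda>z. (Re (\<omega> * u z) + - \<eta>) * inverse (u0 z)) x g1 H1"
    "trace_of H1 + drift x \<bullet> g1 = (trace_of (\<lambda>h. Hv h + 0) - B x \<bullet> (gv + 0) - (c x - lam0) * (Re (\<omega> * u x) + - \<eta>)) / u0 x"
    by (rule quotient_hessian[OF x v'])
  obtain H0 where H0: "has_hessian u0 x (grad u0 x) H0" "trace_of H0 = B x \<bullet> grad u0 x + (c x - lam0) * u0 x"
    by (rule u0_hessian[OF x])
  let ?g = "g1 + (\<eta> * A) *\<^sub>R grad u0 x + 0" and ?H = "\<lambda>h. H1 h + (\<eta> * A) *\<^sub>R H0 h + 0"
  have "has_hessian (\<lambda>z. (Re (\<omega> * u z) + - \<eta>) * inverse (u0 z) + (\<eta> * A) * u0 z + - \<eta> * A') x ?g ?H"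
    by (intro has_hessian_add q has_hessian_cmult H0 has_hessian_const)
  moreover have "(\<lambda>z. (Re (\<omega> * u z) + - \<eta>) * inverse (u0 z) + (\<eta> * A) * u0 z + - \<eta> * A')
     = (\<lambda>z. Re (\<omega> * (u z / of_real (u0 z))) - \<eta> * barrier A A' z)"
  proof
    fix z
    have "Re (\<omega> * (u z / of_real (u0 z))) = Re (\<omega> * u z) * inverse (u0 z)"
      unfolding times_divide_eq_right Re_divide_of_real by (rule divide_inverse)
    then show "(Re (\<omega> * u z) + - \<eta>) * inverse (u0 z) + (\<eta> * A) * u0 z + - \<eta> * A'
       = Re (\<omega> * (u z / of_real (u0 z))) - \<eta> * barrier A A' z"
      unfolding barrier_def by (simp add: algebra_simps)
  qed
  ultimately have hh: "has_hessian (\<lambda>z. Re (\<omega> * (u z / of_real (u0 z))) - \<eta> * barrier A A' z) x ?g ?H" by simp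
  have t1: "trace_of ?H = trace_of H1 + \<eta> * A * trace_of H0"
    using trace_of_lincomb[of 1 H1 "\<eta> * A" H0] by simp
  have d0: "drift x \<bullet> grad u0 x = 2 * (norm (grad u0 x))\<^sup>2 / u0 x - B x \<bullet> grad u0 x"
    by (simp add: drift_def inner_diff_left power2_norm_eq_inner)
  have "\<omega> * (lam - of_real lam0) * (u x / of_real (u0 x)) = (\<omega> * lam * u x - of_real lam0 * (\<omega> * u x)) / of_real (u0 x)"
    by (simp add: algebra_simps diff_divide_distrib)
  then have re: "Re (\<omega> * (lam - of_real lam0) * (u x / of_real (u0 x))) = (Re (\<omega> * lam * u x) - lam0 * Re (\<omega> * u x)) / u0 x"
    by (simp only: Re_divide_of_real minus_complex.sel Re_complex_of_real times_complex.sel Im_complex_of_real) simp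
  have "trace_of Hv - B x \<bullet> gv = c x * Re (\<omega> * u x) - Re (\<omega> * lam * u x)" using v(2) by simp
  then have q2: "trace_of H1 + drift x \<bullet> g1 = (c x * Re (\<omega> * u x) - Re (\<omega> * lam * u x) - (c x - lam0) * (Re (\<omega> * u x) - \<eta>)) / u0 x"
    using q(2) by simp
  have "trace_of ?H + drift x \<bullet> ?g = (trace_of H1 + drift x \<bullet> g1) + \<eta> * A * (trace_of H0 + drift x \<bullet> grad u0 x)"
    unfolding t1 by (simp add: inner_add_right algebra_simps)
  also have "\<dots> = - Re (\<omega> * (lam - of_real lam0) * (u x / of_real (u0 x)))
      + \<eta> * barrier_source A x"
    unfolding q2 d0 H0(2) re using u0 by (simp add: field_simps)
  finally show thesis using hh that by blast
qed

text \<open>The negative terms are of the size \<open>(\<bar>\<lambda>\<^sub>0\<bar> + \<bar>a\<bar>)/u\<^sub>0\<close>. Where \<open>u\<^sub>0 < \<delta>\<^sub>0\<close>, the gradient term beats them for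
  \<open>A = (\<bar>\<lambda>\<^sub>0\<bar> + \<bar>a\<bar>) / (2\<theta>\<^sub>0\<^sup>2)\<close>, and elsewhere they are bounded. The constant \<open>C0\<close> may depend on everything, because it
  is multiplied by \<open>\<eta>\<close> in the end.\<close>
lemma barrier_supersolution:
  obtains A A' C0 where "\<And>z. z \<in> \<Omega> \<Longrightarrow> inverse (u0 z) + 1 \<le> barrier A A' z" "C0 \<ge> 0"
    "\<And>z. z \<in> \<Omega> \<Longrightarrow> a * barrier A A' z - C0 \<le>
       barrier_source A z"
proof -
  define \<theta> where "\<theta> = theta0 \<Omega> u0"
  define \<delta> where "\<delta> = delta0 \<Omega> u0"
  have \<theta>: "\<theta> > 0" and \<delta>: "\<delta> > 0" using theta0_pos delta0_pos by (auto simp: \<theta>_def \<delta>_def)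
  obtain U where U: "U \<ge> 0" "\<And>x. x \<in> closure \<Omega> \<Longrightarrow> norm (u0 x) \<le> U"
    using continuous_image_bounded[OF u0_cont bounded_dom] by blast
  define P where "P = \<bar>lam0\<bar> + \<bar>a\<bar>"
  define A where "A = P / (2 * \<theta>\<^sup>2)"
  define A' where "A' = 1 + A * U"
  define C0 where "C0 = P / \<delta> + A * \<bar>lam0\<bar> * U + \<bar>a\<bar> * A'"
  have P: "P \<ge> 0" and A: "A \<ge> 0" using \<theta> by (auto simp: P_def A_def)
  have A': "A' \<ge> 0" using A U by (simp add: A'_def)
  have uU: "0 < u0 z" "u0 z \<le> U" if "z \<in> \<Omega>" for z
    using that U(2)[of z] closure_subset[of \<Omega>] u0_pos[OF that] by force+
  have ge: "inverse (u0 z) + 1 \<le> barrier A A' z" if "z \<in> \<Omega>" for z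
    using uU[OF that] mult_left_mono[of "u0 z" U A] A by (simp add: barrier_def A'_def)
  have C0: "C0 \<ge> 0" using P \<delta> A U A' by (simp add: C0_def)
  have "a * barrier A A' z - C0 \<le>
       barrier_source A z" if z: "z \<in> \<Omega>" for z
  proof -
    note u = uU[OF z]
    have b0: "barrier A A' z \<ge> 0" using ge[OF z] u by (smt (verit) inverse_positive_iff_positive)
    have b1: "barrier A A' z \<le> inverse (u0 z) + A'" using A u by (simp add: barrier_def)
    have "a * barrier A A' z \<le> \<bar>a\<bar> * barrier A A' z" using b0 by (intro mult_right_mono) auto
    also have "\<dots> \<le> \<bar>a\<bar> * (inverse (u0 z) + A')" using b1 by (intro mult_left_mono) auto
    finally have 1: "a * barrier A A' z \<le> \<bar>a\<bar> / u0 z + \<bar>a\<bar> * A'" by (simp add: algebra_simps divide_inverse)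
    have 2: "- (\<bar>lam0\<bar> / u0 z) \<le> (c z - lam0) / u0 z"
      using u c_nonneg[OF z] by (simp add: divide_right_mono minus_divide_left del: minus_divide_left[symmetric])
    have "- (\<bar>lam0\<bar> * U) \<le> - (\<bar>lam0\<bar> * u0 z)" using u by (simp add: mult_left_mono)
    also have "\<dots> \<le> (c z - lam0) * u0 z"
      using u c_nonneg[OF z] mult_right_mono[of "- \<bar>lam0\<bar>" "c z - lam0" "u0 z"] by simp
    finally have "A * - (\<bar>lam0\<bar> * U) \<le> A * ((c z - lam0) * u0 z)" using A by (rule mult_left_mono)
    then have 3: "- (A * \<bar>lam0\<bar> * U) \<le> A * ((c z - lam0) * u0 z)" by simp
    have 4: "P / u0 z \<le> A * (2 * (norm (grad u0 z))\<^sup>2 / u0 z) + P / \<delta>"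
    proof (cases "u0 z < \<delta>")
      case True
      then have "\<theta> \<le> norm (grad u0 z)" using theta0_le[OF z] by (simp add: \<theta>_def \<delta>_def)
      then have "\<theta>\<^sup>2 \<le> (norm (grad u0 z))\<^sup>2" using \<theta> by (intro power_mono) auto
      then have "A * (2 * \<theta>\<^sup>2) \<le> A * (2 * (norm (grad u0 z))\<^sup>2)" using A by (intro mult_left_mono) auto
      moreover have "A * (2 * \<theta>\<^sup>2) = P" using \<theta> by (simp add: A_def)
      ultimately have "P / u0 z \<le> A * (2 * (norm (grad u0 z))\<^sup>2) / u0 z" using u by (intro divide_right_mono) auto
      moreover have "P / \<delta> \<ge> 0" using P \<delta> by simp
      ultimately show ?thesis by simp
    next
      case False
      then have "P / u0 z \<le> P / \<delta>" using P \<delta> u by (intro divide_left_mono) auto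
      moreover have "A * (2 * (norm (grad u0 z))\<^sup>2 / u0 z) \<ge> 0" using A u by simp
      ultimately show ?thesis by simp
    qed
    have "P / u0 z = \<bar>lam0\<bar> / u0 z + \<bar>a\<bar> / u0 z" by (simp add: P_def add_divide_distrib)
    then show ?thesis using 1 2 3 4 unfolding C0_def by (simp add: distrib_left)
  qed
  with ge C0 show thesis by (rule that)
qed

text \<open>In terms of \<open>q = \<bar>u\<bar>/u\<^sub>0 - \<eta> b\<close> the expression is at most \<open>q(x) + q(y)\<close>. Where \<open>\<bar>u\<bar> \<ge> \<eta>/2\<close>, which is a
  compact subset of the domain, \<open>q\<close> is bounded by some \<open>C1\<close>, elsewhere \<open>q\<close> is at most \<open>- \<eta>/(2u\<^sub>0)\<close>. So near the
  boundary \<open>q\<close> is below \<open>- C1\<close>, and the other point cannot make up for it.\<close>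
lemma quotient_compact:
  assumes ef: "dirichlet_eigenfunction \<Omega> B c lam u" and \<eta>: "\<eta> > 0"
    and b: "\<And>z. z \<in> \<Omega> \<Longrightarrow> inverse (u0 z) + 1 \<le> b z"
  obtains S where "compact S" "S \<subseteq> \<Omega>"
    "\<And>x y. x \<in> \<Omega> \<Longrightarrow> y \<in> \<Omega> \<Longrightarrow>
      norm (u y / of_real (u0 y) - u x / of_real (u0 x)) - \<eta> * (b x + b y) > 0 \<Longrightarrow> x \<in> S \<and> y \<in> S"
proof -
  have uc: "continuous_on (closure \<Omega>) u" and ub: "\<And>x. x \<in> frontier \<Omega> \<Longrightarrow> u x = 0"
    using ef unfolding dirichlet_eigenfunction_def by auto
  have bc: "bounded (closure \<Omega>)" by (rule bounded_closure[OF bounded_dom])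
  define q where "q = (\<lambda>z. norm (u z / of_real (u0 z)) - \<eta> * b z)"
  have qle: "q z \<le> (norm (u z) - \<eta>) / u0 z" if "z \<in> \<Omega>" for z
  proof -
    have "\<eta> * (inverse (u0 z) + 1) \<le> \<eta> * b z" using b[OF that] \<eta> by (intro mult_left_mono) auto
    moreover have "norm (u z / of_real (u0 z)) = norm (u z) / u0 z" using u0_pos[OF that] by (simp add: norm_divide)
    moreover have "(norm (u z) - \<eta>) / u0 z = norm (u z) / u0 z - \<eta> * inverse (u0 z)"
      by (simp add: diff_divide_distrib inverse_eq_divide)
    moreover have "\<eta> * (inverse (u0 z) + 1) = \<eta> * inverse (u0 z) + \<eta>" by (simp add: distrib_left)
    ultimately show ?thesis using \<eta> unfolding q_def by linarith
  qed
  have small: "q z \<le> - (\<eta> / 2) / u0 z" if "z \<in> \<Omega>" "norm (u z) < \<eta> / 2" for z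
    using qle[OF that(1)] divide_right_mono[of "norm (u z) - \<eta>" "- (\<eta> / 2)" "u0 z"] that(2) u0_pos[OF that(1)] by simp
  define K1 where "K1 = {z \<in> closure \<Omega>. \<eta> / 2 \<le> norm (u z)}"
  have "closed K1" unfolding K1_def
    by (intro continuous_on_closed_Collect_le continuous_on_const continuous_on_norm uc closed_closure)
  moreover have "bounded K1" using bc by (rule bounded_subset) (auto simp: K1_def)
  ultimately have cK1: "compact K1" by (simp add: compact_eq_bounded_closed)
  have K1sub: "K1 \<subseteq> \<Omega>" using closure_cases ub \<eta> by (force simp: K1_def)
  have "continuous_on K1 (\<lambda>z. norm (u z) / u0 z)"
    using K1sub u0_pos by (intro continuous_on_divide continuous_on_norm continuous_on_subset[OF uc] continuous_on_subset[OF u0_cont])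
      (force simp: K1_def)+
  then have "compact ((\<lambda>z. norm (u z) / u0 z) ` K1)" using cK1 by (rule compact_continuous_image)
  then have "bounded ((\<lambda>z. norm (u z) / u0 z) ` K1)" by (rule compact_imp_bounded)
  then obtain C where *: "\<forall>q \<in> (\<lambda>z. norm (u z) / u0 z) ` K1. norm q \<le> C" unfolding bounded_iff by blast
  then have C: "norm (u z) / u0 z \<le> C" if "z \<in> K1" for z
  proof -
    have "norm (norm (u z) / u0 z) \<le> C" using * that by blast
    then show ?thesis unfolding real_norm_def by (rule abs_le_D1)
  qed
  define C1 where "C1 = max C 0"
  have C1: "C1 \<ge> 0" by (simp add: C1_def)
  have qC: "q z \<le> C1" if z: "z \<in> \<Omega>" for z
  proof (cases "z \<in> K1")
    case True
    have "q z \<le> norm (u z) / u0 z" using qle[OF z] \<eta> u0_pos[OF z] divide_right_mono[of "norm (u z) - \<eta>" "norm (u z)" "u0 z"] by simp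
    then show ?thesis using C[OF True] by (simp add: C1_def)
  next
    case False
    then have "norm (u z) < \<eta> / 2" using z closure_subset by (force simp: K1_def)
    then have "q z \<le> - (\<eta> / 2) / u0 z" by (rule small[OF z])
    also have "\<dots> \<le> 0" using \<eta> u0_pos[OF z] by simp
    finally show ?thesis using C1 by simp
  qed
  define m where "m = (\<eta> / 2) / (C1 + 1)"
  have m: "m > 0" using \<eta> C1 by (simp add: m_def)
  define S where "S = K1 \<union> {z \<in> closure \<Omega>. m \<le> u0 z}"
  have "closed {z \<in> closure \<Omega>. m \<le> u0 z}"
    by (intro continuous_on_closed_Collect_le continuous_on_const u0_cont closed_closure)
  moreover have "bounded {z \<in> closure \<Omega>. m \<le> u0 z}" using bc by (rule bounded_subset) auto
  ultimately have cS: "compact S" unfolding S_def using cK1 by (intro compact_Un) (simp_all add: compact_eq_bounded_closed)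
  have "{z \<in> closure \<Omega>. m \<le> u0 z} \<subseteq> \<Omega>" using closure_cases u0_frontier m by force
  then have Ssub: "S \<subseteq> \<Omega>" using K1sub by (simp add: S_def)
  have outside: "q z < - C1" if z: "z \<in> \<Omega>" "z \<notin> S" for z
  proof -
    have zc: "z \<in> closure \<Omega>" using z closure_subset by blast
    then have "norm (u z) < \<eta> / 2" "u0 z < m" using z(2) by (auto simp: S_def K1_def)
    then have "q z \<le> - (\<eta> / 2) / u0 z" using small[OF z(1)] by blast
    moreover have "C1 + 1 < (\<eta> / 2) / u0 z"
    proof -
      have "(C1 + 1) * u0 z < (C1 + 1) * m" using \<open>u0 z < m\<close> C1 by (intro mult_strict_left_mono) auto
      also have "\<dots> = \<eta> / 2" unfolding m_def by (rule nonzero_mult_div_cancel_left[of "C1 + 1", folded times_divide_eq_right]) (use C1 in simp)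
      finally show ?thesis using u0_pos[OF z(1)] by (simp add: pos_less_divide_eq)
    qed
    ultimately show ?thesis by simp
  qed
  show thesis
  proof (rule that[OF cS Ssub])
    fix x y assume x: "x \<in> \<Omega>" and y: "y \<in> \<Omega>"
      and gt: "norm (u y / of_real (u0 y) - u x / of_real (u0 x)) - \<eta> * (b x + b y) > 0"
    have "norm (u y / of_real (u0 y) - u x / of_real (u0 x)) \<le> norm (u y / of_real (u0 y)) + norm (u x / of_real (u0 x))"
      by (rule norm_triangle_ineq4)
    then have "q x + q y > 0" using gt by (simp add: q_def distrib_left)
    then show "x \<in> S \<and> y \<in> S"
      using outside[OF x] outside[OF y] qC[OF x] qC[OF y] by linarith
  qed
qed

text \<open>The two-point maximum principle at a maximum \<open>(x0, y0)\<close> of \<open>N/\<psi>\<close>, where \<open>N\<close> is the oscillation of the quotient minus \<open>\<eta>\<close> times the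
  barrier at both points. On the diagonal \<open>N\<close> is negative, so \<open>x0\<close> and \<open>y0\<close> differ. The maximum
  value \<open>M\<close> satisfies \<open>M (\<epsilon> - a) \<psi> \<le> 2\<eta> C0\<close>, and \<open>1 \<le> \<psi> \<le> 2\<close>.\<close>
lemma quotient_oscillation:
  assumes ef: "dirichlet_eigenfunction \<Omega> B c lam u" and \<eta>: "\<eta> > 0"
    and diam: "\<And>x y. x \<in> \<Omega> \<Longrightarrow> y \<in> \<Omega> \<Longrightarrow> dist x y \<le> D"
    and lt: "Re lam - lam0 < gap_const D drift_const"
    and b: "\<And>z. z \<in> \<Omega> \<Longrightarrow> inverse (u0 z) + 1 \<le> barrier A A' z" and C0: "C0 \<ge> 0"
    and sup: "\<And>z. z \<in> \<Omega> \<Longrightarrow> (Re lam - lam0) * barrier A A' z - C0 \<le>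
       barrier_source A z"
    and x1: "x1 \<in> \<Omega>" and y1: "y1 \<in> \<Omega>"
  shows "norm (u y1 / of_real (u0 y1) - u x1 / of_real (u0 x1)) \<le>
    \<eta> * (barrier A A' x1 + barrier A A' y1) + 4 * \<eta> * C0 / (gap_const D drift_const - (Re lam - lam0))"
proof -
  define a where "a = Re lam - lam0"
  define \<epsilon> where "\<epsilon> = gap_const D drift_const"
  define \<kappa> where "\<kappa> = \<bar>drift_const\<bar> + 1"
  have \<kappa>: "\<kappa> > 0" "drift_const \<le> \<kappa>" by (auto simp: \<kappa>_def)
  have \<epsilon>: "\<epsilon> = \<kappa>\<^sup>2 * exp (- \<kappa> * D)" by (simp add: \<epsilon>_def gap_const_def \<kappa>_def)
  have \<epsilon>pos: "\<epsilon> > 0" using gap_const_pos by (simp add: \<epsilon>_def)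
  have a\<epsilon>: "a < \<epsilon>" using lt by (simp add: a_def \<epsilon>_def)
  define w where "w = (\<lambda>z. u z / of_real (u0 z))"
  let ?b = "barrier A A'"
  define \<psi> where "\<psi> = (\<lambda>r. 2 - exp (- \<kappa> * r))"
  have \<psi>: "1 \<le> \<psi> r" "\<psi> r \<le> 2" if "r \<ge> 0" for r using \<kappa> that by (auto simp: \<psi>_def)
  define N where "N = (\<lambda>x y. norm (w y - w x) - \<eta> * (?b x + ?b y))"
  have bpos: "?b z > 0" if "z \<in> \<Omega>" for z
  proof -
    have "inverse (u0 z) > 0" using u0_pos[OF that] by simp
    then show ?thesis using b[OF that] by linarith
  qed
  have rhs0: "4 * \<eta> * C0 / (\<epsilon> - a) \<ge> 0" using \<eta> C0 a\<epsilon> by simp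
  have "N x1 y1 \<le> 4 * \<eta> * C0 / (\<epsilon> - a)"
  proof (cases "N x1 y1 > 0")
    case False
    then show ?thesis using rhs0 by simp
  next
    case True
    obtain S where S: "compact S" "S \<subseteq> \<Omega>" "\<And>x y. x \<in> \<Omega> \<Longrightarrow> y \<in> \<Omega> \<Longrightarrow> N x y > 0 \<Longrightarrow> x \<in> S \<and> y \<in> S"
      using quotient_compact[OF ef \<eta> b] unfolding N_def w_def by blast
    have SS: "x1 \<in> S" "y1 \<in> S" using S(3)[OF x1 y1 True] by auto
    let ?Z = "\<lambda>p. N (fst p) (snd p) / \<psi> (dist (fst p) (snd p))"
    have cu: "continuous_on S u" "continuous_on S u0"
      using ef S(2) closure_subset[of \<Omega>] u0_cont unfolding dirichlet_eigenfunction_def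
      by (auto intro: continuous_on_subset)
    have u0S: "\<forall>z\<in>S. u0 z \<noteq> 0" using S(2) u0_pos by force
    have cw: "continuous_on S w" unfolding w_def
      by (intro continuous_on_divide continuous_on_of_real cu) (use u0S in simp)
    have cb: "continuous_on S ?b" unfolding barrier_def
      by (intro continuous_intros cu) (use u0S in simp)
    have "continuous_on (S \<times> S) ?Z" unfolding N_def
    proof (intro continuous_on_divide continuous_on_diff continuous_on_norm continuous_on_mult continuous_on_add continuous_on_const)
      show "continuous_on (S \<times> S) (\<lambda>p. w (snd p))" "continuous_on (S \<times> S) (\<lambda>p. w (fst p))"
        "continuous_on (S \<times> S) (\<lambda>p. ?b (snd p))" "continuous_on (S \<times> S) (\<lambda>p. ?b (fst p))"
        by (auto intro!: continuous_on_compose2[OF cw] continuous_on_compose2[OF cb] continuous_intros)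
      show "continuous_on (S \<times> S) (\<lambda>p. \<psi> (dist (fst p) (snd p)))"
        unfolding \<psi>_def by (intro continuous_intros)
      have "\<psi> (dist x y) \<noteq> 0" for x y :: "real^'n" using \<psi>(1)[OF zero_le_dist, of x y] by linarith
      then show "\<forall>p\<in>S \<times> S. \<psi> (dist (fst p) (snd p)) \<noteq> 0" by blast
    qed
    moreover have "compact (S \<times> S)" using S by (intro compact_Times)
    moreover have "(x1, y1) \<in> S \<times> S" using SS by simp
    ultimately obtain p where p: "p \<in> S \<times> S" "\<And>p'. p' \<in> S \<times> S \<Longrightarrow> ?Z p' \<le> ?Z p"
      using continuous_attains_sup[of "S \<times> S" ?Z] by blast
    obtain x0 y0 where p0: "p = (x0, y0)" by fastforce
    define M where "M = N x0 y0 / \<psi> (dist x0 y0)"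
    have Mmax: "N x y / \<psi> (dist x y) \<le> M" if "x \<in> S" "y \<in> S" for x y
      using p(2)[of "(x, y)"] that by (simp add: p0 M_def)
    have \<psi>d: "\<psi> (dist x y) > 0" for x y :: "real^'n" using \<psi>(1)[OF zero_le_dist, of x y] by linarith
    have "0 < N x1 y1 / \<psi> (dist x1 y1)" using True \<psi>d by simp
    then have Mpos: "M > 0" using Mmax[OF SS] by linarith
    have NM: "N x y \<le> M * \<psi> (dist x y)" if "x \<in> \<Omega>" "y \<in> \<Omega>" for x y
    proof (cases "N x y > 0")
      case True
      then have "N x y / \<psi> (dist x y) \<le> M" using S(3)[OF that True] Mmax by blast
      then show ?thesis using \<psi>d[of x y] by (simp add: pos_divide_le_eq)
    next
      case False
      moreover have "M * \<psi> (dist x y) > 0" using Mpos \<psi>d by simp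
      ultimately show ?thesis by linarith
    qed
    have x0: "x0 \<in> \<Omega>" and y0: "y0 \<in> \<Omega>" using p(1) S(2) by (auto simp: p0)
    have N0: "N x0 y0 = M * \<psi> (dist x0 y0)" using \<psi>d[of x0 y0] by (simp add: M_def)
    then have N0pos: "N x0 y0 > 0" using Mpos \<psi>d by simp
    have ne: "x0 \<noteq> y0"
    proof
      assume "x0 = y0"
      then have "N x0 y0 = - (\<eta> * (?b x0 + ?b x0))" by (simp add: N_def)
      moreover have "\<eta> * (?b x0 + ?b x0) > 0" using \<eta> bpos[OF x0] by simp
      ultimately show False using N0pos by linarith
    qed
    define \<Delta> where "\<Delta> = w y0 - w x0"
    have "\<eta> * (?b x0 + ?b y0) > 0" using \<eta> bpos[OF x0] bpos[OF y0] by simp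
    then have \<Delta>: "norm \<Delta> > 0" using N0pos unfolding N_def \<Delta>_def by linarith
    define \<omega> where "\<omega> = cnj \<Delta> / of_real (norm \<Delta>)"
    have n\<omega>: "norm \<omega> = 1" using \<Delta> by (simp add: \<omega>_def norm_divide)
    have \<omega>\<Delta>: "\<omega> * \<Delta> = of_real (norm \<Delta>)"
    proof -
      have "cnj \<Delta> * \<Delta> = of_real ((norm \<Delta>)\<^sup>2)" by (metis complex_norm_square mult.commute of_real_power)
      then show ?thesis using \<Delta> by (simp add: \<omega>_def power2_eq_square)
    qed
    obtain g H where gH: "has_hessian (\<lambda>z. Re (- \<omega> * w z) - \<eta> * ?b z) x0 g H"
      "trace_of H + drift x0 \<bullet> g = - Re (- \<omega> * (lam - of_real lam0) * w x0)
      + \<eta> * barrier_source A x0"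
      using test_function_hessian[OF ef x0, of "- \<omega>" \<eta> A A'] unfolding w_def by blast
    obtain g' H' where gH': "has_hessian (\<lambda>z. Re (\<omega> * w z) - \<eta> * ?b z) y0 g' H'"
      "trace_of H' + drift y0 \<bullet> g' = - Re (\<omega> * (lam - of_real lam0) * w y0)
      + \<eta> * barrier_source A y0"
      using test_function_hessian[OF ef y0, of \<omega> \<eta> A A'] unfolding w_def by blast
    let ?f = "\<lambda>z. Re (- \<omega> * w z) - \<eta> * ?b z" and ?f' = "\<lambda>z. Re (\<omega> * w z) - \<eta> * ?b z"
    let ?r = "dist x0 y0"
    define e where "e = (1 / ?r) *\<^sub>R (y0 - x0)"
    define E where "E = exp (- \<kappa> * ?r)"
    have mx: "\<forall>\<^sub>F z in nhds (x0, y0). ?f (fst z) + ?f' (snd z) - M * \<psi> (dist (fst z) (snd z)) \<le> ?f x0 + ?f' y0 - M * \<psi> ?r"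
    proof -
      have "\<forall>\<^sub>F z in nhds (x0, y0). z \<in> \<Omega> \<times> \<Omega>"
        using x0 y0 open_dom by (intro eventually_nhds_in_open open_Times) auto
      then show ?thesis
      proof eventually_elim
        case (elim z)
        have "Re (\<omega> * (w (snd z) - w (fst z))) \<le> norm (\<omega> * (w (snd z) - w (fst z)))" by (rule complex_Re_le_cmod)
        also have "\<dots> = norm (w (snd z) - w (fst z))" by (simp add: norm_mult n\<omega>)
        finally have "?f (fst z) + ?f' (snd z) \<le> N (fst z) (snd z)" by (simp add: N_def algebra_simps)
        moreover have "N (fst z) (snd z) \<le> M * \<psi> (dist (fst z) (snd z))" using NM elim by auto
        moreover have "Re (\<omega> * (w y0 - w x0)) = norm (w y0 - w x0)" using \<omega>\<Delta> by (simp add: \<Delta>_def)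
        then have "?f x0 + ?f' y0 = N x0 y0" by (simp add: N_def algebra_simps)
        ultimately show ?case using N0 by simp
      qed
    qed
    have d1: "((\<lambda>r. M * \<psi> r) has_real_derivative M * \<kappa> * exp (- \<kappa> * s)) (at s)" for s
      unfolding \<psi>_def by (auto intro!: derivative_eq_intros)
    have d2: "((\<lambda>s. M * \<kappa> * exp (- \<kappa> * s)) has_real_derivative - (M * \<kappa>\<^sup>2 * E)) (at ?r)"
      unfolding E_def by (auto intro!: derivative_eq_intros simp: power2_eq_square)
    note tp = two_point_max_hessian[OF gH(1) gH'(1) ne d1 d2 mx, folded e_def E_def]
    have tr: "trace_of H + trace_of H' \<le> - 4 * (M * \<kappa>\<^sup>2 * E)" using tp(3) by simp
    have "drift x0 \<bullet> g + drift y0 \<bullet> g' = M * \<kappa> * E * ((drift y0 - drift x0) \<bullet> e)"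
      unfolding tp(1,2) by (simp add: inner_diff_left algebra_simps)
    also have "\<dots> \<le> M * \<kappa> * E * \<kappa>"
      using drift_modulus[OF x0 y0 ne] \<kappa> Mpos unfolding e_def E_def by (intro mult_left_mono) auto
    finally have dr: "drift x0 \<bullet> g + drift y0 \<bullet> g' \<le> M * \<kappa>\<^sup>2 * E" by (simp add: power2_eq_square mult_ac)
    have "\<kappa> * ?r \<le> \<kappa> * D" using diam[OF x0 y0] \<kappa> by (intro mult_left_mono) auto
    then have "exp (- \<kappa> * D) \<le> E" by (simp add: E_def)
    then have "\<kappa>\<^sup>2 * exp (- \<kappa> * D) \<le> \<kappa>\<^sup>2 * E" by (intro mult_left_mono) auto
    then have \<epsilon>E: "\<epsilon> \<le> \<kappa>\<^sup>2 * E" by (simp only: \<epsilon>)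
    have "\<epsilon> * \<psi> ?r \<le> \<epsilon> * 2" using \<epsilon>pos \<psi>(2)[OF zero_le_dist, of x0 y0] by (intro mult_left_mono) auto
    also have "\<dots> \<le> 3 * (\<kappa>\<^sup>2 * E)" using \<epsilon>E \<epsilon>pos by simp
    finally have "M * (\<epsilon> * \<psi> ?r) \<le> M * (3 * (\<kappa>\<^sup>2 * E))" using Mpos by (intro mult_left_mono) auto
    then have up: "(trace_of H + drift x0 \<bullet> g) + (trace_of H' + drift y0 \<bullet> g') \<le> - (M * \<epsilon> * \<psi> ?r)"
      using tr dr by (simp add: algebra_simps)
    have "Re (\<omega> * (lam - of_real lam0) * w y0) + Re (- \<omega> * (lam - of_real lam0) * w x0) = Re ((lam - of_real lam0) * (\<omega> * \<Delta>))"
      by (simp add: \<Delta>_def algebra_simps)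
    also have "\<dots> = a * norm \<Delta>" unfolding \<omega>\<Delta> by (simp add: a_def)
    finally have re: "- Re (- \<omega> * (lam - of_real lam0) * w x0) + - Re (\<omega> * (lam - of_real lam0) * w y0) = - (a * norm \<Delta>)" by linarith
    have sx: "\<eta> * (a * ?b x0 - C0) \<le> \<eta> * barrier_source A x0"
      using sup[OF x0] \<eta> unfolding a_def by (intro mult_left_mono) auto
    have sy: "\<eta> * (a * ?b y0 - C0) \<le> \<eta> * barrier_source A y0"
      using sup[OF y0] \<eta> unfolding a_def by (intro mult_left_mono) auto
    have "- (a * norm \<Delta>) + \<eta> * (a * ?b x0 - C0) + \<eta> * (a * ?b y0 - C0) \<le> - (M * \<epsilon> * \<psi> ?r)"
      using up re sx sy unfolding gH(2) gH'(2) by linarith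
    moreover have "norm \<Delta> = M * \<psi> ?r + \<eta> * (?b x0 + ?b y0)" using N0 by (simp add: N_def \<Delta>_def)
    ultimately have "M * (\<epsilon> - a) * \<psi> ?r \<le> 2 * \<eta> * C0" by (simp add: algebra_simps)
    moreover have "M * (\<epsilon> - a) * 1 \<le> M * (\<epsilon> - a) * \<psi> ?r"
      using Mpos a\<epsilon> \<psi>(1)[OF zero_le_dist, of x0 y0] by (intro mult_left_mono) auto
    ultimately have "M * (\<epsilon> - a) \<le> 2 * \<eta> * C0" by simp
    then have "M \<le> 2 * \<eta> * C0 / (\<epsilon> - a)" using a\<epsilon> by (simp add: pos_le_divide_eq)
    moreover have "M * \<psi> (dist x1 y1) \<le> M * 2" using Mpos \<psi>(2)[OF zero_le_dist, of x1 y1] by (intro mult_left_mono) auto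
    ultimately have "N x1 y1 \<le> 2 * \<eta> * C0 / (\<epsilon> - a) * 2" using NM[OF x1 y1] by linarith
    then show ?thesis by simp
  qed
  then show ?thesis by (simp add: N_def w_def \<epsilon>_def a_def)
qed

text \<open>Comparing the equations of \<open>Re(\<omega>u)\<close> and \<open>u\<^sub>0\<close> gives \<open>Re(\<omega>k(\<lambda> - \<lambda>\<^sub>0)) = 0\<close> for every \<open>\<omega>\<close>, in particular for the
  conjugate of \<open>k(\<lambda> - \<lambda>\<^sub>0)\<close>.\<close>
lemma proportional_eigenvalue:
  assumes ef: "dirichlet_eigenfunction \<Omega> B c lam u" and k: "\<And>x. x \<in> \<Omega> \<Longrightarrow> u x = k * of_real (u0 x)"
  shows "lam = of_real lam0"
proof -
  obtain x where x: "x \<in> \<Omega>" "u x \<noteq> 0" using ef unfolding dirichlet_eigenfunction_def by blast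
  have u0: "u0 x > 0" by (rule u0_pos[OF x(1)])
  have k0: "k \<noteq> 0" using k[OF x(1)] x(2) by auto
  define \<omega> where "\<omega> = cnj (k * (lam - of_real lam0))"
  obtain g H where gH: "has_hessian (\<lambda>z. Re (\<omega> * u z)) x g H"
    "trace_of H - B x \<bullet> g - c x * Re (\<omega> * u x) = - Re (\<omega> * lam * u x)"
    by (rule eigenfunction_hessian[OF ef x(1)])
  obtain H0 where H0: "has_hessian u0 x (grad u0 x) H0" "trace_of H0 = B x \<bullet> grad u0 x + (c x - lam0) * u0 x"
    by (rule u0_hessian[OF x(1)])
  let ?s = "Re (\<omega> * k)"
  have h2: "has_hessian (\<lambda>z. ?s * u0 z) x (?s *\<^sub>R grad u0 x) (\<lambda>h. ?s *\<^sub>R H0 h)"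
    by (rule has_hessian_cmult[OF H0(1)])
  have eq: "Re (\<omega> * u z) = ?s * u0 z" if "z \<in> \<Omega>" for z
    using k[OF that] by (simp add: algebra_simps)
  have "\<forall>\<^sub>F z in nhds x. ?s * u0 z = Re (\<omega> * u z)"
    using eventually_nhds_in_open[OF open_dom x(1)] by eventually_elim (rule eq[symmetric])
  then have "has_hessian (\<lambda>z. Re (\<omega> * u z)) x (?s *\<^sub>R grad u0 x) (\<lambda>h. ?s *\<^sub>R H0 h)"
    by (rule has_hessian_cong[OF h2])
  then have g: "g = ?s *\<^sub>R grad u0 x" and H: "H = (\<lambda>h. ?s *\<^sub>R H0 h)" using has_hessian_unique[OF gH(1)] by auto
  have "trace_of H = ?s * trace_of H0" unfolding H using trace_of_lincomb[of ?s H0 0 H0] by simp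
  then have "- (lam0 * (?s * u0 x)) = - Re (\<omega> * lam * u x)"
    using gH(2) unfolding eq[OF x(1)] H0(2) g by (simp add: algebra_simps)
  moreover have "Re (\<omega> * lam * u x) = Re (\<omega> * lam * k) * u0 x" using k[OF x(1)] by (simp add: algebra_simps)
  ultimately have "(Re (\<omega> * lam * k) - lam0 * ?s) * u0 x = 0" by (simp add: algebra_simps)
  then have "Re (\<omega> * lam * k) - lam0 * ?s = 0" using u0 by simp
  moreover have "Re (\<omega> * lam * k) - lam0 * ?s = Re (\<omega> * (k * (lam - of_real lam0)))" by (simp add: algebra_simps)
  moreover have "Re (\<omega> * (k * (lam - of_real lam0))) = (norm (k * (lam - of_real lam0)))\<^sup>2"
    unfolding \<omega>_def by (metis Re_complex_of_real complex_norm_square mult.commute)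
  ultimately have "k * (lam - of_real lam0) = 0" by simp
  then show ?thesis using k0 by simp
qed

text \<open>If the gap were smaller, \<open>\<eta> \<rightarrow> 0\<close> in \<open>quotient_oscillation\<close> would make \<open>u/u\<^sub>0\<close> constant.\<close>
theorem spectral_gap:
  assumes ef: "dirichlet_eigenfunction \<Omega> B c lam u" and ne: "lam \<noteq> of_real lam0"
    and diam: "\<And>x y. x \<in> \<Omega> \<Longrightarrow> y \<in> \<Omega> \<Longrightarrow> dist x y \<le> D"
  shows "Re lam - lam0 \<ge> gap_const D drift_const"
proof (rule ccontr)
  assume "\<not> ?thesis"
  then have lt: "Re lam - lam0 < gap_const D drift_const" by simp
  obtain A A' C0 where b: "\<And>z. z \<in> \<Omega> \<Longrightarrow> inverse (u0 z) + 1 \<le> barrier A A' z" "C0 \<ge> 0"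
    "\<And>z. z \<in> \<Omega> \<Longrightarrow> (Re lam - lam0) * barrier A A' z - C0 \<le>
       barrier_source A z"
    using barrier_supersolution[of "Re lam - lam0"] by blast
  have const: "u y / of_real (u0 y) = u x / of_real (u0 x)" if x: "x \<in> \<Omega>" and y: "y \<in> \<Omega>" for x y
  proof -
    let ?t = "norm (u y / of_real (u0 y) - u x / of_real (u0 x))"
    let ?C = "barrier A A' x + barrier A A' y + 4 * C0 / (gap_const D drift_const - (Re lam - lam0))"
    have le: "?t \<le> \<eta> * ?C" if "\<eta> > 0" for \<eta>
      using quotient_oscillation[OF ef that diam lt b x y] by (simp add: distrib_left mult_ac)
    have "?t \<le> 0"
    proof (rule field_le_epsilon)
      fix e :: real assume e: "e > 0"
      have "?t \<le> e / (1 + \<bar>?C\<bar>) * ?C" by (rule le) (use e in simp)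
      also have "\<dots> \<le> e / (1 + \<bar>?C\<bar>) * (1 + \<bar>?C\<bar>)" using e by (intro mult_left_mono) auto
      also have "\<dots> = e" by simp
      finally show "?t \<le> 0 + e" by simp
    qed
    then show ?thesis by simp
  qed
  obtain x where x: "x \<in> \<Omega>" using nonempty by blast
  have "lam = of_real lam0"
  proof (rule proportional_eigenvalue[OF ef, of "u x / of_real (u0 x)"])
    fix y assume y: "y \<in> \<Omega>"
    show "u y = u x / of_real (u0 x) * of_real (u0 y)"
      using const[OF x y] u0_pos[OF y] by (simp add: field_simps)
  qed
  then show False using ne by simp
qed

end

lemma strictly_convex_imp_convex:
  assumes "strictly_convex \<Omega>" "open \<Omega>" shows "convex \<Omega>"
  unfolding convex_contains_open_segment
proof (intro ballI)
  fix x y assume xy: "x \<in> \<Omega>" "y \<in> \<Omega>"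
  then have "x \<in> closure \<Omega>" "y \<in> closure \<Omega>" using closure_subset by auto
  then show "open_segment x y \<subseteq> \<Omega>"
    using assms xy unfolding strictly_convex_def by (cases "x = y") (auto simp: interior_open)
qed

section \<open>The eigenvalue comparison\<close>

lemma diameter_open_pos:
  fixes S :: "'a::euclidean_space set"
  assumes "open S" "S \<noteq> {}" "bounded S"
  shows "diameter S > 0"
proof -
  obtain x where x: "x \<in> S" using assms by blast
  obtain r where r: "r > 0" "cball x r \<subseteq> S" using assms(1) x open_contains_cball by blast
  obtain e :: 'a where e: "e \<in> Basis" using nonempty_Basis by blast
  have d: "dist x (x + r *\<^sub>R e) = r" using r e by (simp add: dist_norm)
  then have "x + r *\<^sub>R e \<in> S" using r by auto
  then have "dist x (x + r *\<^sub>R e) \<le> diameter S" using x assms(3) by (intro diameter_bounded_bound)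
  then show ?thesis using d r by simp
qed

theorem theorem0p1:
  fixes \<Omega> :: "(real^'n::finite) set" and D :: real
  assumes "open \<Omega>" and "\<Omega> \<noteq> {}" and "bounded \<Omega>" and "connected \<Omega>"
    and "strictly_convex \<Omega>" and "smooth_boundary \<Omega>"
    and "D = diameter \<Omega>"
  shows "\<exists>\<Phi> :: ('n \<Rightarrow> real) \<Rightarrow> ('n \<Rightarrow> real) \<Rightarrow> real \<Rightarrow> real \<Rightarrow> real \<Rightarrow> real \<Rightarrow> real \<Rightarrow> real.
    \<forall>(B :: real^'n \<Rightarrow> real^'n) (c :: real^'n \<Rightarrow> real) (K :: real) (lam\<^sub>0 :: real) (u\<^sub>0 :: real^'n \<Rightarrow> real) (\<sigma> :: real).
      (\<forall>j. Ck_closure 3 \<Omega> (\<lambda>x. B x $ j)) \<longrightarrow>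
      Ck_closure 2 \<Omega> c \<longrightarrow>
      (\<forall>x\<in>closure \<Omega>. c x \<ge> 0) \<longrightarrow>
      (\<forall>x\<in>\<Omega>. norm_d_beta B x \<le> K * infdist x (frontier \<Omega>)) \<longrightarrow>
      principal_eigenpair \<Omega> B c lam\<^sub>0 u\<^sub>0 \<longrightarrow>
      \<sigma> = \<Phi> (\<lambda>j. Ck_norm 2 \<Omega> (\<lambda>x. B x $ j)) (\<lambda>j. Ck_norm 1 \<Omega> (laplacian (\<lambda>x. B x $ j)))
             (Ck_norm 2 \<Omega> c) K
             (delta0 \<Omega> u\<^sub>0) (theta0 \<Omega> u\<^sub>0) (Ck_norm 1 \<Omega> (grad u\<^sub>0)) \<longrightarrow>
      \<sigma> > 0 \<and>
      (\<exists>\<mu>\<^sub>0 \<mu>\<^sub>1. sl_first_two_eigenvalues D \<sigma> \<mu>\<^sub>0 \<mu>\<^sub>1 \<and>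
         (\<forall>lam. dirichlet_eigenvalue \<Omega> B c lam \<and> lam \<noteq> of_real lam\<^sub>0 \<longrightarrow>
            Re lam - lam\<^sub>0 > (1/4) * (\<mu>\<^sub>1 - \<mu>\<^sub>0)) \<and>
         (1/4) * (\<mu>\<^sub>1 - \<mu>\<^sub>0) > 0)"
proof -
  define gap where "gap = (\<lambda>(b :: 'n \<Rightarrow> real) \<delta> \<theta> g.
    gap_const D (4 * concavity_const (real CARD('n) * g) g \<delta> \<theta> + 2 * (\<Sum>j\<in>UNIV. b j)))"
  define good where "good = (\<lambda>\<epsilon> \<sigma>. \<sigma> > 0 \<and>
    (\<exists>\<mu>0 \<mu>1. sl_first_two_eigenvalues D \<sigma> \<mu>0 \<mu>1 \<and> (1/4) * (\<mu>1 - \<mu>0) < \<epsilon>))"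
  define \<Phi> where "\<Phi> = (\<lambda>(b :: 'n \<Rightarrow> real) (l :: 'n \<Rightarrow> real) (cn :: real) (K :: real) \<delta> \<theta> g.
    SOME \<sigma>. good (gap b \<delta> \<theta> g) \<sigma>)"
  have Dpos: "D > 0" using diameter_open_pos assms by blast
  have good: "good (gap b \<delta> \<theta> g) (\<Phi> b l cn K \<delta> \<theta> g)" for b l cn K \<delta> \<theta> g
  proof -
    have "\<exists>\<sigma>. good (gap b \<delta> \<theta> g) \<sigma>"
      using sl_gap_small[OF Dpos gap_const_pos] unfolding good_def gap_def by blast
    then show ?thesis unfolding \<Phi>_def by (rule someI_ex)
  qed
  show ?thesis
  proof (intro exI[of _ \<Phi>] allI impI)
    fix B :: "real^'n \<Rightarrow> real^'n" and c :: "real^'n \<Rightarrow> real" and K lam0 :: real and u0 :: "real^'n \<Rightarrow> real" and \<sigma> :: real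
    assume B: "\<forall>j. Ck_closure 3 \<Omega> (\<lambda>x. B x $ j)" and c: "Ck_closure 2 \<Omega> c" "\<forall>x\<in>closure \<Omega>. c x \<ge> 0"
      and pair: "principal_eigenpair \<Omega> B c lam0 u0"
      and \<sigma>: "\<sigma> = \<Phi> (\<lambda>j. Ck_norm 2 \<Omega> (\<lambda>x. B x $ j)) (\<lambda>j. Ck_norm 1 \<Omega> (laplacian (\<lambda>x. B x $ j)))
             (Ck_norm 2 \<Omega> c) K (delta0 \<Omega> u0) (theta0 \<Omega> u0) (Ck_norm 1 \<Omega> (grad u0))"
    interpret principal_pair \<Omega> B c lam0 u0
    proof
      show "convex \<Omega>" by (rule strictly_convex_imp_convex[OF assms(5,1)])
      show "\<And>x. x \<in> \<Omega> \<Longrightarrow> 0 \<le> c x" using c closure_subset by blast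
    qed (use assms B c pair in auto)
    have gap: "gap (\<lambda>j. Ck_norm 2 \<Omega> (\<lambda>x. B x $ j)) (delta0 \<Omega> u0) (theta0 \<Omega> u0) (Ck_norm 1 \<Omega> (grad u0))
       = gap_const D drift_const"
      by (simp add: gap_def drift_const_def log_grad_const_def hess_bound_def)
    have "good (gap_const D drift_const) \<sigma>" unfolding gap[symmetric] \<sigma> by (rule good)
    then obtain \<mu>0 \<mu>1 where \<mu>: "\<sigma> > 0" "sl_first_two_eigenvalues D \<sigma> \<mu>0 \<mu>1"
      "(1/4) * (\<mu>1 - \<mu>0) < gap_const D drift_const"
      unfolding good_def by blast
    have diam: "dist x y \<le> D" if "x \<in> \<Omega>" "y \<in> \<Omega>" for x y
      using that assms by (simp add: diameter_bounded_bound)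
    have "Re lam - lam0 > (1/4) * (\<mu>1 - \<mu>0)" if ev: "dirichlet_eigenvalue \<Omega> B c lam" and ne: "lam \<noteq> of_real lam0" for lam
    proof -
      obtain u where "dirichlet_eigenfunction \<Omega> B c lam u" using ev unfolding dirichlet_eigenvalue_def by blast
      from spectral_gap[OF this ne diam] show ?thesis using \<mu>(3) by linarith
    qed
    moreover have "(1/4) * (\<mu>1 - \<mu>0) > 0" using \<mu>(2) by (simp add: sl_first_two_eigenvalues_def)
    ultimately show "\<sigma> > 0 \<and> (\<exists>\<mu>\<^sub>0 \<mu>\<^sub>1. sl_first_two_eigenvalues D \<sigma> \<mu>\<^sub>0 \<mu>\<^sub>1 \<and>
         (\<forall>lam. dirichlet_eigenvalue \<Omega> B c lam \<and> lam \<noteq> of_real lam0 \<longrightarrow>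
            Re lam - lam0 > (1/4) * (\<mu>\<^sub>1 - \<mu>\<^sub>0)) \<and> (1/4) * (\<mu>\<^sub>1 - \<mu>\<^sub>0) > 0)"
      using \<mu>(1,2) by blast
  qed
qed

end
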